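(* Let $B_n$ be endowed with the dual Garside structure, let $n=rd+1$ for integers $r\geqslant 2$ and $d\geqslant 1$, and let $\varepsilon=\delta a_{21}$. Then the cardinality of the super summit set $[\varepsilon^d]^S$ is $$nZ_d(r)=\frac{n}{d}\binom{dr}{d-1}=\frac{n}{d}\binom{n-1}{d-1},$$ where $Z_d(r)$ is the number of multichains $1\preccurlyeq a_1\preccurlyeq\cdots\preccurlyeq a_{r-1}\preccurlyeq[d,d-1,\ldots,1]$ of simple elements.
   Context: $B_n$ has band generators $a_{ij}$ ($1\le j<i\le n$), $a_{ij}=\sigma_{i-1}\cdots\sigma_{j+1}\sigma_j\sigma_{j+1}^{-1}\cdots\sigma_{i-1}^{-1}$. The dual Garside structure is $(B_n,B_n^+,\delta)$ with $B_n^+$ the monoid of positive words in band generators and $\delta=a_{n,n-1}\cdots a_{21}=\sigma_{n-1}\cdots\sigma_1$. $\alpha\preccurlyeq\beta$ iff $\alpha^{-1}\beta\in B_n^+$; simple elements are those $\alpha$ with $1\preccurlyeq\alpha\preccurlyeq\delta$. $\inf(\alpha)=\max\{r:\delta^r\preccurlyeq\alpha\}$, $\sup(\alpha)=\min\{s:\alpha\preccurlyeq\delta^s\}$, $\operatorname{len}=\sup-\inf$, and the super summit set $[\alpha]^S$ is the set of conjugates of $\alpha$ of minimal $\operatorname{len}$. For $1\le i_1<\cdots<i_k\le n$, $[i_k,\ldots,i_1]=a_{i_ki_{k-1}}\cdots a_{i_2i_1}$. *)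

theory Defs
  imports Complex_Main
begin

text \<open>Braid group B_n given by its standard Artin presentation.
A word is a list of letters (i, True) = sigma_i and (i, False) = sigma_i^-1, 1 <= i < n.
Group elements are equivalence classes of such words.\<close>

type_synonym bword = "(nat \<times> bool) list"

definition letter_ok :: "nat \<Rightarrow> nat \<times> bool \<Rightarrow> bool" where
  "letter_ok n l \<longleftrightarrow> 1 \<le> fst l \<and> fst l < n"

definition bwords :: "nat \<Rightarrow> bword set" where
  "bwords n = {w. \<forall>l\<in>set w. letter_ok n l}"

inductive beq :: "nat \<Rightarrow> bword \<Rightarrow> bword \<Rightarrow> bool" for n where
  beq_refl: "beq n w w"
| beq_sym: "beq n u v \<Longrightarrow> beq n v u"
| beq_trans: "beq n u v \<Longrightarrow> beq n v w \<Longrightarrow> beq n u w"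
| beq_cancel: "1 \<le> i \<Longrightarrow> i < n \<Longrightarrow>
    beq n (u @ [(i, b), (i, \<not> b)] @ v) (u @ v)"
| beq_comm: "1 \<le> i \<Longrightarrow> i + 1 < j \<Longrightarrow> j < n \<Longrightarrow>
    beq n (u @ [(i, True), (j, True)] @ v) (u @ [(j, True), (i, True)] @ v)"
| beq_braid: "1 \<le> i \<Longrightarrow> i + 1 < n \<Longrightarrow>
    beq n (u @ [(i, True), (i + 1, True), (i, True)] @ v)
          (u @ [(i + 1, True), (i, True), (i + 1, True)] @ v)"

definition belt :: "nat \<Rightarrow> bword \<Rightarrow> bword set" where
  "belt n w = {v \<in> bwords n. beq n w v}"

definition braid_group :: "nat \<Rightarrow> bword set set" where
  "braid_group n = belt n ` bwords n"

definition winv :: "bword \<Rightarrow> bword" where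
  "winv w = rev (map (\<lambda>(i, b). (i, \<not> b)) w)"

definition band :: "nat \<Rightarrow> nat \<Rightarrow> bword" where
  "band i j = map (\<lambda>k. (k, True)) (rev [j+1..<i]) @ [(j, True)]
              @ map (\<lambda>k. (k, False)) [j+1..<i]"

definition dual_pos :: "nat \<Rightarrow> bword \<Rightarrow> bool" where
  "dual_pos n w \<longleftrightarrow> (\<exists>ps. (\<forall>(i, j)\<in>set ps. 1 \<le> j \<and> j < i \<and> i \<le> n)
                          \<and> beq n w (concat (map (\<lambda>(i, j). band i j) ps)))"

definition dprec :: "nat \<Rightarrow> bword \<Rightarrow> bword \<Rightarrow> bool" where
  "dprec n u v \<longleftrightarrow> dual_pos n (winv u @ v)"

text \<open>delta = a_(n,n-1) ... a_21 = sigma_(n-1) ... sigma_1.\<close>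
definition ddelta :: "nat \<Rightarrow> bword" where
  "ddelta n = map (\<lambda>k. (k, True)) (rev [1..<n])"

definition wpow :: "bword \<Rightarrow> int \<Rightarrow> bword" where
  "wpow w r = (if 0 \<le> r then concat (replicate (nat r) w)
               else concat (replicate (nat (- r)) (winv w)))"

definition dinf :: "nat \<Rightarrow> bword \<Rightarrow> int" where
  "dinf n w = (GREATEST r. dprec n (wpow (ddelta n) r) w)"

definition dsup :: "nat \<Rightarrow> bword \<Rightarrow> int" where
  "dsup n w = (LEAST s. dprec n w (wpow (ddelta n) s))"

definition dlen :: "nat \<Rightarrow> bword \<Rightarrow> int" where
  "dlen n w = dsup n w - dinf n w"

definition conjugates :: "nat \<Rightarrow> bword \<Rightarrow> bword set" where
  "conjugates n w = {c @ w @ winv c | c. c \<in> bwords n}"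

definition super_summit :: "nat \<Rightarrow> bword \<Rightarrow> bword set set" where
  "super_summit n w =
     belt n ` {x \<in> conjugates n w.
                dlen n x = (LEAST m. \<exists>y \<in> conjugates n w. m = dlen n y)}"

definition simple :: "nat \<Rightarrow> bword \<Rightarrow> bool" where
  "simple n a \<longleftrightarrow> dprec n [] a \<and> dprec n a (ddelta n)"

text \<open>The prefix order lifted to group elements (well defined on classes).\<close>
definition eprec :: "nat \<Rightarrow> bword set \<Rightarrow> bword set \<Rightarrow> bool" where
  "eprec n A B \<longleftrightarrow> (\<exists>a\<in>A. \<exists>b\<in>B. dprec n a b)"

text \<open>[i_k, ..., i_1] = a_(i_k i_(k-1)) ... a_(i_2 i_1), for an increasing list [i_1,...,i_k].\<close>
definition bracket :: "nat list \<Rightarrow> bword" where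
  "bracket is = concat (rev (map (\<lambda>k. band (is ! (k + 1)) (is ! k)) [0..<length is - 1]))"

definition multichains :: "nat \<Rightarrow> nat \<Rightarrow> bword \<Rightarrow> bword set list set" where
  "multichains n r tw =
     {as. length as = r - 1 \<and> set as \<subseteq> braid_group n
          \<and> (\<forall>A\<in>set as. \<exists>a\<in>A. simple n a)
          \<and> successively (eprec n) (belt n [] # as @ [belt n tw])}"

definition Zd :: "nat \<Rightarrow> nat \<Rightarrow> nat \<Rightarrow> nat" where
  "Zd n d r = card (multichains n r (bracket [1..<d+1]))"

end

theory Submission
  imports Defs "HOL-Combinatorics.Orbits"
begin

text \<open>
  Exponent sums show that the super summit set consists of the conjugates \<open>\<delta>\<^sup>d a\<close> of \<open>\<epsilon>\<^sup>d\<close> with \<open>a\<close>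
  simple of length \<open>d\<close>. A simple element is determined by its permutation, because all shortest
  factorisations of the cycle \<open>c\<close> into transpositions lift to the same product of band generators,
  namely \<open>\<delta>\<close>: a factorisation can be moved to the standard one by relations between neighbouring
  letters, which are noncrossing. Put \<open>C = c\<^sup>d\<close>, again an \<open>n\<close>-cycle. Since \<open>\<epsilon>\<^bsup>dr\<^esup> = \<delta>\<^sup>n\<close> is
  central, the permutation \<open>g\<close> of \<open>\<delta>\<^sup>d a\<close> satisfies \<open>g\<^sup>r = 1\<close>, and \<open>C\<^sup>-\<^sup>1 g\<close> is a product of \<open>d\<close>
  transpositions. Conversely such a \<open>g\<close> has at most \<open>d + 1\<close> cycles, hence exactly one fixed point and
  \<open>d\<close> cycles of length \<open>r\<close>, and it is a noncrossing partition for \<open>C\<close>. Counting these by the recursion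
  of the Fuss-Catalan numbers gives \<open>n choose d\<close>.

  Every such \<open>g\<close> comes from the super summit set: rotate its fixed point to \<open>0\<close>; then \<open>g\<close> moves each
  block of \<open>d\<close> consecutive points to the previous one, and conjugation by a band generator (partial
  cycling) pushes the letters of \<open>a\<close> from block to block until they all lie in the lowest one. The
  permutations \<open>a\<close> induces on the \<open>r\<close> blocks are the quotients of a multichain, so the \<open>g\<close> fixing
  \<open>0\<close> are counted by \<open>Z\<^sub>d(r)\<close>.
\<close>

section \<open>Cycle counts and products of transpositions\<close>

text \<open>Two cycles are in play, and each argument suits only one of them. Counting by deletion
  of the last point needs the standard cycle \<open>c\<close>, while the permutations
  \<open>g\<close> are noncrossing for \<open>C\<close>. As \<open>r * d\<close> is
  \<open>-1\<close> modulo \<open>n\<close>, multiplication by \<open>d\<close> renumbers the points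
  so that \<open>c\<close> becomes \<open>C\<close>, and the residue of a point modulo
  \<open>r\<close> becomes the number of its block of \<open>d\<close> consecutive points. That
  \<open>g\<close> moves blocks down is therefore a statement about residues, proved along the
  recursion that also counts. This recursion merges cycles, so it runs in a larger family in which
  the cycle of \<open>0\<close> has any length \<open>k\<close>. Simplicity of \<open>a\<close>
  requires that its permutation divide \<open>c\<close>, not \<open>C\<close>. The link is
  \<open>n = d * r + 1\<close>, by which \<open>g ^^ r = id\<close> unfolds to a factorisation of
  \<open>c\<close> starting with the permutation of \<open>a\<close>. Conjugacy is settled by a
  normal form: once all letters lie in the lowest block, \<open>g ^^ r = id\<close> leaves no choice
  there.\<close>

lemma orbit_eq_of_mem:
  assumes "permutation p" "y \<in> orbit p x"
  shows "orbit p y = orbit p x"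
  using orbit_cyclic_eq3[OF cyclic_on_orbit'[OF assms(1)] assms(2)] .

lemma orbit_subset_invariant:
  assumes "x \<in> A" "\<And>y. y \<in> A \<Longrightarrow> p y \<in> A"
  shows "orbit p x \<subseteq> A"
proof
  fix y assume "y \<in> orbit p x"
  then show "y \<in> A" by induction (use assms in auto)
qed

lemma permutation_comp_transpose:
  "permutation p \<Longrightarrow> permutation (p \<circ> transpose a b)"
  by (intro permutation_compose permutation_swap_id)

lemma orbit_comp_transpose_other:
  assumes "permutation p" "x \<notin> orbit p a" "x \<notin> orbit p b"
  shows "orbit (p \<circ> transpose a b) x = orbit p x"
proof (rule orbit_cong)
  show "x \<in> orbit p x" using assms(1) by (rule permutation_self_in_orbit)
  fix s assume s: "s \<in> orbit p x"
  have "s \<noteq> a" "s \<noteq> b"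
    using s assms by (auto dest: orbit_swap[OF permutation_self_in_orbit[OF assms(1)]])
  then show "(p \<circ> transpose a b) s = p s" by simp
qed

text \<open>On the cycle of \<open>b\<close> the new permutation agrees with \<open>p\<close> except
  at \<open>b\<close>, and it enters that cycle because \<open>a\<close> is now sent to
  \<open>p b\<close>.\<close>

lemma orbit_subset_orbit_comp_transpose:
  assumes "permutation p" "b \<notin> orbit p a"
  shows "orbit p b \<subseteq> orbit (p \<circ> transpose a b) a"
proof
  fix y assume y: "y \<in> orbit p b"
  have base: "p b \<in> orbit (p \<circ> transpose a b) a"
    using orbit.base[of "p \<circ> transpose a b" a] by simp
  from y show "y \<in> orbit (p \<circ> transpose a b) a"
  proof induction
    case base
    then show ?case by (fact base)
  next
    case (step y)
    have "y \<noteq> a"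
      using step.hyps assms by (auto dest: orbit_swap[OF permutation_self_in_orbit[OF assms(1)]])
    then have "p y = (p \<circ> transpose a b) y" if "y \<noteq> b"
      using that by simp
    then show ?case
      using base orbit.step[OF step.IH] by (cases "y = b") (simp_all del: comp_apply)
  qed
qed

lemma orbit_comp_transpose_merge:
  assumes "permutation p" "b \<notin> orbit p a"
  shows "orbit (p \<circ> transpose a b) a = orbit p a \<union> orbit p b"
    and "orbit (p \<circ> transpose a b) b = orbit p a \<union> orbit p b"
proof -
  let ?q = "p \<circ> transpose a b"
  have q: "permutation ?q" by (rule permutation_comp_transpose[OF assms(1)])
  have selfp: "\<And>x. x \<in> orbit p x" by (rule permutation_self_in_orbit[OF assms(1)])
  have nab: "a \<notin> orbit p b"
    using assms(2) orbit_swap[OF selfp, of a b] by blast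
  have 1: "orbit p b \<subseteq> orbit ?q a" by (rule orbit_subset_orbit_comp_transpose[OF assms])
  have 2: "orbit p a \<subseteq> orbit ?q b"
    using orbit_subset_orbit_comp_transpose[OF assms(1) nab] by (simp add: transpose_commute)
  have eq: "orbit ?q b = orbit ?q a"
    using 1 selfp orbit_eq_of_mem[OF q] by blast
  have "orbit ?q a \<subseteq> orbit p a \<union> orbit p b"
  proof (rule orbit_subset_invariant)
    show "a \<in> orbit p a \<union> orbit p b" using selfp by blast
    fix y assume "y \<in> orbit p a \<union> orbit p b"
    then show "?q y \<in> orbit p a \<union> orbit p b"
      by (cases "y = a"; cases "y = b") (auto intro: orbit.intros)
  qed
  with 1 2 eq show "orbit ?q a = orbit p a \<union> orbit p b" "orbit ?q b = orbit p a \<union> orbit p b"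
    by auto
qed

lemma card_orbit_funpow:
  assumes "permutation p"
  shows "(p ^^ card (orbit p a)) a = a"
    and "inj_on (\<lambda>i. (p ^^ i) a) {..<card (orbit p a)}"
    and "card (orbit p a) > 0"
proof -
  have self: "a \<in> orbit p a" using assms by (rule permutation_self_in_orbit)
  have inj: "inj_on (\<lambda>n. (p ^^ n) a) {0..<funpow_dist1 p a a}"
    by (rule inj_on_funpow_dist1[OF self])
  have "card (orbit p a) = funpow_dist1 p a a"
    using orbit_conv_funpow_dist1[OF self] card_image[OF inj] by simp
  then show "(p ^^ card (orbit p a)) a = a" "inj_on (\<lambda>i. (p ^^ i) a) {..<card (orbit p a)}"
    "card (orbit p a) > 0"
    using funpow_dist1_prop[OF self] inj by (auto simp: lessThan_atLeast0)
qed

text \<open>The transposition redirects \<open>(p ^^ k) a\<close> to \<open>p a\<close>, so the arc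
  from \<open>p a\<close> to \<open>(p ^^ k) a\<close> closes up. Knowing this arc explicitly allows
  a cycle of prescribed length to be cut off later.\<close>

lemma orbit_comp_transpose_split:
  assumes p: "permutation p" and k: "0 < k" "k < card (orbit p a)"
  defines "q \<equiv> p \<circ> transpose a ((p ^^ k) a)"
  shows "orbit q ((p ^^ k) a) = (\<lambda>i. (p ^^ i) a) ` {1..k}"
    and "card (orbit q ((p ^^ k) a)) = k"
    and "(p ^^ k) a \<notin> orbit q a"
proof -
  let ?b = "(p ^^ k) a"
  let ?c = "card (orbit p a)"
  have inj: "inj_on (\<lambda>i. (p ^^ i) a) {..<?c}" by (rule card_orbit_funpow[OF p])
  have ne: "(p ^^ i) a \<noteq> (p ^^ j) a" if "i < ?c" "j < ?c" "i \<noteq> j" for i j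
    using inj_onD[OF inj, of i j] that by auto
  have q: "permutation q" unfolding q_def by (rule permutation_comp_transpose[OF p])
  have step: "q ((p ^^ i) a) = (p ^^ Suc i) a" if "0 < i" "i < k" for i
  proof -
    have "(p ^^ i) a \<noteq> a" using ne[of i 0] that k by simp
    moreover have "(p ^^ i) a \<noteq> ?b" using ne[of i k] that k by simp
    ultimately show ?thesis by (simp add: q_def)
  qed
  have stepk: "q ?b = p a" by (simp add: q_def)
  have mem: "(p ^^ i) a \<in> orbit q ?b" if "0 < i" "i \<le> k" for i
    using that
  proof (induction i)
    case (Suc i)
    show ?case
    proof (cases "i = 0")
      case True
      then show ?thesis using orbit.base[of q ?b] stepk by simp
    next
      case False
      then show ?thesis using orbit.step[OF Suc.IH] step[of i] Suc.prems by simp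
    qed
  qed simp
  have "orbit q ?b \<subseteq> (\<lambda>i. (p ^^ i) a) ` {1..k}"
  proof (rule orbit_subset_invariant)
    show "?b \<in> (\<lambda>i. (p ^^ i) a) ` {1..k}" using k by auto
    fix y assume "y \<in> (\<lambda>i. (p ^^ i) a) ` {1..k}"
    then obtain i where i: "1 \<le> i" "i \<le> k" "y = (p ^^ i) a" by auto
    show "q y \<in> (\<lambda>i. (p ^^ i) a) ` {1..k}"
    proof (cases "i = k")
      case True
      then have "q y = (p ^^ 1) a" using i stepk by simp
      then show ?thesis using k by force
    next
      case False
      then have "q y = (p ^^ Suc i) a" "Suc i \<in> {1..k}" using i step[of i] by auto
      then show ?thesis by blast
    qed
  qed
  then show eq: "orbit q ?b = (\<lambda>i. (p ^^ i) a) ` {1..k}" using mem by auto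
  have "inj_on (\<lambda>i. (p ^^ i) a) {1..k}"
    by (rule inj_on_subset[OF inj]) (use k in auto)
  then show "card (orbit q ?b) = k" using eq card_image by fastforce
  have "a \<notin> orbit q ?b" unfolding eq using ne[of 0] k by (auto simp del: funpow.simps)
  then show "?b \<notin> orbit q a"
    using orbit_swap[OF permutation_self_in_orbit[OF q]] by blast
qed

lemma orbit_obtain_funpow:
  assumes p: "permutation p" and "b \<in> orbit p a" "a \<noteq> b"
  obtains k where "0 < k" "k < card (orbit p a)" "b = (p ^^ k) a"
proof -
  have "b \<in> {(p ^^ m) a | m. m < card (orbit p a)}"
    using assms(2) orbit_altdef_bounded[of "card (orbit p a)" p a] card_orbit_funpow[OF p, of a]
    by simp
  then obtain k where "k < card (orbit p a)" "b = (p ^^ k) a" by auto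
  moreover have "0 < k" using assms(3) calculation by (cases k) auto
  ultimately show thesis using that by blast
qed

text \<open>Fixed points count as cycles, so \<open>card S - ncyc S p\<close> is the reflection
  length of a permutation \<open>p\<close> of a finite \<open>S\<close>: the least number of
  transpositions with product \<open>p\<close>.\<close>

definition ncyc :: "'a set \<Rightarrow> ('a \<Rightarrow> 'a) \<Rightarrow> nat" where
  "ncyc S p = card (orbit p ` S)"

lemma ncyc_merge:
  assumes S: "finite S" "p permutes S" "a \<in> S" "b \<in> S" and nb: "b \<notin> orbit p a"
  shows "ncyc S p = Suc (ncyc S (p \<circ> transpose a b))"
proof -
  let ?q = "p \<circ> transpose a b"
  let ?U = "orbit p a \<union> orbit p b"
  have p: "permutation p" using S permutation_permutes by blast
  have self: "\<And>x. x \<in> orbit p x" by (rule permutation_self_in_orbit[OF p])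
  let ?O = "orbit p ` S - {orbit p a, orbit p b}"
  have other: "x \<notin> ?U \<longleftrightarrow> orbit p x \<noteq> orbit p a \<and> orbit p x \<noteq> orbit p b" for x
    using self orbit_eq_of_mem[OF p] by blast
  have qU: "orbit ?q x = ?U" if "x \<in> ?U" for x
    using orbit_comp_transpose_merge[OF p nb] that
      orbit_eq_of_mem[OF permutation_comp_transpose[OF p]] by metis
  have qO: "orbit ?q x = orbit p x" if "x \<notin> ?U" for x
    using orbit_comp_transpose_other[OF p] that by blast
  have im: "orbit ?q ` S = insert ?U ?O"
  proof (intro equalityI subsetI)
    fix X assume "X \<in> orbit ?q ` S"
    then obtain x where x: "x \<in> S" "X = orbit ?q x" by blast
    show "X \<in> insert ?U ?O"
    proof (cases "x \<in> ?U")
      case True then show ?thesis using qU x by blast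
    next
      case False then show ?thesis using qO[OF False] other[of x] x by blast
    qed
  next
    fix X assume "X \<in> insert ?U ?O"
    then consider "X = ?U" | "X \<in> ?O" by blast
    then show "X \<in> orbit ?q ` S"
    proof cases
      case 1
      have "a \<in> ?U" using self by blast
      then show ?thesis using 1 qU S(3) by (metis imageI)
    next
      case 2
      then obtain x where "x \<in> S" "X = orbit p x" "x \<notin> ?U" using other by blast
      then show ?thesis using qO by blast
    qed
  qed
  have "?U \<notin> ?O"
  proof
    assume "?U \<in> ?O"
    then obtain x where x: "x \<in> S" "?U = orbit p x" "?U \<noteq> orbit p a" by blast
    then have "a \<in> orbit p x" using self by blast
    then show False using x orbit_eq_of_mem[OF p] by metis
  qed
  moreover have "finite ?O" using S by simp
  ultimately have "card (orbit ?q ` S) = Suc (card ?O)" unfolding im by simp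
  moreover have "orbit p a \<noteq> orbit p b" using self nb by blast
  then have "card (orbit p ` S) = Suc (Suc (card ?O))"
    using S card_Diff_subset[of "{orbit p a, orbit p b}" "orbit p ` S"]
      card_mono[of "orbit p ` S" "{orbit p a, orbit p b}"] by auto
  ultimately show ?thesis by (simp add: ncyc_def)
qed

text \<open>Merging read backwards: the transposition is an involution, so it joins the two parts
  again.\<close>

lemma ncyc_split:
  assumes S: "finite S" "p permutes S" "a \<in> S" "b \<in> S" and b: "a \<noteq> b" "b \<in> orbit p a"
  shows "ncyc S (p \<circ> transpose a b) = Suc (ncyc S p)"
proof -
  have p: "permutation p" using S permutation_permutes by blast
  obtain k where k: "0 < k" "k < card (orbit p a)" "b = (p ^^ k) a"
    using orbit_obtain_funpow[OF p b(2,1)] .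
  have "b \<notin> orbit (p \<circ> transpose a b) a"
    using orbit_comp_transpose_split(3)[OF p k(1,2)] k(3) by simp
  moreover have "p \<circ> transpose a b permutes S"
    using S by (intro permutes_compose permutes_swap_id)
  ultimately have "ncyc S (p \<circ> transpose a b)
      = Suc (ncyc S (p \<circ> transpose a b \<circ> transpose a b))"
    using S by (intro ncyc_merge)
  then show ?thesis by (simp add: comp_assoc)
qed

lemma ncyc_image:
  assumes p: "finite S" "p permutes S" and f: "inj_on f S" "\<And>x. x \<in> S \<Longrightarrow> q (f x) = f (p x)"
  shows "ncyc (f ` S) q = ncyc S p"
proof -
  have perm: "permutation p" using p permutation_permutes by blast
  have orb: "orbit q (f x) = f ` orbit p x" if "x \<in> S" for x
    using orbit_inverse[OF permutation_self_in_orbit[OF perm, of x], of q f] f(2)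
      permutes_orbit_subset[OF p(2) that] by (metis subsetD)
  have "orbit q ` f ` S = (`) f ` (orbit p ` S)"
    unfolding image_image using orb by (intro image_cong) auto
  moreover have "inj_on ((`) f) (orbit p ` S)"
  proof (rule inj_onI)
    fix X Y assume XY: "X \<in> orbit p ` S" "Y \<in> orbit p ` S" "f ` X = f ` Y"
    then have "X \<subseteq> S" "Y \<subseteq> S" using permutes_orbit_subset[OF p(2)] by auto
    then show "X = Y" using XY(3) inj_on_image_eq_iff[OF f(1)] by blast
  qed
  ultimately show ?thesis by (simp add: ncyc_def card_image)
qed

text \<open>\<open>q\<close> conjugates \<open>p \<circ> q\<close> into \<open>q \<circ> p\<close>,
  and relabelling preserves the cycle type.\<close>

lemma ncyc_comp_commute:
  assumes "finite S" "p permutes S" "q permutes S"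
  shows "ncyc S (p \<circ> q) = ncyc S (q \<circ> p)"
proof -
  have "ncyc (q ` S) (q \<circ> p) = ncyc S (p \<circ> q)"
    using assms by (intro ncyc_image) (auto intro: permutes_compose permutes_inj_on)
  then show ?thesis using permutes_image[OF assms(3)] by simp
qed

lemma ncyc_inv:
  assumes "finite S" "p permutes S"
  shows "ncyc S (inv p) = ncyc S p"
proof -
  have "permutation p" using assms permutation_permutes by blast
  then show ?thesis by (simp add: ncyc_def orbit_inv_eq fun_eq_iff cong: image_cong)
qed

lemma ncyc_merge_left:
  assumes "finite S" "p permutes S" "a \<in> S" "b \<in> S" "b \<notin> orbit p a"
  shows "ncyc S p = Suc (ncyc S (transpose a b \<circ> p))"
  using ncyc_merge[OF assms] ncyc_comp_commute[OF assms(1,2) permutes_swap_id[OF assms(3,4)]]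
  by simp

lemma ncyc_split_left:
  assumes "finite S" "p permutes S" "a \<in> S" "b \<in> S" "a \<noteq> b" "b \<in> orbit p a"
  shows "ncyc S (transpose a b \<circ> p) = Suc (ncyc S p)"
  using ncyc_split[OF assms] ncyc_comp_commute[OF assms(1,2) permutes_swap_id[OF assms(3,4)]]
  by simp

lemma ncyc_id: "ncyc S id = card S"
proof -
  have "orbit id x = {x}" for x :: 'a by (simp add: orbit_eq_singleton_iff)
  then have "orbit id = (\<lambda>x :: 'a. {x})" by auto
  then show ?thesis by (simp add: ncyc_def card_image)
qed

lemma ncyc_le_card: "finite S \<Longrightarrow> ncyc S p \<le> card S"
  by (simp add: ncyc_def card_image_le)

lemma ncyc_disjoint_UN:
  assumes "finite I" "\<And>i. i \<in> I \<Longrightarrow> finite (A i)"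
    and "\<And>i x. i \<in> I \<Longrightarrow> x \<in> A i \<Longrightarrow> p x \<in> A i"
    and "\<And>i j. i \<in> I \<Longrightarrow> j \<in> I \<Longrightarrow> i \<noteq> j \<Longrightarrow> A i \<inter> A j = {}"
  shows "ncyc (\<Union>i\<in>I. A i) p = (\<Sum>i\<in>I. ncyc (A i) p)"
proof -
  have sub: "X \<subseteq> A i" "X \<noteq> {}" if "i \<in> I" "X \<in> orbit p ` A i" for i X
  proof -
    have "orbit p x \<subseteq> A i" if "x \<in> A i" for x
      by (rule orbit_subset_invariant[OF that assms(3)[OF \<open>i \<in> I\<close>]])
    then show "X \<subseteq> A i" "X \<noteq> {}" using that orbit_nonempty[of p] by auto
  qed
  have "(orbit p ` A i) \<inter> (orbit p ` A j) = {}" if "i \<in> I" "j \<in> I" "i \<noteq> j" for i j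
  proof (rule equals0I)
    fix X assume "X \<in> (orbit p ` A i) \<inter> (orbit p ` A j)"
    then have "X \<subseteq> A i \<inter> A j" "X \<noteq> {}" using sub[OF that(1)] sub[OF that(2)] by auto
    then show False using assms(4)[OF that] by simp
  qed
  then show ?thesis
    unfolding ncyc_def image_UN
    by (intro card_UN_disjoint) (simp_all add: assms(1,2))
qed

lemma ncyc_insert_fixpoint:
  assumes "finite S" "p permutes S" "x \<notin> S"
  shows "ncyc (insert x S) p = Suc (ncyc S p)"
proof -
  have "p x = x" using assms(2,3) by (simp add: permutes_not_in)
  then have "orbit p x = {x}" by (simp add: orbit_eq_singleton_iff)
  moreover have ne: "{x} \<noteq> orbit p y" if "y \<in> S" for y
    using permutes_orbit_subset[OF assms(2) that] assms(3) by auto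
  have "{x} \<notin> orbit p ` S"
  proof
    assume "{x} \<in> orbit p ` S"
    then obtain y where "y \<in> S" "{x} = orbit p y" by (rule imageE)
    then show False using ne by simp
  qed
  ultimately show ?thesis using assms(1) by (simp add: ncyc_def)
qed

lemma ncyc_transpose_bounds:
  assumes "finite S" "p permutes S" "a \<in> S" "b \<in> S"
  shows "ncyc S p \<le> Suc (ncyc S (p \<circ> transpose a b))"
    and "ncyc S (p \<circ> transpose a b) \<le> Suc (ncyc S p)"
proof -
  consider "a = b" | "a \<noteq> b" "b \<in> orbit p a" | "b \<notin> orbit p a" by blast
  then have "ncyc S p \<le> Suc (ncyc S (p \<circ> transpose a b)) \<and>
      ncyc S (p \<circ> transpose a b) \<le> Suc (ncyc S p)"
  proof cases
    case 1 then show ?thesis by simp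
  next
    case 2 then show ?thesis using ncyc_split[OF assms 2] by linarith
  next
    case 3 then show ?thesis using ncyc_merge[OF assms 3] by linarith
  qed
  then show "ncyc S p \<le> Suc (ncyc S (p \<circ> transpose a b))"
    "ncyc S (p \<circ> transpose a b) \<le> Suc (ncyc S p)" by auto
qed

section \<open>Factorisations into transpositions and the reflection length\<close>

definition transps_on :: "'a set \<Rightarrow> ('a \<times> 'a) list \<Rightarrow> bool" where
  "transps_on S ts \<longleftrightarrow> (\<forall>(a, b) \<in> set ts. a \<in> S \<and> b \<in> S \<and> a \<noteq> b)"

lemma transps_on_simps [simp]:
  "transps_on S []"
  "transps_on S ((a, b) # ts) \<longleftrightarrow> a \<in> S \<and> b \<in> S \<and> a \<noteq> b \<and> transps_on S ts"
  "transps_on S (ts @ us) \<longleftrightarrow> transps_on S ts \<and> transps_on S us"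
  by (auto simp: transps_on_def)

lemma transps_on_permutes: "transps_on S ts \<Longrightarrow> apply_transps ts permutes S"
  by (rule permutes_apply_transps) (auto simp: transps_on_def)

lemma ncyc_transps_bounds:
  assumes "finite S" "p permutes S" "transps_on S ts"
  shows "ncyc S p \<le> ncyc S (p \<circ> apply_transps ts) + length ts"
    and "ncyc S (p \<circ> apply_transps ts) \<le> ncyc S p + length ts"
proof -
  have "ncyc S p \<le> ncyc S (p \<circ> apply_transps ts) + length ts \<and>
    ncyc S (p \<circ> apply_transps ts) \<le> ncyc S p + length ts"
    using assms(2,3)
  proof (induction ts arbitrary: p)
    case (Cons t ts)
    obtain a b where t: "t = (a, b)" by force
    have ab: "a \<in> S" "b \<in> S" using Cons.prems t by auto
    then have "p \<circ> transpose a b permutes S"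
      using Cons.prems by (intro permutes_compose permutes_swap_id)
    note IH = Cons.IH[OF this, unfolded comp_assoc]
    have ts: "transps_on S ts" and "p \<circ> apply_transps (t # ts) = p \<circ> (transpose a b \<circ> apply_transps ts)"
      using Cons.prems t by simp_all
    then show ?case
      using IH[OF ts] ncyc_transpose_bounds[OF assms(1) Cons.prems(1) ab] by (simp only: list.size) linarith
  qed simp
  then show "ncyc S p \<le> ncyc S (p \<circ> apply_transps ts) + length ts"
    "ncyc S (p \<circ> apply_transps ts) \<le> ncyc S p + length ts" by auto
qed

text \<open>\<open>id\<close> has \<open>card S\<close> cycles, and each transposition removes at
  most one.\<close>

lemma card_le_ncyc_transps:
  assumes "finite S" "transps_on S ts"
  shows "card S \<le> ncyc S (apply_transps ts) + length ts"
  using ncyc_transps_bounds(1)[OF assms(1) permutes_id assms(2)] by (simp add: ncyc_id)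

text \<open>The bound of \<open>card_le_ncyc_transps\<close> is attained: multiplying on the left by
  \<open>transpose x (q x)\<close> turns a moved point \<open>x\<close> into a fixed point and
  creates one more cycle.\<close>

lemma transps_exist:
  assumes "finite S" "q permutes S"
  shows "\<exists>ts. transps_on S ts \<and> apply_transps ts = q \<and> length ts + ncyc S q = card S"
  using assms(2)
  proof (induction "card S - ncyc S q" arbitrary: q rule: less_induct)
  case less
  show ?case
  proof (cases "q = id")
    case True
    then show ?thesis by (intro exI[of _ "[]"]) (auto simp: ncyc_id)
  next
    case False
    then obtain x where x: "q x \<noteq> x" by (auto simp: fun_eq_iff)
    then have xS: "x \<in> S" "q x \<in> S"
      using less.prems permutes_not_in permutes_in_image by metis+
    let ?t = "transpose x (q x)"
    have ex: "q x \<in> orbit q x" by (rule orbit.base)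
    have n: "ncyc S (?t \<circ> q) = Suc (ncyc S q)"
      using ncyc_split_left[OF assms(1) less.prems xS x[symmetric] ex] .
    have per: "?t \<circ> q permutes S"
      using less.prems xS by (intro permutes_compose permutes_swap_id)
    have "ncyc S (?t \<circ> q) \<le> card S" by (rule ncyc_le_card[OF assms(1)])
    then have "card S - ncyc S (?t \<circ> q) < card S - ncyc S q" using n by linarith
    from less.hyps[OF this per] obtain ts where "transps_on S ts" "apply_transps ts = ?t \<circ> q"
      "length ts + ncyc S (?t \<circ> q) = card S" by blast
    then show ?thesis
      using n xS x by (intro exI[of _ "(x, q x) # ts"]) (auto simp: comp_assoc[symmetric])
  qed
  qed

text \<open>The triangle inequality for the reflection length
  \<open>card S - ncyc S p\<close>.\<close>

lemma ncyc_comp_bounds: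
  assumes "finite S" "p permutes S" "q permutes S"
  shows "ncyc S p + ncyc S q \<le> ncyc S (p \<circ> q) + card S"
proof -
  from transps_exist[OF assms(1,3)] obtain ts where
    ts: "transps_on S ts" "apply_transps ts = q" "length ts + ncyc S q = card S" by blast
  show ?thesis
    using ncyc_transps_bounds(1)[OF assms(1,2) ts(1)] ts by simp
qed

section \<open>Permutations below a cycle\<close>

text \<open>The permutation of the Garside element. It steps downwards because words act by
  composition, last letter first. Being the identity from \<open>N\<close> on, cycles of different
  sizes can be compared.\<close>

definition prd :: "nat \<Rightarrow> nat \<Rightarrow> nat" where
  "prd N x = (if x < N then if x = 0 then N - 1 else x - 1 else x)"

lemma prd_Suc: "prd (Suc N) = prd N \<circ> transpose 0 N"
  by (auto simp: prd_def fun_eq_iff transpose_def)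

lemma prd_permutes: "prd N permutes {..<N}"
proof (induction N)
  case 0
  then show ?case by (simp add: prd_def fun_eq_iff)
next
  case (Suc N)
  have "prd N permutes {..<Suc N}" by (rule permutes_subset[OF Suc.IH]) auto
  then show ?case
    unfolding prd_Suc by (intro permutes_compose permutes_swap_id) auto
qed

lemma permutes_lessThan_permutation: "g permutes {..<N :: nat} \<Longrightarrow> permutation g"
  using permutation_permutes by blast

lemma orbit_lessThan:
  "g permutes {..<N :: nat} \<Longrightarrow> x < N \<Longrightarrow> orbit g x \<subseteq> {..<N}"
  by (rule permutes_orbit_subset) auto

lemma ncyc_lessThan_Suc:
  "g permutes {..<N :: nat} \<Longrightarrow> ncyc {..<Suc N} g = Suc (ncyc {..<N} g)"
  unfolding lessThan_Suc by (rule ncyc_insert_fixpoint) auto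

lemma permutes_lessThan_Suc_fixed:
  assumes "g permutes {..<Suc N}" "g N = N"
  shows "g permutes {..<N}"
proof (rule permutes_superset[OF assms(1)])
  show "g x = x" if "x \<in> {..<Suc N} - {..<N}" for x
    using that assms(2) by (simp add: less_Suc_eq)
qed

lemma ncyc_prd: "N > 0 \<Longrightarrow> ncyc {..<N} (prd N) = 1"
proof (induction N)
  case (Suc N)
  show ?case
  proof (cases "N = 0")
    case True
    have "prd 1 = id" by (auto simp: prd_def)
    then show ?thesis using True ncyc_id[of "{..<Suc 0}"] by (simp add: id_def)
  next
    case False
    have sub: "prd N permutes {..<Suc N}" by (rule permutes_subset[OF prd_permutes]) auto
    have "N \<notin> orbit (prd N) 0" using orbit_lessThan[OF prd_permutes, of 0 N] False by auto
    then have "ncyc {..<Suc N} (prd N) = Suc (ncyc {..<Suc N} (prd N \<circ> transpose 0 N))"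
      by (intro ncyc_merge sub) auto
    then show ?thesis
      using Suc.IH False ncyc_lessThan_Suc[OF prd_permutes[of N]] unfolding prd_Suc[of N] by linarith
  qed
qed simp

text \<open>Equality in \<open>ncyc_prd_factors_le\<close>: the cycles of \<open>g\<close> form a noncrossing partition.\<close>

definition nc_below :: "nat \<Rightarrow> (nat \<Rightarrow> nat) \<Rightarrow> bool" where
  "nc_below N g \<longleftrightarrow> g permutes {..<N} \<and> ncyc {..<N} g + ncyc {..<N} (inv g \<circ> prd N) = N + 1"

lemma nc_below_permutes: "nc_below N g \<Longrightarrow> g permutes {..<N}"
  by (simp add: nc_below_def)

lemma ncyc_prd_factors_le:
  assumes "N > 0" "g permutes {..<N}" "h permutes {..<N}" "g \<circ> h = prd N"
  shows "ncyc {..<N} g + ncyc {..<N} h \<le> N + 1"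
  using ncyc_comp_bounds[of "{..<N}" g h] assms ncyc_prd by simp

lemma inv_comp_transpose:
  assumes "g permutes S" "a \<in> S" "b \<in> S"
  shows "inv (g \<circ> transpose a b) = transpose a b \<circ> inv g"
  using o_inv_distrib[OF permutes_bij[OF assms(1)] permutes_bij[OF permutes_swap_id[OF assms(2,3)]]]
  by simp

context
  fixes N :: nat and g :: "nat \<Rightarrow> nat" and a b :: nat
  assumes g: "nc_below N g" and ab: "a < N" "b < N" "a \<noteq> b"
begin

private lemma N: "N > 0" using ab by simp

private lemma gp: "g permutes {..<N}" using g by (rule nc_below_permutes)

private lemma kp: "inv g \<circ> prd N permutes {..<N}"
  by (intro permutes_compose prd_permutes permutes_inv gp)

private lemma gtp: "g \<circ> transpose a b permutes {..<N}"
  using ab by (intro permutes_compose permutes_swap_id gp) auto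

private lemma kappa_comp: "inv (g \<circ> transpose a b) \<circ> prd N = transpose a b \<circ> (inv g \<circ> prd N)"
  using inv_comp_transpose[OF gp, of a b] ab by (simp add: comp_assoc)

text \<open>\<open>inv g \<circ> prd N\<close> is the Kreweras complement of \<open>g\<close>. If
  \<open>a\<close> and \<open>b\<close> shared a cycle of both, one transposition would split both
  factors of \<open>prd N\<close> and push their total number of cycles beyond
  \<open>N + 1\<close>.\<close>

lemma nc_below_tree:
  assumes "b \<in> orbit g a"
  shows "b \<notin> orbit (inv g \<circ> prd N) a"
proof
  assume b: "b \<in> orbit (inv g \<circ> prd N) a"
  have 1: "ncyc {..<N} (g \<circ> transpose a b) = Suc (ncyc {..<N} g)"
    using ab assms by (intro ncyc_split gp) simp_all
  have 2: "ncyc {..<N} (transpose a b \<circ> (inv g \<circ> prd N)) = Suc (ncyc {..<N} (inv g \<circ> prd N))"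
    using ab b by (intro ncyc_split_left kp) simp_all
  have "ncyc {..<N} (g \<circ> transpose a b) + ncyc {..<N} (transpose a b \<circ> (inv g \<circ> prd N)) \<le> N + 1"
  proof (rule ncyc_prd_factors_le[OF N gtp])
    show "transpose a b \<circ> (inv g \<circ> prd N) permutes {..<N}"
      using ab by (intro permutes_compose[OF kp] permutes_swap_id) auto
    have "g \<circ> transpose a b \<circ> (transpose a b \<circ> (inv g \<circ> prd N))
        = g \<circ> (transpose a b \<circ> transpose a b) \<circ> inv g \<circ> prd N" by (simp only: comp_assoc)
    also have "\<dots> = prd N" using permutes_inv_o(1)[OF gp] by simp
    finally show "g \<circ> transpose a b \<circ> (transpose a b \<circ> (inv g \<circ> prd N)) = prd N" .
  qed
  then show False using 1 2 g by (simp add: nc_below_def)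
qed

text \<open>The transposition, inserted between the two factors of \<open>prd N\<close>, costs
  \<open>g\<close> a cycle and gains its complement one, so the total stays at
  \<open>N + 1\<close>.\<close>

lemma nc_below_merge:
  assumes "b \<notin> orbit g a" "b \<in> orbit (inv g \<circ> prd N) a"
  shows "nc_below N (g \<circ> transpose a b)"
proof -
  have 1: "ncyc {..<N} g = Suc (ncyc {..<N} (g \<circ> transpose a b))"
    using ab assms by (intro ncyc_merge gp) simp_all
  have 2: "ncyc {..<N} (transpose a b \<circ> (inv g \<circ> prd N)) = Suc (ncyc {..<N} (inv g \<circ> prd N))"
    using ab assms by (intro ncyc_split_left kp) simp_all
  show ?thesis using 1 2 g gtp unfolding nc_below_def kappa_comp by linarith
qed

text \<open>By \<open>nc_below_tree\<close>, a transposition that splits \<open>g\<close> has to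
  merge two cycles of the complement.\<close>

lemma nc_below_split:
  assumes "b \<in> orbit g a"
  shows "nc_below N (g \<circ> transpose a b)"
proof -
  have 1: "ncyc {..<N} (g \<circ> transpose a b) = Suc (ncyc {..<N} g)"
    using ab assms by (intro ncyc_split gp) simp_all
  have 2: "ncyc {..<N} (inv g \<circ> prd N) = Suc (ncyc {..<N} (transpose a b \<circ> (inv g \<circ> prd N)))"
    using ab nc_below_tree[OF assms] by (intro ncyc_merge_left kp) simp_all
  show ?thesis using 1 2 g gtp unfolding nc_below_def kappa_comp by linarith
qed

end

text \<open>The new point \<open>N\<close> is inserted into the cycle of \<open>0\<close> right
  after \<open>0\<close>; all later iterates of \<open>0\<close> are delayed by one.\<close>

lemma orbit_add_point:
  assumes "h permutes {..<N}" "N > 0"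
  defines "g \<equiv> h \<circ> transpose 0 N"
  shows "orbit g 0 = insert N (orbit h 0)" and "N \<notin> orbit h 0"
    and "g 0 = N"
    and "\<And>x. x < N \<Longrightarrow> x \<notin> orbit h 0 \<Longrightarrow> orbit g x = orbit h x"
    and "card (orbit g 0) = Suc (card (orbit h 0))"
    and "g permutes {..<Suc N}"
    and "\<And>i. 0 < i \<Longrightarrow> i \<le> card (orbit h 0) \<Longrightarrow> (g ^^ Suc i) 0 = (h ^^ i) 0"
proof -
  have p: "permutation h" using assms(1) by (rule permutes_lessThan_permutation)
  have hN: "h N = N" using assms(1) by (simp add: permutes_not_in)
  have oN: "orbit h N = {N}" using hN by (simp add: orbit_eq_singleton_iff)
  have sub: "orbit h 0 \<subseteq> {..<N}" using orbit_lessThan[OF assms(1,2)] .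
  show N: "N \<notin> orbit h 0" using sub by auto
  show eq: "orbit g 0 = insert N (orbit h 0)"
    using orbit_comp_transpose_merge(1)[OF p N] oN by (simp add: g_def)
  show "g 0 = N" by (simp add: g_def hN)
  show "orbit g x = orbit h x" if "x < N" "x \<notin> orbit h 0" for x
    using orbit_comp_transpose_other[OF p that(2), of N] oN that by (simp add: g_def)
  have "finite (orbit h 0)" using sub finite_subset by blast
  then show "card (orbit g 0) = Suc (card (orbit h 0))" using eq N by simp
  have "h permutes {..<Suc N}" by (rule permutes_subset[OF assms(1)]) auto
  then show "g permutes {..<Suc N}"
    unfolding g_def by (intro permutes_compose permutes_swap_id) auto
  show "(g ^^ Suc i) 0 = (h ^^ i) 0" if "0 < i" "i \<le> card (orbit h 0)" for i
    using that
  proof (induction i)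
    case (Suc i)
    show ?case
    proof (cases "i = 0")
      case True
      then show ?thesis using hN by (simp add: g_def)
    next
      case False
      have "(h ^^ i) 0 \<noteq> 0"
        using inj_onD[OF card_orbit_funpow(2)[OF p, of 0], of i 0] Suc.prems False by auto
      moreover have "(h ^^ i) 0 \<noteq> N"
        using N funpow_in_orbit[OF permutation_self_in_orbit[OF p], of i 0] by metis
      ultimately have "g ((h ^^ i) 0) = h ((h ^^ i) 0)" by (simp add: g_def)
      then show ?thesis using Suc False by simp
    qed
  qed simp
qed

text \<open>The complement of the enlarged permutation is conjugate to that of \<open>h\<close> with
  \<open>N\<close> as an additional fixed point. So one factor keeps its number of cycles and the
  other gains one, in step with the bound.\<close>

lemma nc_below_add_point:
  assumes "N > 0" "h permutes {..<N}"
  shows "nc_below (Suc N) (h \<circ> transpose 0 N) \<longleftrightarrow> nc_below N h"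
proof -
  let ?g = "h \<circ> transpose 0 N"
  let ?t = "transpose 0 N"
  let ?k = "inv h \<circ> prd N"
  have p: "permutation h" using assms(2) by (rule permutes_lessThan_permutation)
  have h': "h permutes {..<Suc N}" by (rule permutes_subset[OF assms(2)]) auto
  have t: "?t permutes {..<Suc N}" by (rule permutes_swap_id) auto
  have k: "?k permutes {..<N}" by (intro permutes_compose prd_permutes permutes_inv assms)
  have k': "?k permutes {..<Suc N}" by (rule permutes_subset[OF k]) auto
  note add = orbit_add_point[OF assms(2,1)]
  have "ncyc {..<Suc N} h = Suc (ncyc {..<Suc N} ?g)"
    using add(2) by (intro ncyc_merge h') auto
  then have 1: "ncyc {..<Suc N} ?g = ncyc {..<N} h"
    using ncyc_lessThan_Suc[OF assms(2)] by simp
  have "inv ?g \<circ> prd (Suc N) = ?t \<circ> (?k \<circ> ?t)"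
    unfolding prd_Suc using inv_comp_transpose[OF h', of 0 N] by (simp add: comp_assoc)
  moreover have "ncyc {..<Suc N} (?t \<circ> (?k \<circ> ?t)) = ncyc {..<Suc N} (?k \<circ> ?t \<circ> ?t)"
    by (intro ncyc_comp_commute t permutes_compose[OF t k']) auto
  moreover have "?k \<circ> ?t \<circ> ?t = ?k" by (simp add: comp_assoc)
  ultimately have 2: "ncyc {..<Suc N} (inv ?g \<circ> prd (Suc N)) = Suc (ncyc {..<N} ?k)"
    using ncyc_lessThan_Suc[OF k] by simp
  show ?thesis using 1 2 add(6) assms unfolding nc_below_def by auto
qed

text \<open>There are \<open>m\<close> cycles of length \<open>r\<close> besides that of
  \<open>0\<close>, whose length \<open>k\<close> is a free parameter because deleting points and
  merging cycles changes it. The count wanted in the end is that for \<open>k = 1\<close>.\<close>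

definition nc_perms :: "nat \<Rightarrow> nat \<Rightarrow> nat \<Rightarrow> (nat \<Rightarrow> nat) set" where
  "nc_perms r m k = {g. nc_below (r * m + k) g \<and> card (orbit g 0) = k
     \<and> (\<forall>x < r * m + k. x \<notin> orbit g 0 \<longrightarrow> card (orbit g x) = r)}"

lemma finite_nc_perms: "finite (nc_perms r m k)"
  by (rule finite_subset[OF _ finite_permutations[of "{..<r * m + k}"]])
    (auto simp: nc_perms_def nc_below_def)

lemma nc_perms_add_point:
  assumes "h permutes {..<r * m + k}" "k > 0"
  shows "h \<circ> transpose 0 (r * m + k) \<in> nc_perms r m (Suc k) \<longleftrightarrow> h \<in> nc_perms r m k"
proof -
  let ?N = "r * m + k"
  have N: "?N > 0" using assms by simp
  note add = orbit_add_point[OF assms(1) N]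
  have "(\<forall>x < Suc ?N. x \<notin> orbit (h \<circ> transpose 0 ?N) 0 \<longrightarrow> card (orbit (h \<circ> transpose 0 ?N) x) = r)
      \<longleftrightarrow> (\<forall>x < ?N. x \<notin> orbit h 0 \<longrightarrow> card (orbit h x) = r)"
    using add(1,4) by (auto simp: less_Suc_eq)
  then show ?thesis
    using nc_below_add_point[OF N assms(1)] add(5) by (simp add: nc_perms_def)
qed

lemma comp_transpose_transpose [simp]: "g \<circ> transpose a b \<circ> transpose a b = g"
  by (simp add: comp_assoc)

lemma nc_perms_Suc_cases_fixed:
  assumes "g \<in> nc_perms r m (Suc k)" "k > 0" "g 0 = r * m + k"
  obtains h where "h \<in> nc_perms r m k" "g = h \<circ> transpose 0 (r * m + k)"
proof -
  let ?N = "r * m + k"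
  let ?h = "g \<circ> transpose 0 ?N"
  have g: "g permutes {..<Suc ?N}" using assms(1) by (simp add: nc_perms_def nc_below_def)
  have "?h permutes {..<Suc ?N}" by (intro permutes_compose[OF _ g] permutes_swap_id) auto
  moreover have "?h ?N = ?N" using assms(3) by simp
  ultimately have "?h permutes {..<?N}"
    by (rule permutes_lessThan_Suc_fixed)
  then have "?h \<in> nc_perms r m k" using nc_perms_add_point[of ?h r m k] assms by simp
  then show thesis using that[of ?h] by simp
qed

text \<open>\<open>z\<close>, the preimage of the last point, is the image of \<open>0\<close> under
  the complement. Hence it is not on the cycle of \<open>0\<close> in \<open>g\<close>, and joining
  the two cycles stays noncrossing. Afterwards \<open>0\<close> is sent to the last point, which can
  be deleted.\<close>

lemma nc_perms_Suc_cases_split: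
  assumes "g \<in> nc_perms r m (Suc k)" "g 0 \<noteq> r * m + k"
  defines "z \<equiv> inv g (r * m + k)"
  defines "h \<equiv> g \<circ> transpose 0 z \<circ> transpose 0 (r * m + k)"
  shows "m > 0" and "h \<in> nc_perms r (m - 1) (k + r)"
    and "z = ((h \<circ> transpose 0 (r * m + k)) ^^ r) 0"
proof -
  let ?N = "r * m + k"
  have nc: "nc_below (Suc ?N) g" using assms(1) by (simp add: nc_perms_def)
  have g: "g permutes {..<Suc ?N}" using nc by (rule nc_below_permutes)
  have p: "permutation g" using g by (rule permutes_lessThan_permutation)
  have gz: "g z = ?N" unfolding z_def using permutes_inverses(1)[OF g] .
  have z0: "z \<noteq> 0" using assms(2) gz by metis
  have zN: "z < Suc ?N" using gz permutes_in_image[OF g, of z] by simp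
  have "z \<in> orbit (inv g \<circ> prd (Suc ?N)) 0"
    using orbit.base[of "inv g \<circ> prd (Suc ?N)" 0] by (simp add: prd_def z_def)
  then have znot: "z \<notin> orbit g 0" using nc_below_tree[OF nc _ zN] z0 by auto
  have cz: "card (orbit g z) = r" using assms(1) zN znot by (simp add: nc_perms_def)
  have c0: "card (orbit g 0) = Suc k" using assms(1) by (simp add: nc_perms_def)
  have disj: "orbit g 0 \<inter> orbit g z = {}"
  proof (rule equals0I)
    fix x assume "x \<in> orbit g 0 \<inter> orbit g z"
    then have "orbit g 0 = orbit g z" using orbit_eq_of_mem[OF p] by blast
    then show False using znot permutation_self_in_orbit[OF p, of z] by simp
  qed
  have fin: "finite (orbit g x)" if "x < Suc ?N" for x
    using orbit_lessThan[OF g that] finite_subset by blast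
  have subs: "orbit g 0 \<union> orbit g z \<subseteq> {..<Suc ?N}"
    using orbit_lessThan[OF g zN] orbit_lessThan[OF g, of 0] by simp
  have ckr: "card (orbit g 0 \<union> orbit g z) = Suc k + r"
    using card_Un_disjoint[OF fin fin disj] zN c0 cz by simp
  have rpos: "r > 0" using card_orbit_funpow(3)[OF p, of z] cz by simp
  show m: "m > 0"
  proof (rule ccontr)
    assume "\<not> m > 0"
    then have "card (orbit g 0 \<union> orbit g z) \<le> Suc k"
      using card_mono[OF _ subs] by simp
    then show False using ckr rpos by simp
  qed
  let ?g1 = "g \<circ> transpose 0 z"
  have g1: "nc_below (Suc ?N) ?g1"
    using z0 zN znot \<open>z \<in> orbit (inv g \<circ> prd (Suc ?N)) 0\<close> by (intro nc_below_merge nc) auto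
  have hN: "h ?N = ?N" using gz by (simp add: h_def)
  have "h permutes {..<Suc ?N}"
    unfolding h_def by (intro permutes_compose[OF _ nc_below_permutes[OF g1]] permutes_swap_id) auto
  then have hp: "h permutes {..<?N}"
    using hN by (rule permutes_lessThan_Suc_fixed)
  have N: "?N = r * (m - 1) + (k + r)" using m by (cases m) auto
  have g1h: "?g1 = h \<circ> transpose 0 ?N" by (simp add: h_def)
  have "?g1 \<in> nc_perms r (m - 1) (Suc (k + r))"
  proof -
    have o1: "orbit ?g1 0 = orbit g 0 \<union> orbit g z"
      by (rule orbit_comp_transpose_merge(1)[OF p znot])
    have "card (orbit ?g1 x) = r" if "x < Suc ?N" "x \<notin> orbit ?g1 0" for x
      using that assms(1) orbit_comp_transpose_other[OF p, of x 0 z] unfolding o1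
      by (simp add: nc_perms_def)
    then show ?thesis using g1 ckr N o1 by (simp add: nc_perms_def)
  qed
  then show "h \<in> nc_perms r (m - 1) (k + r)"
    using nc_perms_add_point[of h r "m - 1" "k + r"] hp N rpos g1h by simp
  \<comment> \<open>The merged cycle runs from \<open>0\<close> through the old cycle of
    \<open>z\<close> and reaches \<open>z\<close> itself after \<open>r\<close> steps.\<close>
  have "(?g1 ^^ i) 0 = (g ^^ i) z" if "0 < i" "i \<le> r" for i
    using that
  proof (induction i)
    case (Suc i)
    show ?case
    proof (cases "i = 0")
      case False
      have "(g ^^ i) z \<noteq> z"
        using inj_onD[OF card_orbit_funpow(2)[OF p, of z], of i 0] Suc.prems False cz by auto
      moreover have "(g ^^ i) z \<in> orbit g z"
        by (rule funpow_in_orbit[OF permutation_self_in_orbit[OF p]])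
      then have "(g ^^ i) z \<noteq> 0"
        using disj permutation_self_in_orbit[OF p, of 0] by auto
      ultimately show ?thesis using Suc False by simp
    qed simp
  qed simp
  from this[of r] show "z = ((h \<circ> transpose 0 ?N) ^^ r) 0"
    using rpos card_orbit_funpow(1)[OF p, of z] cz g1h by simp
qed

text \<open>Inverse of \<open>nc_perms_Suc_cases_split\<close>: the \<open>r\<close> points that
  follow \<open>0\<close> in the enlarged cycle, the first of which is \<open>N\<close>, are cut off
  as a cycle of their own.\<close>

lemma nc_perms_Suc_intro_split:
  fixes r m k :: nat
  assumes "h \<in> nc_perms r m (k + r)" "r > 0"
  defines "N \<equiv> r * Suc m + k"
  defines "g1 \<equiv> h \<circ> transpose 0 N"
  defines "z \<equiv> (g1 ^^ r) 0"
  defines "g \<equiv> g1 \<circ> transpose 0 z"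
  shows "g \<in> nc_perms r (Suc m) (Suc k)" and "inv g N = z" and "g 0 \<noteq> N"
    and "orbit g z = (\<lambda>i. (g1 ^^ i) 0) ` {1..r}"
    and "card (orbit g1 0) = Suc (k + r)" and "z \<notin> orbit g 0"
proof -
  have Neq: "N = r * m + (k + r)" by (simp add: N_def)
  have h: "h permutes {..<N}" using assms(1) by (simp add: nc_perms_def nc_below_def Neq)
  have g1: "g1 \<in> nc_perms r m (Suc (k + r))"
    using nc_perms_add_point[of h r m "k + r"] assms(1,2) h by (simp add: g1_def Neq)
  then have nc: "nc_below (Suc N) g1" by (simp add: nc_perms_def Neq)
  have g1p: "g1 permutes {..<Suc N}" using nc by (rule nc_below_permutes)
  have p: "permutation g1" using g1p by (rule permutes_lessThan_permutation)
  show c: "card (orbit g1 0) = Suc (k + r)" using g1 by (simp add: nc_perms_def)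
  have r: "0 < r" "r < card (orbit g1 0)" using c assms(2) by auto
  have z0: "z \<noteq> 0"
    using inj_onD[OF card_orbit_funpow(2)[OF p, of 0], of r 0] r by (auto simp: z_def)
  have zo: "z \<in> orbit g1 0"
    unfolding z_def by (rule funpow_in_orbit[OF permutation_self_in_orbit[OF p]])
  have zN: "z < Suc N" using zo orbit_lessThan[OF g1p, of 0] by auto
  have ncg: "nc_below (Suc N) g"
    unfolding g_def using z0 zN zo by (intro nc_below_split nc) auto
  have gp: "g permutes {..<Suc N}" using ncg by (rule nc_below_permutes)
  have pg: "permutation g" using gp by (rule permutes_lessThan_permutation)
  note sp = orbit_comp_transpose_split[OF p r, folded z_def, folded g_def]
  show "orbit g z = (\<lambda>i. (g1 ^^ i) 0) ` {1..r}" by (rule sp(1))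
  show znot: "z \<notin> orbit g 0" by (rule sp(3))
  have g1g: "g1 = g \<circ> transpose 0 z" by (simp add: g_def)
  have o1: "orbit g1 0 = orbit g 0 \<union> orbit g z"
    unfolding g1g by (rule orbit_comp_transpose_merge(1)[OF pg znot])
  have disj: "orbit g 0 \<inter> orbit g z = {}"
  proof (rule equals0I)
    fix x assume "x \<in> orbit g 0 \<inter> orbit g z"
    then have "orbit g 0 = orbit g z" using orbit_eq_of_mem[OF pg] by blast
    then show False using znot permutation_self_in_orbit[OF pg, of z] by simp
  qed
  have fin: "finite (orbit g x)" if "x < Suc N" for x
    using orbit_lessThan[OF gp that] finite_subset by blast
  have "card (orbit g 0) + r = Suc (k + r)"
    using card_Un_disjoint[OF fin fin disj] zN c sp(2) o1 by simp
  moreover have "card (orbit g x) = r" if "x < Suc N" "x \<notin> orbit g 0" for x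
  proof (cases "x \<in> orbit g z")
    case True
    then show ?thesis using orbit_eq_of_mem[OF pg True] sp(2) by simp
  next
    case False
    then have "orbit g1 x = orbit g x" "x \<notin> orbit g1 0"
      using orbit_comp_transpose_other[OF pg that(2) False] that o1 by (auto simp: g1g)
    then show ?thesis using g1 that by (auto simp: nc_perms_def Neq)
  qed
  ultimately show "g \<in> nc_perms r (Suc m) (Suc k)"
    using ncg by (simp add: nc_perms_def N_def)
  have "g z = g1 0" by (simp add: g_def)
  also have "\<dots> = N" using h by (simp add: g1_def permutes_not_in)
  finally have gz: "g z = N" .
  then show "inv g N = z" using permutes_inverses(2)[OF gp, of z] by simp
  show "g 0 \<noteq> N" using gz z0 permutes_inj[OF gp] by (metis injD)
qed

text \<open>For \<open>m = 0\<close> there is no second cycle to contain the last point, so it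
  always follows \<open>0\<close>, and deleting it is a bijection down to the one-point
  case.\<close>

lemma card_nc_perms_0: "k > 0 \<Longrightarrow> r > 0 \<Longrightarrow> card (nc_perms r 0 k) = 1"
proof (induction k)
  case (Suc k)
  show ?case
  proof (cases "k = 0")
    case True
    have "nc_perms r 0 1 = {id}"
    proof -
      have "ncyc {..<Suc 0} (inv id \<circ> prd (Suc 0)) = 1"
        using ncyc_prd[of 1] by simp
      moreover have "orbit id (0 :: nat) = {0}" by (simp add: orbit_eq_singleton_iff)
      moreover have "g permutes {..<Suc 0} \<longleftrightarrow> g = id" for g :: "nat \<Rightarrow> nat"
        by (simp add: lessThan_Suc)
      ultimately show ?thesis
        by (auto simp: nc_perms_def nc_below_def ncyc_id)
    qed
    then show ?thesis using True by simp
  next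
    case False
    let ?f = "\<lambda>h. h \<circ> transpose 0 k"
    have "nc_perms r 0 (Suc k) = ?f ` nc_perms r 0 k"
    proof (intro equalityI subsetI)
      fix g assume g: "g \<in> nc_perms r 0 (Suc k)"
      then have g0: "g 0 = r * 0 + k" using nc_perms_Suc_cases_split(1)[OF g] by fastforce
      show "g \<in> ?f ` nc_perms r 0 k"
        by (rule nc_perms_Suc_cases_fixed[OF g _ g0]) (use False in simp_all)
    next
      fix g assume "g \<in> ?f ` nc_perms r 0 k"
      then obtain h where h: "h \<in> nc_perms r 0 k" "g = ?f h" by blast
      then have "h permutes {..<r * 0 + k}" by (simp add: nc_perms_def nc_below_def)
      then show "g \<in> nc_perms r 0 (Suc k)" using nc_perms_add_point[of h r 0 k] h False by simp
    qed
    moreover have inj: "inj ?f" by (rule inj_on_inverseI[where g = ?f]) simp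
    have "card (?f ` nc_perms r 0 k) = card (nc_perms r 0 k)" by (rule card_image[OF inj_on_subset[OF inj subset_UNIV]])
    ultimately show ?thesis using Suc False by simp
  qed
qed simp

text \<open>Delete the last point \<open>L\<close>: either \<open>0\<close> is mapped to \<open>L\<close>, or the cycle of \<open>L\<close> is first
  merged into the cycle of \<open>0\<close>, from which it can be recovered since its length \<open>r\<close> is known.\<close>

lemma card_nc_perms_rec:
  assumes "r > 0"
  shows "card (nc_perms r (Suc m) (Suc k)) =
    (if k = 0 then 0 else card (nc_perms r (Suc m) k)) + card (nc_perms r m (k + r))"
proof -
  let ?N = "r * Suc m + k"
  let ?A = "{g \<in> nc_perms r (Suc m) (Suc k). g 0 = ?N}"
  let ?B = "{g \<in> nc_perms r (Suc m) (Suc k). g 0 \<noteq> ?N}"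
  let ?fA = "\<lambda>h. h \<circ> transpose 0 ?N"
  let ?fB = "\<lambda>h. ?fA h \<circ> transpose 0 ((?fA h ^^ r) 0)"
  let ?gB = "\<lambda>g. g \<circ> transpose 0 (inv g ?N) \<circ> transpose 0 ?N"
  have A: "card ?A = (if k = 0 then 0 else card (nc_perms r (Suc m) k))"
  proof (cases "k = 0")
    case True
    have "g 0 = 0" if "g \<in> nc_perms r (Suc m) (Suc 0)" for g
    proof -
      have p: "permutation g"
        using that permutes_lessThan_permutation by (auto simp: nc_perms_def nc_below_def)
      have "card (orbit g 0) = 1" using that by (simp add: nc_perms_def)
      then show ?thesis using card_orbit_funpow(1)[OF p, of 0] by simp
    qed
    then have "?A = {}" using True assms by fastforce
    then have "card ?A = 0" by (simp only: card.empty)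
    then show ?thesis using True by (simp only: if_True refl)
  next
    case False
    have "?A = ?fA ` nc_perms r (Suc m) k"
    proof (intro equalityI subsetI)
      fix g assume "g \<in> ?A"
      then have g: "g \<in> nc_perms r (Suc m) (Suc k)" "g 0 = ?N" by auto
      show "g \<in> ?fA ` nc_perms r (Suc m) k"
        by (rule nc_perms_Suc_cases_fixed[OF g(1) _ g(2)]) (use False in simp_all)
    next
      fix g assume "g \<in> ?fA ` nc_perms r (Suc m) k"
      then obtain h where h: "h \<in> nc_perms r (Suc m) k" "g = ?fA h" by blast
      have hp: "h permutes {..<?N}" using h(1) by (simp add: nc_perms_def nc_below_def)
      then have "g 0 = ?N" using orbit_add_point(3)[OF hp] False h(2) by simp
      then show "g \<in> ?A" using nc_perms_add_point[OF hp] h False by simp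
    qed
    moreover have inj: "inj ?fA" by (rule inj_on_inverseI[where g = ?fA]) simp
    have "card (?fA ` nc_perms r (Suc m) k) = card (nc_perms r (Suc m) k)"
      by (rule card_image[OF inj_on_subset[OF inj subset_UNIV]])
    ultimately show ?thesis using False by simp
  qed
  have "bij_betw ?fB (nc_perms r m (k + r)) ?B"
  proof (rule bij_betw_byWitness[where f' = ?gB])
    show "\<forall>h \<in> nc_perms r m (k + r). ?gB (?fB h) = h"
      using nc_perms_Suc_intro_split(2)[OF _ assms, of _ m k] by simp
    show "\<forall>g \<in> ?B. ?fB (?gB g) = g"
      using nc_perms_Suc_cases_split(3)[of _ r "Suc m" k] by simp
    show "?fB ` nc_perms r m (k + r) \<subseteq> ?B"
      using nc_perms_Suc_intro_split(1,3)[OF _ assms, of _ m k] by blast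
    show "?gB ` ?B \<subseteq> nc_perms r m (k + r)"
      using nc_perms_Suc_cases_split(2)[of _ r "Suc m" k] by auto
  qed
  then have B: "card ?B = card (nc_perms r m (k + r))" by (rule bij_betw_same_card[symmetric])
  have "nc_perms r (Suc m) (Suc k) = ?A \<union> ?B" by blast
  moreover have "card (?A \<union> ?B) = card ?A + card ?B"
    by (rule card_Un_disjoint) (auto intro: finite_subset[OF _ finite_nc_perms])
  ultimately show ?thesis using A B by simp
qed

text \<open>Recursion of the Raney numbers \<open>k / (r * m + k) * ((r * m + k) choose m)\<close>.
  Both terms on the right belong to \<open>M\<close> points: the \<open>r\<close> points of a merged
  cycle are added to \<open>k\<close> when \<open>m\<close> drops by one.\<close>

lemma fuss_catalan_step:
  fixes M m k r :: nat
  assumes "M = r * m + k + r" "M > 0" "m \<le> M"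
  shows "real (Suc k) / real (Suc M) * real (Suc M choose Suc m)
    = real k / real M * real (M choose Suc m) + real (k + r) / real M * real (M choose m)"
proof -
  have 1: "real (Suc M choose Suc m) = real (Suc M) / real (Suc m) * real (M choose m)"
    using Suc_times_binomial[of m M] by (simp add: field_simps flip: of_nat_mult of_nat_Suc)
  have "Suc m * (M choose Suc m) = (M - m) * (M choose m)"
    by (metis binomial_absorb_comp binomial_absorption mult.commute)
  then have "real (Suc m) * real (M choose Suc m) = real (M - m) * real (M choose m)"
    by (metis of_nat_mult)
  then have 2: "real (M choose Suc m) = (real M - real m) / real (Suc m) * real (M choose m)"
    using assms(3) by (simp add: field_simps of_nat_diff del: of_nat_Suc)
  have "real (Suc k) / real (Suc m) = real k * (real M - real m) / (real M * real (Suc m))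
      + real (k + r) / real M"
  proof -
    \<comment> \<open>This identity remains once both sides are multiples of
      \<open>M choose m\<close>; it is where \<open>M = r * m + k + r\<close> enters.\<close>
    have "real (Suc k) * real M = real k * (real M - real m) + real (k + r) * real (Suc m)"
      using assms(1) by (simp add: algebra_simps)
    then have "real (Suc k) * real M / (real M * real (Suc m))
        = (real k * (real M - real m) + real (k + r) * real (Suc m)) / (real M * real (Suc m))"
      by simp
    then show ?thesis using assms(2) by (simp add: add_divide_distrib del: of_nat_Suc)
  qed
  then have "real (Suc k) / real (Suc m) * real (M choose m) =
     (real k * (real M - real m) / (real M * real (Suc m)) + real (k + r) / real M) * real (M choose m)"
    by simp
  then show ?thesis unfolding 1 2 by (simp add: field_simps del: of_nat_Suc)
qed

lemma card_nc_perms: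
  assumes "k > 0" "r > 0"
  shows "real (card (nc_perms r m k)) = real k / real (r * m + k) * real ((r * m + k) choose m)"
  using assms(1)
proof (induction m arbitrary: k)
  case 0
  then show ?case using card_nc_perms_0[of k r] assms(2) by simp
next
  case (Suc m)
  note IHm = Suc.IH
  show ?case using Suc.prems
  proof (induction k)
    case (Suc k)
    let ?M = "r * m + k + r"
    have mM: "m \<le> ?M" using mult_le_mono1[of 1 r m] assms(2) by linarith
    have "real (card (nc_perms r (Suc m) (Suc k))) =
      (if k = 0 then 0 else real (card (nc_perms r (Suc m) k))) + real (card (nc_perms r m (k + r)))"
      using card_nc_perms_rec[OF assms(2), of m k] by simp
    \<comment> \<open>The closed formula contains the factor \<open>k\<close>, so it also covers the
      exceptional value at \<open>k = 0\<close>.\<close>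
    also have "(if k = 0 then 0 else real (card (nc_perms r (Suc m) k)))
        = real k / real ?M * real (?M choose Suc m)"
      using Suc.IH by (cases "k = 0") (simp_all add: algebra_simps)
    also have "real (card (nc_perms r m (k + r))) = real (k + r) / real ?M * real (?M choose m)"
      using IHm[of "k + r"] assms(2)
      by (simp add: algebra_simps)
    also have "real k / real ?M * real (?M choose Suc m) + real (k + r) / real ?M * real (?M choose m)
        = real (Suc k) / real (Suc ?M) * real (Suc ?M choose Suc m)"
      using assms(2) mM by (intro fuss_catalan_step[symmetric]) simp_all
    finally show ?case by (simp add: algebra_simps)
  qed simp
qed

text \<open>The points skipped between neighbours on a noncrossing cycle are filled by whole cycles
  of length \<open>r\<close>, so a step lowers the residue modulo \<open>r\<close> by one. On the
  cycle of \<open>0\<close> only the step leaving \<open>0\<close> may deviate: it lands on the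
  residue of \<open>k - 1\<close>. That clause carries the induction.\<close>

definition levelled :: "nat \<Rightarrow> nat \<Rightarrow> nat \<Rightarrow> (nat \<Rightarrow> nat) \<Rightarrow> bool" where
  "levelled r N k g \<longleftrightarrow> (\<forall>i. 0 < i \<and> i \<le> k \<longrightarrow> ((g ^^ i) 0 + i) mod r = k mod r)
     \<and> (\<forall>x < N. x \<notin> orbit g 0 \<longrightarrow> (g x + 1) mod r = x mod r)"

lemma levelled_add_point:
  assumes "h permutes {..<N}" "N > 0" "card (orbit h 0) = k" "N mod r = k mod r" "levelled r N k h"
  shows "levelled r (Suc N) (Suc k) (h \<circ> transpose 0 N)"
  unfolding levelled_def
proof (intro conjI allI impI)
  let ?g = "h \<circ> transpose 0 N"
  note add = orbit_add_point[OF assms(1,2)]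
  have p: "permutation h" using assms(1) by (rule permutes_lessThan_permutation)
  fix i assume i: "0 < i \<and> i \<le> Suc k"
  show "((?g ^^ i) 0 + i) mod r = Suc k mod r"
  proof (cases "i = 1")
    case True
    then show ?thesis using add(3) assms(4) by (simp add: mod_Suc)
  next
    case False
    then obtain j where j: "i = Suc j" "0 < j" "j \<le> k" using i by (cases i) auto
    then have "((h ^^ j) 0 + j) mod r = k mod r" using assms(5) by (simp add: levelled_def)
    then have "Suc ((h ^^ j) 0 + j) mod r = Suc k mod r" by (metis mod_Suc_eq)
    then show ?thesis using add(7)[of j] j assms(3) by simp
  qed
next
  let ?g = "h \<circ> transpose 0 N"
  note add = orbit_add_point[OF assms(1,2)]
  have p: "permutation h" using assms(1) by (rule permutes_lessThan_permutation)
  fix x assume x: "x < Suc N" "x \<notin> orbit ?g 0"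
  then have x': "x < N" "x \<notin> orbit h 0" using add(1) by auto
  then have "x \<noteq> 0" using permutation_self_in_orbit[OF p] by metis
  then have "?g x = h x" using x' by simp
  then show "(?g x + 1) mod r = x mod r" using assms(5) x' by (simp add: levelled_def)
qed

text \<open>The arc cut off has length \<open>r\<close>, so closing it by the step from
  \<open>z\<close> to \<open>g1 0\<close> lowers the residue by one as well. On the remaining cycle
  the iterates of \<open>0\<close> are renumbered by \<open>r\<close>, which is invisible modulo
  \<open>r\<close>.\<close>

lemma levelled_split:
  fixes r m k :: nat
  assumes h: "h \<in> nc_perms r m (k + r)" and r: "r > 0" and lev: "levelled r (r * m + (k + r)) (k + r) h"
  defines "N \<equiv> r * Suc m + k"
  defines "g1 \<equiv> h \<circ> transpose 0 N"
  defines "z \<equiv> (g1 ^^ r) 0"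
  defines "g \<equiv> g1 \<circ> transpose 0 z"
  shows "levelled r (r * Suc m + Suc k) (Suc k) g"
proof -
  note sp = nc_perms_Suc_intro_split[OF h r, folded N_def, folded g1_def, folded z_def, folded g_def]
  have Neq: "N = r * m + (k + r)" by (simp add: N_def)
  have hp: "h permutes {..<N}" using h by (simp add: nc_perms_def nc_below_def Neq)
  have "card (orbit h 0) = k + r" using h by (simp add: nc_perms_def)
  then have lev1: "levelled r (Suc N) (Suc (k + r)) g1"
    unfolding g1_def using r Neq
    by (intro levelled_add_point[OF hp _ _ _ lev[folded Neq]]) simp_all
  have lev0: "((g1 ^^ i) 0 + i) mod r = Suc k mod r" if "0 < i" "i \<le> Suc (k + r)" for i
  proof -
    have "((g1 ^^ i) 0 + i) mod r = Suc (k + r) mod r"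
      using lev1 that by (simp add: levelled_def)
    also have "\<dots> = Suc k mod r" by (metis add_Suc mod_add_self2)
    finally show ?thesis .
  qed
  have gp: "g permutes {..<Suc N}" using sp(1) by (simp add: nc_perms_def nc_below_def N_def)
  have pg: "permutation g" using gp by (rule permutes_lessThan_permutation)
  have g1p: "g1 permutes {..<Suc N}"
    using orbit_add_point(6)[OF hp] r by (simp add: g1_def N_def)
  have p: "permutation g1" using g1p by (rule permutes_lessThan_permutation)
  have ne: "(g1 ^^ i) 0 \<noteq> (g1 ^^ j) 0" if "i < Suc (k + r)" "j < Suc (k + r)" "i \<noteq> j" for i j
    using inj_onD[OF card_orbit_funpow(2)[OF p, of 0], of i j] sp(5) that by auto
  have gi: "(g ^^ i) 0 = (g1 ^^ (r + i)) 0" if "0 < i" "i \<le> Suc k" for i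
    using that
  proof (induction i)
    case (Suc i)
    show ?case
    proof (cases "i = 0")
      case True
      then show ?thesis by (simp add: g_def z_def)
    next
      case False
      have "(g1 ^^ (r + i)) 0 \<noteq> 0" using ne[of "r + i" 0] Suc.prems r by simp
      moreover have "(g1 ^^ (r + i)) 0 \<noteq> z" using ne[of "r + i" r] Suc.prems False
        by (simp add: z_def)
      ultimately show ?thesis using Suc False by (simp add: g_def)
    qed
  qed simp
  have "(g x + 1) mod r = x mod r" if x: "x < Suc N" "x \<notin> orbit g 0" for x
  proof (cases "x \<in> orbit g z")
    case True
    then obtain i where i: "x = (g1 ^^ i) 0" "1 \<le> i" "i \<le> r" using sp(4) by auto
    have l: "(x + i) mod r = Suc k mod r" using lev0[of i] i by simp
    show ?thesis
    proof (cases "i = r")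
      case True
      then have "g x = (g1 ^^ 1) 0" using i by (simp add: g_def z_def)
      then have "(g x + 1) mod r = Suc k mod r" using lev0[of 1] by (metis le_add1 plus_1_eq_Suc zero_less_one)
      then show ?thesis using l True by simp
    next
      case False
      have "x \<noteq> 0" "x \<noteq> z" using ne[of i 0] ne[of i r] i False by (simp_all add: z_def)
      then have "g x = (g1 ^^ Suc i) 0" using i by (simp add: g_def)
      then have "(g x + Suc i) mod r = (x + i) mod r" using lev0[of "Suc i"] l i False by simp
      then have "(g x + 1 + i) mod r = (x + i) mod r" by simp
      then show ?thesis by (simp only: nat_mod_eq_iff) auto
    qed
  next
    case False
    have "g1 = g \<circ> transpose 0 z" by (simp add: g_def)
    then have "x \<notin> orbit g1 0"
      using orbit_comp_transpose_merge(1)[OF pg sp(6)] x False by simp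
    moreover have "x \<noteq> 0" "x \<noteq> z"
      using permutation_self_in_orbit[OF pg] x False by metis+
    then have "g x = g1 x" by (simp add: g_def)
    ultimately show ?thesis using lev1 x by (simp add: levelled_def)
  qed
  moreover have "((g ^^ i) 0 + i) mod r = Suc k mod r" if "0 < i" "i \<le> Suc k" for i
  proof -
    have "((g1 ^^ (r + i)) 0 + i) mod r = ((g1 ^^ (r + i)) 0 + (r + i)) mod r"
      by (metis add.left_commute mod_add_self1)
    then show ?thesis using gi[OF that] lev0[of "r + i"] that by simp
  qed
  ultimately show ?thesis by (simp add: levelled_def N_def)
qed

text \<open>The induction repeats the recursion of \<open>card_nc_perms_rec\<close>, with the same
  two ways of deleting the last point.\<close>

lemma nc_perms_levelled:
  assumes "g \<in> nc_perms r m k" "k > 0" "r > 0"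
  shows "levelled r (r * m + k) k g"
  using assms(1,2)
proof (induction m arbitrary: k g)
  case 0
  then show ?case
  proof (induction k arbitrary: g)
    case (Suc k)
    show ?case
    proof (cases "k = 0")
      case True
      then have "g permutes {..<Suc 0}" using Suc.prems by (simp add: nc_perms_def nc_below_def)
      then have g: "g = id" by (simp add: lessThan_Suc)
      have "0 \<in> orbit g 0" using orbit.base[of g 0] g by simp
      moreover have "((g ^^ i) 0 + i) mod r = Suc k mod r" if "0 < i \<and> i \<le> Suc k" for i
      proof -
        have "i = 1" using that True by simp
        then show ?thesis using g True by simp
      qed
      ultimately show ?thesis using True by (auto simp: levelled_def)
    next
      case False
      have g0: "g 0 = r * 0 + k" using nc_perms_Suc_cases_split(1)[OF Suc.prems(1)] by fastforce
      obtain h where h: "h \<in> nc_perms r 0 k" "g = h \<circ> transpose 0 (r * 0 + k)"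
        by (rule nc_perms_Suc_cases_fixed[OF Suc.prems(1) _ g0]) (use False in simp_all)
      then have "levelled r (r * 0 + k) k h" using Suc.IH False by simp
      then have "levelled r (Suc k) (Suc k) (h \<circ> transpose 0 k)"
        using levelled_add_point[of h k k r] h(1) False by (simp add: nc_perms_def nc_below_def)
      then show ?thesis unfolding h(2) mult_0_right add_0 .
    qed
  qed simp
next
  case (Suc m)
  note IHm = Suc.IH
  from Suc.prems show ?case
  proof (induction k arbitrary: g)
    case (Suc k)
    let ?N = "r * Suc m + k"
    show ?case
    proof (cases "g 0 = ?N")
      case True
      have "k \<noteq> 0"
      proof
        assume "k = 0"
        have p: "permutation g"
          using Suc.prems permutes_lessThan_permutation by (auto simp: nc_perms_def nc_below_def)
        have "card (orbit g 0) = 1" using Suc.prems \<open>k = 0\<close> by (simp add: nc_perms_def)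
        then have "g 0 = 0" using card_orbit_funpow(1)[OF p, of 0] by simp
        then show False using True assms(3) by simp
      qed
      obtain h where h: "h \<in> nc_perms r (Suc m) k" "g = h \<circ> transpose 0 ?N"
        by (rule nc_perms_Suc_cases_fixed[OF Suc.prems(1) _ True]) (use \<open>k \<noteq> 0\<close> in simp_all)
      then have "levelled r ?N k h" using Suc.IH \<open>k \<noteq> 0\<close> by simp
      moreover have "?N mod r = k mod r" by (rule mod_mult_self4)
      ultimately have "levelled r (Suc ?N) (Suc k) (h \<circ> transpose 0 ?N)"
        using h(1) \<open>k \<noteq> 0\<close> by (intro levelled_add_point) (simp_all add: nc_perms_def nc_below_def)
      then show ?thesis unfolding h(2) add_Suc_right .
    next
      case False
      note sp = nc_perms_Suc_cases_split[OF Suc.prems(1) False]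
      let ?h = "g \<circ> transpose 0 (inv g ?N) \<circ> transpose 0 ?N"
      have h: "?h \<in> nc_perms r m (k + r)" using sp(2) by simp
      have eq: "?h \<circ> transpose 0 ?N \<circ> transpose 0 (((?h \<circ> transpose 0 ?N) ^^ r) 0) = g"
        unfolding sp(3)[symmetric] by simp
      have "levelled r (r * m + (k + r)) (k + r) ?h"
        by (rule IHm[OF h]) (use assms(3) in simp)
      from levelled_split[OF h assms(3) this] show ?thesis unfolding eq .
    qed
  qed simp
qed

section \<open>Roots of the identity below a cycle\<close>

text \<open>The model for the standard cycle; \<open>rotperms\<close> is its counterpart for the
  power \<open>C\<close>. The last condition says that \<open>inv (prd n) \<circ> g\<close>, with
  \<open>n = r * d + 1\<close>, has reflection length \<open>d\<close>.\<close>

definition root_perms :: "nat \<Rightarrow> nat \<Rightarrow> (nat \<Rightarrow> nat) set" where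
  "root_perms r d = {g. g permutes {..<r * d + 1} \<and> g ^^ r = id
     \<and> ncyc {..<r * d + 1} (inv (prd (r * d + 1)) \<circ> g) + d = r * d + 1}"

lemma card_orbit_dvd:
  assumes "permutation g" "g ^^ r = id"
  shows "card (orbit g x) dvd r"
proof -
  let ?c = "card (orbit g x)"
  note c = card_orbit_funpow[OF assms(1), of x]
  have "(g ^^ (r mod ?c)) x = (g ^^ r) x" using c(1) by (rule funpow_mod_eq)
  then have "(g ^^ (r mod ?c)) x = (g ^^ 0) x" using assms(2) by simp
  then have "r mod ?c = 0" using c(2,3)
    inj_onD[OF c(2), of "r mod ?c" 0] by simp
  then show ?thesis by auto
qed

lemma sum_card_orbits:
  assumes "finite S" "p permutes S"
  shows "(\<Sum>X\<in>orbit p ` S. card X) = card S"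
proof -
  have p: "permutation p" using assms permutation_permutes by blast
  have "card (\<Union>(orbit p ` S)) = (\<Sum>X\<in>orbit p ` S. card X)"
  proof (rule card_Union_disjoint)
    show "pairwise disjnt (orbit p ` S)"
      by (auto simp: pairwise_def disjnt_def) (metis orbit_eq_of_mem[OF p])+
    show "finite X" if "X \<in> orbit p ` S" for X
      using that permutes_orbit_subset[OF assms(2)] assms(1) finite_subset by blast
  qed
  moreover have "\<Union>(orbit p ` S) = S"
    using permutes_orbit_subset[OF assms(2)] permutation_self_in_orbit[OF p] by blast
  ultimately show ?thesis by simp
qed

lemma ncyc_inv_prd_comp:
  assumes "g permutes {..<N}"
  shows "ncyc {..<N} (inv (prd N) \<circ> g) = ncyc {..<N} (inv g \<circ> prd N)"
proof -
  have "inv (inv g \<circ> prd N) = inv (prd N) \<circ> inv (inv g)"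
    by (intro o_inv_distrib permutes_bij[OF permutes_inv[OF assms]] permutes_bij[OF prd_permutes])
  then have "inv (inv g \<circ> prd N) = inv (prd N) \<circ> g"
    using permutes_inv_inv[OF assms] by simp
  moreover have "inv g \<circ> prd N permutes {..<N}"
    by (rule permutes_compose[OF prd_permutes permutes_inv[OF assms]])
  ultimately show ?thesis using ncyc_inv[of "{..<N}" "inv g \<circ> prd N"] by simp
qed

text \<open>The factorisation bounds the number of cycles by \<open>d + 1\<close>, and cycles of length at most \<open>r\<close>
  covering \<open>r * d + 1\<close> points attain this bound only if exactly one of them is shorter than \<open>r\<close>.\<close>

lemma root_perms_structure:
  assumes g: "g \<in> root_perms r d" and r: "r \<ge> 2"
  defines "n \<equiv> r * d + 1"
  shows "nc_below n g"
    and "\<exists>x < n. g x = x \<and> (\<forall>y < n. y \<noteq> x \<longrightarrow> card (orbit g y) = r)"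
proof -
  have gp: "g permutes {..<n}" and gr: "g ^^ r = id"
    and k: "ncyc {..<n} (inv g \<circ> prd n) + d = n"
    using g ncyc_inv_prd_comp by (auto simp: root_perms_def n_def)
  have p: "permutation g" using gp by (rule permutes_lessThan_permutation)
  have kp: "inv g \<circ> prd n permutes {..<n}"
    by (rule permutes_compose[OF prd_permutes permutes_inv[OF gp]])
  have "g \<circ> (inv g \<circ> prd n) = prd n"
    using permutes_inv_o(1)[OF gp] by (simp add: comp_assoc[symmetric])
  then have le: "ncyc {..<n} g + ncyc {..<n} (inv g \<circ> prd n) \<le> n + 1"
    by (intro ncyc_prd_factors_le gp kp) (simp_all add: n_def)
  let ?O = "orbit g ` {..<n}"
  have dvd: "card X dvd r" if "X \<in> ?O" for X using that card_orbit_dvd[OF p gr] by auto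
  have leX: "card X \<le> r" if "X \<in> ?O" for X using dvd_imp_le[OF dvd[OF that]] r by simp
  \<comment> \<open>A proper divisor of \<open>r\<close> is at most \<open>r / 2\<close>, so a short
    cycle misses at least half of \<open>r\<close>.\<close>
  have half: "2 * card X \<le> r" if "X \<in> ?O" "card X \<noteq> r" for X
  proof -
    have "card X dvd r" using that(1) by (rule dvd)
    then obtain q where q: "r = card X * q" by (rule dvdE)
    have "q \<noteq> 0" using q r by (cases "q = 0") auto
    moreover have "q \<noteq> 1" using q that(2) by auto
    ultimately have "2 \<le> q" by linarith
    then show ?thesis using q by (simp add: mult.commute)
  qed
  have sumO: "(\<Sum>X\<in>?O. card X) = n" using sum_card_orbits[OF _ gp] by simp
  have "(\<Sum>X\<in>?O. r - card X) + (\<Sum>X\<in>?O. card X) = (\<Sum>X\<in>?O. r)"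
    unfolding sum.distrib[symmetric] by (rule sum.cong) (use leX in auto)
  then have tot: "(\<Sum>X\<in>?O. r - card X) + n = r * card ?O" using sumO by (simp add: mult.commute)
  have "card ?O \<le> d + 1" using le k by (simp add: ncyc_def)
  moreover have "d < card ?O"
  proof (rule ccontr)
    assume "\<not> d < card ?O"
    then have "r * card ?O \<le> r * d" by simp
    then show False using tot unfolding n_def by linarith
  qed
  ultimately have cO: "card ?O = d + 1" by simp
  then show "nc_below n g" using gp k by (simp add: nc_below_def ncyc_def)
  \<comment> \<open>The deficits \<open>r - card X\<close> add up to
    \<open>r * (d + 1) - (r * d + 1) = r - 1\<close>.\<close>
  have "(\<Sum>X\<in>?O. r - card X) + (r * d + 1) = r * d + r"
    using tot unfolding cO unfolding n_def by (simp only: distrib_left mult_1_right)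
  then have def_sum: "(\<Sum>X\<in>?O. r - card X) = r - 1" by linarith
  then obtain X where X: "X \<in> ?O" "r - card X \<noteq> 0"
    using r by (metis One_nat_def diff_is_0_eq not_less_eq_eq numeral_2_eq_2 sum.neutral)
  have split: "(\<Sum>X\<in>?O. r - card X) = (r - card X) + (\<Sum>Y\<in>?O - {X}. r - card Y)"
    by (rule sum.remove) (use X in auto)
  \<comment> \<open>Two short cycles would already have a total deficit of at least
    \<open>r\<close>. So a single one carries the whole \<open>r - 1\<close> and is a fixed
    point.\<close>
  have others: "card Y = r" if "Y \<in> ?O" "Y \<noteq> X" for Y
  proof (rule ccontr)
    assume "card Y \<noteq> r"
    then have "2 * card Y \<le> r" "2 * card X \<le> r" using half that X by auto
    moreover have "r - card Y \<le> (\<Sum>Y\<in>?O - {X}. r - card Y)"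
      by (rule member_le_sum) (use that in auto)
    ultimately show False using split def_sum X(2) r by linarith
  qed
  then have "(\<Sum>Y\<in>?O - {X}. r - card Y) = 0" by simp
  then have "card X = 1" using split def_sum leX[OF X(1)] r by simp
  obtain x where x: "x < n" "X = orbit g x" using X(1) by auto
  have "g x = x" using card_orbit_funpow(1)[OF p, of x] \<open>card X = 1\<close> x by simp
  moreover have "card (orbit g y) = r" if "y < n" "y \<noteq> x" for y
  proof -
    have "X = {x}" using \<open>g x = x\<close> x by (simp add: orbit_eq_singleton_iff)
    then have "orbit g y \<noteq> X" using permutation_self_in_orbit[OF p, of y] that by auto
    then show ?thesis using others that by auto
  qed
  ultimately show "\<exists>x < n. g x = x \<and> (\<forall>y < n. y \<noteq> x \<longrightarrow> card (orbit g y) = r)"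
    using x by blast
qed

lemma root_perms_fixpoint_unique:
  assumes "g \<in> root_perms r d" "r \<ge> 2" "x < r * d + 1" "y < r * d + 1" "g x = x" "g y = y"
  shows "x = y"
proof -
  have "card (orbit g z) = 1" if "g z = z" for z
    using that orbit_eq_singleton_iff[of g z] by simp
  then show ?thesis using root_perms_structure(2)[OF assms(1,2)] assms by (metis Suc_1 Suc_n_not_le_n One_nat_def)
qed

lemma nc_perms_eq_root_perms:
  assumes r: "r \<ge> 2"
  shows "nc_perms r d 1 = {g \<in> root_perms r d. g 0 = 0}"
proof (intro equalityI subsetI)
  let ?n = "r * d + 1"
  fix g assume "g \<in> {g \<in> root_perms r d. g 0 = 0}"
  then have g: "g \<in> root_perms r d" "g 0 = 0" by auto
  obtain x where x: "x < ?n" "g x = x" "\<forall>y < ?n. y \<noteq> x \<longrightarrow> card (orbit g y) = r"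
    using root_perms_structure(2)[OF g(1) r] by blast
  have "x = 0" using root_perms_fixpoint_unique[OF g(1) r x(1) _ x(2) g(2)] by simp
  moreover have "orbit g 0 = {0}" using g(2) by (simp add: orbit_eq_singleton_iff)
  ultimately show "g \<in> nc_perms r d 1"
    using root_perms_structure(1)[OF g(1) r] x(3) by (auto simp: nc_perms_def)
next
  let ?n = "r * d + 1"
  fix g assume g: "g \<in> nc_perms r d 1"
  have nc: "nc_below ?n g" using g by (simp add: nc_perms_def)
  have gp: "g permutes {..<?n}" using nc by (rule nc_below_permutes)
  have p: "permutation g" using gp by (rule permutes_lessThan_permutation)
  have c0: "card (orbit g 0) = 1" using g by (simp add: nc_perms_def)
  then have g0: "g 0 = 0" using card_orbit_funpow(1)[OF p, of 0] by simp
  then have o0: "orbit g 0 = {0}" by (simp add: orbit_eq_singleton_iff)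
  have cx: "card (orbit g x) = r" if "x < ?n" "x \<noteq> 0" for x
    using g that o0 by (auto simp: nc_perms_def)
  have "(g ^^ r) x = x" for x
  proof -
    consider "x = 0" | "x \<noteq> 0" "x < ?n" | "\<not> x < ?n" by blast
    then show ?thesis
    proof cases
      case 1
      have "(g ^^ i) 0 = 0" for i by (induction i) (simp_all add: g0)
      then show ?thesis using 1 by simp
    next
      case 2
      then show ?thesis using card_orbit_funpow(1)[OF p, of x] cx by simp
    next
      case 3
      then have "g x = x" using permutes_not_in[OF gp] by simp
      then have "(g ^^ i) x = x" for i by (induction i) simp_all
      then show ?thesis by simp
    qed
  qed
  then have gr: "g ^^ r = id" by auto
  let ?O = "orbit g ` {..<?n}"
  have inO: "{0} \<in> ?O" using o0 by (metis imageI lessThan_iff zero_less_Suc Suc_eq_plus1)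
  have "(\<Sum>X\<in>?O. card X) = card {0 :: nat} + (\<Sum>X\<in>?O - {{0}}. card X)"
    by (rule sum.remove) (use inO in auto)
  moreover have "card X = r" if "X \<in> ?O - {{0}}" for X
    using that cx o0 by auto
  then have "(\<Sum>X\<in>?O - {{0}}. card X) = r * (card ?O - 1)"
    using inO by (simp add: mult.commute)
  moreover have "(\<Sum>X\<in>?O. card X) = r * d + 1"
    using sum_card_orbits[OF finite_lessThan gp] by (simp only: card_lessThan)
  moreover have "card {0 :: nat} = 1" by simp
  ultimately have "r * d = r * (card ?O - 1)" by linarith
  then have "card ?O - 1 = d" using r nat_mult_eq_cancel1[of r d "card ?O - 1"] by linarith
  moreover have "card ?O > 0" using inO by (auto simp: card_gt_0_iff)
  ultimately have "ncyc {..<?n} g = d + 1" unfolding ncyc_def by linarith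
  then show "g \<in> {g \<in> root_perms r d. g 0 = 0}"
    using nc gr g0 gp ncyc_inv_prd_comp[OF gp] by (simp add: root_perms_def nc_below_def)
qed

lemma inv_funpow_perm_conj:
  assumes "bij q"
  shows "(inv q \<circ> g \<circ> q) ^^ k = inv q \<circ> (g ^^ k) \<circ> q"
proof (induction k)
  case 0
  then show ?case using assms by (simp add: bij_is_inj)
next
  case (Suc k)
  have "inv q \<circ> g \<circ> q \<circ> (inv q \<circ> (g ^^ k) \<circ> q) = inv q \<circ> g \<circ> (q \<circ> inv q) \<circ> (g ^^ k) \<circ> q"
    by (simp only: comp_assoc)
  then show ?case using Suc assms by (simp add: fun_eq_iff surj_f_inv_f bij_is_surj)
qed

lemma ncyc_perm_conj:
  assumes "finite S" "p permutes S" "q permutes S"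
  shows "ncyc S (inv q \<circ> p \<circ> q) = ncyc S p"
proof -
  have "ncyc S (inv q \<circ> (p \<circ> q)) = ncyc S ((p \<circ> q) \<circ> inv q)"
    by (intro ncyc_comp_commute permutes_inv permutes_compose assms)
  then show ?thesis using permutes_inv_o(1)[OF assms(3)] by (simp add: comp_assoc)
qed

lemma root_perms_conj:
  assumes g: "g \<in> root_perms r d" and q: "q permutes {..<r * d + 1}"
    and comm: "q \<circ> prd (r * d + 1) = prd (r * d + 1) \<circ> q"
  shows "inv q \<circ> g \<circ> q \<in> root_perms r d"
proof -
  let ?n = "r * d + 1"
  let ?c = "prd ?n"
  have gp: "g permutes {..<?n}" using g by (simp add: root_perms_def)
  have bq: "bij q" using q by (rule permutes_bij)
  have bc: "bij ?c" using prd_permutes by (rule permutes_bij)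
  have qi: "q \<circ> inv q = id" "inv q \<circ> q = id" using permutes_inv_o[OF q] by auto
  have ci: "?c \<circ> inv ?c = id" "inv ?c \<circ> ?c = id" using permutes_inv_o[OF prd_permutes] by auto
  have "inv ?c \<circ> inv q = inv q \<circ> inv ?c"
    using o_inv_distrib[OF bq bc] o_inv_distrib[OF bc bq] comm by simp
  then have "inv ?c \<circ> (inv q \<circ> g \<circ> q) = inv q \<circ> (inv ?c \<circ> g) \<circ> q"
    by (simp only: comp_assoc[symmetric])
  moreover have "inv ?c \<circ> g permutes {..<?n}"
    by (intro permutes_compose permutes_inv prd_permutes gp)
  ultimately have "ncyc {..<?n} (inv ?c \<circ> (inv q \<circ> g \<circ> q)) = ncyc {..<?n} (inv ?c \<circ> g)"
    using ncyc_perm_conj[of "{..<?n}" "inv ?c \<circ> g" q] q by simp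
  moreover have "(inv q \<circ> g \<circ> q) ^^ r = id"
    using inv_funpow_perm_conj[OF bq, where g = g and k = r] g qi by (simp add: root_perms_def)
  moreover have "inv q \<circ> g \<circ> q permutes {..<?n}"
    by (intro permutes_compose permutes_inv q gp)
  ultimately show ?thesis using g by (simp add: root_perms_def)
qed

lemma funpow_permutes: "p permutes S \<Longrightarrow> (p ^^ k) permutes S"
  by (induction k) (auto intro: permutes_compose permutes_id simp del: comp_apply)

lemma prd_funpow: "x < N \<Longrightarrow> (prd N ^^ x) x = 0"
proof -
  have "k \<le> x \<Longrightarrow> (prd N ^^ k) x = x - k" if "x < N" for k
    using that by (induction k) (auto simp: prd_def)
  then show "x < N \<Longrightarrow> (prd N ^^ x) x = 0" by simp
qed

text \<open>The unique fixed point below \<open>r * d + 1\<close> partitions the set. Powers of the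
  cycle commute with the cycle, and conjugation by them carries each class to that of the fixed
  point \<open>0\<close>.\<close>

lemma card_root_perms:
  assumes "r \<ge> 2"
  shows "card (root_perms r d) = (r * d + 1) * card (nc_perms r d 1)"
proof -
  let ?n = "r * d + 1"
  let ?F = "\<lambda>x. {g \<in> root_perms r d. g x = x}"
  have fin: "finite (root_perms r d)"
    by (rule finite_subset[OF _ finite_permutations[of "{..<?n}"]]) (auto simp: root_perms_def)
  have eq: "root_perms r d = (\<Union>x\<in>{..<?n}. ?F x)"
    using root_perms_structure(2)[OF _ assms] by fastforce
  have sum: "card (\<Union>x\<in>{..<?n}. ?F x) = (\<Sum>x\<in>{..<?n}. card (?F x))"
    by (rule card_UN_disjoint) (use fin root_perms_fixpoint_unique[OF _ assms] in auto)
  have cF: "card (?F x) = card (?F 0)" if x: "x < ?n" for x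
  proof -
    let ?q = "prd ?n ^^ x"
    have q: "?q permutes {..<?n}" by (rule funpow_permutes[OF prd_permutes])
    have q': "inv ?q permutes {..<?n}" using q by (rule permutes_inv)
    have iq: "inv (inv ?q) = ?q" using q by (rule permutes_inv_inv)
    have comm: "?q \<circ> prd ?n = prd ?n \<circ> ?q" by (simp add: funpow_swap1 fun_eq_iff)
    have qi: "?q (inv ?q y) = y" "inv ?q (?q y) = y" for y using permutes_inverses[OF q] by auto
    have comm': "inv ?q \<circ> prd ?n = prd ?n \<circ> inv ?q"
    proof
      fix y
      have "?q (prd ?n (inv ?q y)) = prd ?n y" using fun_cong[OF comm, of "inv ?q y"] qi by simp
      then show "(inv ?q \<circ> prd ?n) y = (prd ?n \<circ> inv ?q) y" using qi by (metis comp_apply)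
    qed
    have qx: "?q x = 0" using x by (rule prd_funpow)
    then have q0: "inv ?q 0 = x" using qi by metis
    have "bij_betw (\<lambda>g. inv (inv ?q) \<circ> g \<circ> inv ?q) (?F x) (?F 0)"
    proof (rule bij_betw_byWitness[where f' = "\<lambda>g. inv ?q \<circ> g \<circ> ?q"])
      show "\<forall>g\<in>?F x. inv ?q \<circ> (inv (inv ?q) \<circ> g \<circ> inv ?q) \<circ> ?q = g"
        using qi iq by (auto simp: fun_eq_iff)
      show "\<forall>g\<in>?F 0. inv (inv ?q) \<circ> (inv ?q \<circ> g \<circ> ?q) \<circ> inv ?q = g"
        using qi iq by (auto simp: fun_eq_iff)
      show "(\<lambda>g. inv (inv ?q) \<circ> g \<circ> inv ?q) ` ?F x \<subseteq> ?F 0"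
        using root_perms_conj[OF _ q' comm'] q0 qx iq by auto
      show "(\<lambda>g. inv ?q \<circ> g \<circ> ?q) ` ?F 0 \<subseteq> ?F x"
        using root_perms_conj[OF _ q comm] q0 qx by auto
    qed
    then show ?thesis by (rule bij_betw_same_card)
  qed
  have "(\<Sum>x\<in>{..<?n}. card (?F x)) = (\<Sum>x\<in>{..<?n}. card (?F 0))"
    by (intro sum.cong refl cF) simp
  then have "card (root_perms r d) = ?n * card (?F 0)"
    using sum arg_cong[OF eq, of card] by (simp only: sum_constant card_lessThan of_nat_id)
  then show ?thesis by (simp only: nc_perms_eq_root_perms[OF assms])
qed

lemma card_root_perms_binomial:
  assumes "r \<ge> 2"
  shows "card (root_perms r d) = (r * d + 1) choose d"
proof -
  have "real (card (nc_perms r d 1)) = real 1 / real (r * d + 1) * real ((r * d + 1) choose d)"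
    using assms by (intro card_nc_perms) simp_all
  moreover have "N * (real 1 / N * X) = X" if "N > 0" for N X :: real using that by simp
  moreover have "real (r * d + 1) > 0" by linarith
  ultimately have "real (card (root_perms r d)) = real ((r * d + 1) choose d)"
    unfolding card_root_perms[OF assms] of_nat_mult by metis
  then show ?thesis by (simp only: of_nat_eq_iff)
qed

section \<open>Band generators\<close>

context group_add
begin

definition cj :: "'a \<Rightarrow> 'a \<Rightarrow> 'a" where
  "cj g x = g + x - g"

lemma cj_add: "cj g (x + y) = cj g x + cj g y"
  by (simp add: cj_def add.assoc diff_conv_add_uminus del: add_uminus_conv_diff)

lemma cj_cj: "cj g (cj h x) = cj (g + h) x"
  by (simp add: cj_def add.assoc minus_add diff_conv_add_uminus del: add_uminus_conv_diff)

lemma cj_cj_distrib: "cj g (cj h x) = cj (cj g h) (cj g x)"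
  by (simp add: cj_def add.assoc minus_add diff_conv_add_uminus del: add_uminus_conv_diff)

lemma cj_commute: "g + x = x + g \<Longrightarrow> cj g x = x"
  by (simp add: cj_def)

lemma cj_eq_iff: "cj g x = y \<longleftrightarrow> g + x = y + g"
  unfolding cj_def by (simp add: diff_eq_eq)

lemma commute_add: "x + y = y + x \<Longrightarrow> x + z = z + x \<Longrightarrow> x + (y + z) = (y + z) + x"
  by (metis add.assoc)

lemma commute_uminus: "x + y = y + x \<Longrightarrow> x + - y = - y + x"
  by (metis add.assoc add.right_neutral left_minus add.left_neutral right_minus)

lemma commute_cj: "x + g = g + x \<Longrightarrow> x + y = y + x \<Longrightarrow> x + cj g y = cj g y + x"
  unfolding cj_def diff_conv_add_uminus by (intro commute_add commute_uminus)

end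

text \<open>Only the relations are assumed, so the calculus of band generators holds in every image
  of the braid group; faithfulness enters later, with \<open>val_eq_iff\<close>.\<close>

locale artin_system =
  fixes n :: nat and s :: "nat \<Rightarrow> 'a :: group_add"
  assumes far: "k + 1 < l \<Longrightarrow> l + 1 < n \<Longrightarrow> s k + s l = s l + s k"
    and braid: "k + 2 < n \<Longrightarrow> s k + s (k + 1) + s k = s (k + 1) + s k + s (k + 1)"
begin

text \<open>All indices start at \<open>0\<close>: \<open>bnd p q\<close> is the band generator \<open>a\<close> with indices \<open>p + 1\<close> and \<open>q + 1\<close>.\<close>

primrec bnd :: "nat \<Rightarrow> nat \<Rightarrow> 'a" where
  "bnd 0 q = 0"
| "bnd (Suc p) q = (if p = q then s q else cj (s p) (bnd p q))"

lemma commute_bndI: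
  assumes "q < p" "\<And>k. q \<le> k \<Longrightarrow> k < p \<Longrightarrow> x + s k = s k + x"
  shows "x + bnd p q = bnd p q + x"
  using assms
proof (induction p)
  case (Suc p)
  then show ?case by (cases "p = q") (auto intro: commute_cj)
qed simp

lemma s_bnd_above: "q < p \<Longrightarrow> p < k \<Longrightarrow> k + 1 < n \<Longrightarrow> s k + bnd p q = bnd p q + s k"
  by (rule commute_bndI) (simp_all add: far[symmetric])

lemma s_bnd_below: "q < p \<Longrightarrow> p < n \<Longrightarrow> k + 1 < q \<Longrightarrow> s k + bnd p q = bnd p q + s k"
  by (rule commute_bndI) (simp_all add: far)

text \<open>The recursion of \<open>bnd\<close> strips the upper index; this is its mirror image for
  the lower one. It starts from the braid relation and continues because \<open>s p\<close> commutes
  with \<open>s q\<close>.\<close>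

lemma bnd_shift_lower: "q + 1 < p \<Longrightarrow> p < n \<Longrightarrow> bnd p q = cj (- s q) (bnd p (q + 1))"
proof (induction p)
  case (Suc p)
  show ?case
  proof (cases "p = q + 1")
    case True
    have "s q + s (q + 1) + s q = s (q + 1) + s q + s (q + 1)"
      by (rule braid) (use Suc.prems True in simp)
    then have "s q + cj (s (q + 1)) (s q) = s (q + 1) + s q"
      unfolding cj_def by (metis add.assoc add_diff_cancel diff_conv_add_uminus)
    then have "cj (- s q) (s (q + 1)) = cj (s (q + 1)) (s q)"
      unfolding cj_eq_iff by (metis add.assoc minus_add_cancel add_minus_cancel minus_equation_iff add.right_inverse add.right_neutral)
    then show ?thesis using True by simp
  next
    case False
    then have IH: "bnd p q = cj (- s q) (bnd p (q + 1))" using Suc by simp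
    have "s p + - s q = - s q + s p"
      using far[of q p] Suc.prems False by (intro commute_uminus) simp
    then have "cj (s p) (cj (- s q) x) = cj (- s q) (cj (s p) x)" for x
      unfolding cj_cj by simp
    then show ?thesis using Suc.prems False IH by auto
  qed
qed simp

lemma s_bnd_lower: "q + 1 < p \<Longrightarrow> p < n \<Longrightarrow> s q + bnd p q = bnd p (q + 1) + s q"
  using bnd_shift_lower[of q p] by (simp add: cj_def add.assoc[symmetric])

text \<open>When the upper index first exceeds \<open>k + 1\<close>, the generator passes through by
  the braid relation, since \<open>s (k + 1)\<close> commutes with \<open>bnd k q\<close>. All later
  conjugating letters commute with \<open>s k\<close>.\<close>

lemma s_bnd_nested: "q < k \<Longrightarrow> k + 1 < p \<Longrightarrow> p < n \<Longrightarrow> s k + bnd p q = bnd p q + s k"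
proof (induction p)
  case (Suc p)
  show ?case
  proof (cases "p = k + 1")
    case True
    let ?a = "s k" and ?b = "s (k + 1)" and ?A = "bnd k q"
    have br: "?a + ?b + ?a = ?b + ?a + ?b"
      by (rule braid) (use Suc.prems True in simp)
    have bA: "?b + ?A = ?A + ?b" using Suc.prems True by (intro s_bnd_above) auto
    have "cj ?a (cj ?b (cj ?a ?A)) = cj (?a + ?b + ?a) ?A"
      by (simp add: cj_cj add.assoc)
    also have "\<dots> = cj ?b (cj ?a (cj ?b ?A))"
      unfolding br by (simp add: cj_cj add.assoc)
    also have "cj ?b ?A = ?A" using bA by (rule cj_commute)
    finally have "?a + cj ?b (cj ?a ?A) = cj ?b (cj ?a ?A) + ?a" by (simp only: cj_eq_iff)
    then show ?thesis using True Suc.prems by simp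
  next
    case False
    then have "s k + bnd p q = bnd p q + s k" using Suc by simp
    moreover have "s k + s p = s p + s k" using far[of k p] Suc.prems False by simp
    ultimately show ?thesis using Suc.prems False by (auto intro: commute_cj)
  qed
qed simp

lemma bnd_commute_disjoint:
  assumes "q < p" "p < n" "u < q" "v < u"
  shows "bnd p q + bnd u v = bnd u v + bnd p q"
proof (rule commute_bndI[OF assms(4)])
  fix k assume "v \<le> k" "k < u"
  then show "bnd p q + s k = s k + bnd p q" using s_bnd_below[of q p k] assms by simp
qed

lemma bnd_commute_nested:
  assumes "p < n" "u < p" "v < u" "q < v"
  shows "bnd p q + bnd u v = bnd u v + bnd p q"
proof (rule commute_bndI[OF assms(3)])
  fix k assume "v \<le> k" "k < u"
  then show "bnd p q + s k = s k + bnd p q" using s_bnd_nested[of q k p] assms by simp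
qed

text \<open>With \<open>bnd_triangle2\<close> and the commutation lemmas, these are the
  Birman-Ko-Lee relations. Raising \<open>p\<close> conjugates by \<open>s p\<close>, which leaves
  \<open>bnd q u\<close> alone.\<close>

lemma bnd_triangle1: "u < q \<Longrightarrow> q < p \<Longrightarrow> p < n \<Longrightarrow> bnd p q + bnd q u = bnd p u + bnd p q"
proof (induction p)
  case (Suc p)
  show ?case
  proof (cases "p = q")
    case True
    then show ?thesis using Suc.prems by (simp add: cj_def)
  next
    case False
    then have "bnd p q + bnd q u = bnd p u + bnd p q" using Suc by simp
    then have "cj (s p) (bnd p q) + cj (s p) (bnd q u) = cj (s p) (bnd p u) + cj (s p) (bnd p q)"
      by (metis cj_add)
    moreover have "cj (s p) (bnd q u) = bnd q u"
      using Suc.prems False by (intro cj_commute s_bnd_above) auto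
    ultimately show ?thesis using Suc.prems False by auto
  qed
qed simp

text \<open>The base case \<open>p = q + 1\<close> of \<open>bnd_triangle2\<close>. As the upper
  index is at its minimum here, the induction lowers the smallest index instead, by conjugation with
  a negative generator.\<close>

lemma s_bnd_triangle: "d > 0 \<Longrightarrow> q + 1 < n \<Longrightarrow> d \<le> q \<Longrightarrow>
    s q + bnd q (q - d) = bnd q (q - d) + bnd (q + 1) (q - d)"
proof (induction d)
  case (Suc d)
  show ?case
  proof (cases "d = 0")
    case True
    then obtain u where q: "q = Suc u" using Suc.prems by (cases q) auto
    have "s u + s (u + 1) + s u = s (u + 1) + s u + s (u + 1)"
      by (rule braid) (use Suc.prems q in simp)
    then have "s u + cj (s (u + 1)) (s u) = s (u + 1) + s u"
      unfolding cj_def by (metis add.assoc add_diff_cancel diff_conv_add_uminus)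
    then show ?thesis using q True by simp
  next
    case False
    let ?u = "q - Suc d"
    have u: "?u + 1 = q - d" using Suc.prems by simp
    have IH: "s q + bnd q (q - d) = bnd q (q - d) + bnd (q + 1) (q - d)" using Suc False by simp
    have 1: "bnd q ?u = cj (- s ?u) (bnd q (q - d))"
      using bnd_shift_lower[of ?u q] u Suc.prems False by simp
    have 2: "bnd (q + 1) ?u = cj (- s ?u) (bnd (q + 1) (q - d))"
    proof -
      have "bnd (q + 1) ?u = cj (- s ?u) (bnd (q + 1) (?u + 1))"
        by (rule bnd_shift_lower) (use Suc.prems False in auto)
      then show ?thesis unfolding u .
    qed
    have "s q + - s ?u = - s ?u + s q"
      using far[of ?u q] Suc.prems False by (intro commute_uminus) simp
    then have 3: "cj (- s ?u) (s q) = s q" by (intro cj_commute) simp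
    have "cj (- s ?u) (s q) + cj (- s ?u) (bnd q (q - d))
        = cj (- s ?u) (bnd q (q - d)) + cj (- s ?u) (bnd (q + 1) (q - d))"
      using IH by (metis cj_add)
    then show ?thesis unfolding 1 2 3 .
  qed
qed simp

lemma bnd_triangle2: "u < q \<Longrightarrow> q < p \<Longrightarrow> p < n \<Longrightarrow> bnd p q + bnd q u = bnd q u + bnd p u"
proof (induction p)
  case (Suc p)
  show ?case
  proof (cases "p = q")
    case True
    then show ?thesis using Suc.prems s_bnd_triangle[of "q - u" q] by simp
  next
    case False
    then have "bnd p q + bnd q u = bnd q u + bnd p u" using Suc by simp
    then have "cj (s p) (bnd p q) + cj (s p) (bnd q u) = cj (s p) (bnd q u) + cj (s p) (bnd p u)"
      by (metis cj_add)
    moreover have "cj (s p) (bnd q u) = bnd q u"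
      using Suc.prems False by (intro cj_commute s_bnd_above) auto
    ultimately show ?thesis using Suc.prems False by auto
  qed
qed simp

section \<open>The Garside element of the first strands, and how it rotates band generators\<close>

primrec dlt :: "nat \<Rightarrow> 'a" where
  "dlt 0 = 0"
| "dlt (Suc m) = (if m = 0 then 0 else s (m - 1) + dlt m)"

lemma s_dlt_above: "m \<le> k \<Longrightarrow> k + 1 < n \<Longrightarrow> s k + dlt m = dlt m + s k"
proof (induction m)
  case (Suc m)
  then show ?case
    using far[of "m - 1" k] by (cases "m = 0") (auto intro!: commute_add)
qed simp

lemma dlt_s: "m \<le> n \<Longrightarrow> k + 2 < m \<Longrightarrow> dlt m + s (k + 1) = s k + dlt m"
proof (induction m)
  case (Suc m)
  show ?case
  proof (cases "k + 2 = m")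
    case True
    have d: "dlt (Suc m) = s (k + 1) + (s k + dlt (k + 1))"
      unfolding True[symmetric] by simp
    have "s (k + 1) + dlt (k + 1) = dlt (k + 1) + s (k + 1)"
      using Suc.prems True by (intro s_dlt_above) auto
    then have "dlt (Suc m) + s (k + 1) = s (k + 1) + s k + s (k + 1) + dlt (k + 1)"
      unfolding d by (simp add: add.assoc)
    also have "\<dots> = s k + s (k + 1) + s k + dlt (k + 1)"
      using braid[of k] Suc.prems by simp
    finally show ?thesis unfolding d by (simp add: add.assoc)
  next
    case False
    then have IH: "dlt m + s (k + 1) = s k + dlt m" using Suc by simp
    have "s k + s (m - 1) = s (m - 1) + s k" using far[of k "m - 1"] Suc.prems False by simp
    then have "s (m - 1) + (s k + dlt m) = s k + (s (m - 1) + dlt m)" by (metis add.assoc)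
    then show ?thesis using IH Suc.prems by (simp add: add.assoc)
  qed
qed simp

abbreviation dl :: 'a where "dl \<equiv> dlt n"

lemma dl_bnd_Suc: "q < p \<Longrightarrow> p + 1 < n \<Longrightarrow> cj dl (bnd (p + 1) (q + 1)) = bnd p q"
proof (induction p)
  case (Suc p)
  have s: "cj dl (s (k + 1)) = s k" if "k + 2 < n" for k
    unfolding cj_eq_iff using dlt_s[of n k] that by simp
  show ?case
  proof (cases "p = q")
    case True
    then show ?thesis using s[of q] Suc.prems by simp
  next
    case False
    then have IH: "cj dl (bnd (p + 1) (q + 1)) = bnd p q" using Suc by simp
    have "cj dl (cj (s (p + 1)) x) = cj (cj dl (s (p + 1))) (cj dl x)" for x
      by (rule cj_cj_distrib)
    then show ?thesis using IH s[of p] Suc.prems False by simp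
  qed
qed simp

lemma bnd_0_dlt: "m \<ge> 2 \<Longrightarrow> bnd (m - 1) 0 + dlt m = dlt m + s 0"
proof (induction m)
  case (Suc m)
  show ?case
  proof (cases "m = 1")
    case False
    then obtain l where m: "m = Suc l" "l > 0" using Suc.prems by (cases m) auto
    have "bnd l 0 + dlt m = dlt m + s 0" using Suc m by simp
    moreover have "cj (s l) (bnd l 0) + (s l + dlt m) = s l + (bnd l 0 + dlt m)"
      by (simp add: cj_def add.assoc minus_add diff_conv_add_uminus del: add_uminus_conv_diff)
    ultimately show ?thesis using m by (simp add: add.assoc)
  qed simp
qed simp

lemma dl_bnd_0: "0 < p \<Longrightarrow> p < n \<Longrightarrow> cj dl (bnd p 0) = bnd (n - 1) (p - 1)"
proof (induction p)
  case (Suc p)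
  show ?case
  proof (cases "p = 0")
    case True
    then show ?thesis using bnd_0_dlt[of n] Suc.prems by (simp add: cj_eq_iff)
  next
    case False
    then obtain k where k: "p = Suc k" by (cases p) auto
    have IH: "cj dl (bnd p 0) = bnd (n - 1) k" using Suc k by simp
    have s: "cj dl (s p) = s k"
      unfolding cj_eq_iff using dlt_s[of n k] Suc.prems k by simp
    have "cj dl (cj (s p) x) = cj (cj dl (s p)) (cj dl x)" for x
      by (rule cj_cj_distrib)
    then have "cj dl (bnd (Suc p) 0) = cj (s k) (bnd (n - 1) k)" using IH s k by simp
    also have "\<dots> = bnd (n - 1) p"
      unfolding cj_eq_iff using s_bnd_lower[of k "n - 1"] Suc.prems k by simp
    finally show ?thesis by simp
  qed
qed simp

definition bs :: "nat \<Rightarrow> nat \<Rightarrow> 'a" where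
  "bs x y = bnd (max x y) (min x y)"

text \<open>Conjugation by the Garside element rotates the points. A letter involving
  \<open>0\<close> wraps around to \<open>n - 1\<close>, which exchanges its smaller and larger
  index; hence the symmetric notation \<open>bs\<close>.\<close>

lemma dl_bs:
  assumes "x < n" "y < n" "x \<noteq> y"
  shows "dl + bs x y = bs (prd n x) (prd n y) + dl"
proof -
  have lt: "dl + bnd p q = bs (prd n p) (prd n q) + dl" if "q < p" "p < n" for p q
  proof (cases "q = 0")
    case True
    then show ?thesis
      using dl_bnd_0[of p] that by (simp add: cj_eq_iff bs_def prd_def max_def min_def)
  next
    case False
    then show ?thesis
      using dl_bnd_Suc[of "q - 1" "p - 1"] that by (simp add: cj_eq_iff bs_def prd_def max_def min_def)
  qed
  show ?thesis
  proof (cases "x < y")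
    case True
    then show ?thesis using lt[of x y] assms by (simp add: bs_def max.commute min.commute max_def min_def)
  next
    case False
    then show ?thesis using lt[of y x] assms by (simp add: bs_def max_def min_def)
  qed
qed

definition bsum :: "(nat \<times> nat) list \<Rightarrow> 'a" where
  "bsum ps = sum_list (map (\<lambda>(p, q). bs p q) ps)"

lemma bsum_simps [simp]:
  "bsum [] = 0" "bsum ((p, q) # ps) = bs p q + bsum ps" "bsum (ps @ qs) = bsum ps + bsum qs"
  by (simp_all add: bsum_def)

lemma dl_bsum:
  "transps_on {..<n} ps \<Longrightarrow> dl + bsum ps = bsum (map (map_prod (prd n) (prd n)) ps) + dl"
proof (induction ps)
  case (Cons t ps)
  obtain x y where t: "t = (x, y)" by force
  have "dl + bsum (t # ps) = (dl + bs x y) + bsum ps" using t by (simp add: add.assoc)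
  also have "dl + bs x y = bs (prd n x) (prd n y) + dl"
    using Cons.prems t by (intro dl_bs) auto
  also have "\<dots> + bsum ps = bs (prd n x) (prd n y) + (dl + bsum ps)" by (simp add: add.assoc)
  also have "dl + bsum ps = bsum (map (map_prod (prd n) (prd n)) ps) + dl"
    using Cons t by simp
  finally show ?case using t by (simp add: add.assoc)
qed simp

end

section \<open>Shortest factorisations of the Garside element\<close>

definition ord_on :: "nat \<Rightarrow> (nat \<times> nat) list \<Rightarrow> bool" where
  "ord_on m ps \<longleftrightarrow> (\<forall>(p, q) \<in> set ps. q < p \<and> p < m)"

lemma ord_on_simps [simp]:
  "ord_on m []" "ord_on m ((p, q) # ps) \<longleftrightarrow> q < p \<and> p < m \<and> ord_on m ps"
  "ord_on m (ps @ qs) \<longleftrightarrow> ord_on m ps \<and> ord_on m qs"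
  by (auto simp: ord_on_def)

lemma ord_on_transps_on: "ord_on m ps \<Longrightarrow> transps_on {..<m} ps"
  by (auto simp: ord_on_def transps_on_def)

definition ordered :: "(nat \<times> nat) list \<Rightarrow> (nat \<times> nat) list" where
  "ordered ts = map (\<lambda>(x, y). (max x y, min x y)) ts"

lemma length_ordered [simp]: "length (ordered ts) = length ts"
  by (simp add: ordered_def)

lemma apply_transps_ordered [simp]: "apply_transps (ordered ts) = apply_transps ts"
proof -
  have "transpose (max x y) (min x y) = transpose x y" for x y :: nat
    by (simp add: max_def min_def transpose_commute)
  then show ?thesis by (induction ts) (auto simp: ordered_def)
qed

lemma ord_on_ordered: "transps_on {..<m} ts \<Longrightarrow> ord_on m (ordered ts)"
  by (induction ts) (auto simp: ordered_def max_def min_def)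

text \<open>Adjacent letters of a shortest factorisation of the cycle into transpositions are
  noncrossing: after splitting the cycle at \<open>x, y\<close>, the next letter may not merge its two parts.\<close>

lemma reduced_adjacent:
  assumes ord: "ord_on m (u @ (x, y) # (x', y') # v)"
    and len: "length (u @ (x, y) # (x', y') # v) + 1 = m"
    and app: "apply_transps (u @ (x, y) # (x', y') # v) = prd m"
  shows "(y < x' \<and> x' \<le> x) \<longleftrightarrow> (y < y' \<and> y' \<le> x)"
proof -
  let ?c = "prd m" and ?t = "transpose x y" and ?t' = "transpose x' y'"
  let ?U = "apply_transps u" and ?V = "apply_transps v"
  let ?S = "{..<m}"
  have xy: "y < x" "x < m" "y' < x'" "x' < m" using ord by auto
  have c: "?c permutes ?S" by (rule prd_permutes)
  have U: "?U permutes ?S" and V: "?V permutes ?S"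
    using ord by (auto intro!: transps_on_permutes ord_on_transps_on)
  have t: "?t permutes ?S" using xy by (intro permutes_swap_id) auto
  have tc: "?t \<circ> ?c permutes ?S" by (rule permutes_compose[OF c t])
  have X: "inv ?c \<circ> ?U \<circ> ?c permutes ?S" by (intro permutes_compose permutes_inv U c)
  have "?U \<circ> (?t \<circ> (?t' \<circ> ?V)) = ?c" using app by (simp add: comp_assoc)
  then have cV: "?c z = ?U (?t (?t' (?V z)))" for z by (metis comp_apply)
  \<comment> \<open>Carrying the prefix \<open>u\<close> around the cycle by conjugation leaves the
    two neighbouring letters next to \<open>?c\<close>.\<close>
  have W: "?V \<circ> (inv ?c \<circ> ?U \<circ> ?c) = ?t' \<circ> (?t \<circ> ?c)"
  proof
    fix z
    let ?w = "inv ?c (?U (?c z))"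
    have "?U (?t (?t' (?V ?w))) = ?U (?c z)"
      using cV[of ?w] permutes_inverses(1)[OF c] by simp
    then have "?t (?t' (?V ?w)) = ?c z" using permutes_inj[OF U] by (auto dest: injD)
    then have "?V ?w = ?t' (?t (?c z))" by (metis transpose_involutory)
    then show "(?V \<circ> (inv ?c \<circ> ?U \<circ> ?c)) z = (?t' \<circ> (?t \<circ> ?c)) z" by simp
  qed
  have "m \<le> ncyc ?S ?U + length u" "m \<le> ncyc ?S ?V + length v"
    using card_le_ncyc_transps[of ?S u] card_le_ncyc_transps[of ?S v] ord
    by (auto simp: ord_on_transps_on)
  moreover have "ncyc ?S (inv ?c \<circ> ?U \<circ> ?c) = ncyc ?S ?U"
    by (rule ncyc_perm_conj[OF _ U c]) simp
  moreover have "ncyc ?S ?V + ncyc ?S (inv ?c \<circ> ?U \<circ> ?c)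
      \<le> ncyc ?S (?V \<circ> (inv ?c \<circ> ?U \<circ> ?c)) + card ?S"
    by (rule ncyc_comp_bounds[OF _ V X]) simp
  \<comment> \<open>Only \<open>m - 3\<close> letters remain in \<open>u\<close> and
    \<open>v\<close>, so this product has at least three cycles, whereas
    \<open>?t \<circ> ?c\<close> has at most two: the second letter has to split.\<close>
  ultimately have ge: "3 \<le> ncyc ?S (?t' \<circ> (?t \<circ> ?c))" using len W by simp
  have "ncyc ?S (?c \<circ> ?t) \<le> Suc (ncyc ?S ?c)"
    using xy by (intro ncyc_transpose_bounds(2) c) auto
  moreover have "ncyc ?S (?t \<circ> ?c) = ncyc ?S (?c \<circ> ?t)"
    by (rule ncyc_comp_commute[OF _ t c]) simp
  moreover have "ncyc ?S ?c = 1" using xy by (intro ncyc_prd) simp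
  ultimately have le: "ncyc ?S (?t \<circ> ?c) \<le> 2" by simp
  have p: "permutation (?t \<circ> ?c)" using tc by (rule permutes_lessThan_permutation)
  \<comment> \<open>\<open>{y<..x}\<close> is one of the parts that \<open>?t\<close> cuts out of
    the descending cycle: \<open>y + 1\<close> is now sent to \<open>x\<close>.\<close>
  have orb: "orbit (?t \<circ> ?c) z \<subseteq> {y<..x}" if "z \<in> {y<..x}" for z
  proof (rule orbit_subset_invariant[OF that])
    fix w assume w: "w \<in> {y<..x}"
    then have "?c w = w - 1" using xy by (simp add: prd_def)
    then show "(?t \<circ> ?c) w \<in> {y<..x}"
      using w xy by (auto simp: transpose_def)
  qed
  have "y' \<in> orbit (?t \<circ> ?c) x'"
  proof (rule ccontr)
    assume "y' \<notin> orbit (?t \<circ> ?c) x'"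
    then have "ncyc ?S (?t \<circ> ?c) = Suc (ncyc ?S (?t' \<circ> (?t \<circ> ?c)))"
      using xy by (intro ncyc_merge_left tc) simp_all
    then show False using ge le by simp
  qed
  moreover from this have "x' \<in> orbit (?t \<circ> ?c) y'"
    by (rule orbit_swap[OF permutation_self_in_orbit[OF p]])
  ultimately have "x' \<in> {y<..x} \<longleftrightarrow> y' \<in> {y<..x}" using orb[of x'] orb[of y'] by blast
  then show ?thesis by simp
qed

context artin_system
begin

lemma bs_ordered: "q < p \<Longrightarrow> bs p q = bnd p q"
  by (simp add: bs_def max_def min_def)

lemma bsum_ordered [simp]: "bsum (ordered ts) = bsum ts"
proof -
  have "bs (max x y) (min x y) = bs x y" for x y by (simp add: bs_def max_def min_def)
  then show ?thesis by (induction ts) (auto simp: ordered_def)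
qed

text \<open>By \<open>reduced_adjacent\<close> a neighbour \<open>(x, y)\<close> either commutes
  with \<open>(L, a)\<close> or has \<open>y = a\<close>, where a triangle relation changes
  \<open>a\<close> into \<open>x\<close>. The inert prefix \<open>b\<close> makes the lemma
  applicable again after a first top letter has been moved to the front.\<close>

lemma move_top_letter_front:
  assumes "L < n" "ord_on (Suc L) (b @ u @ (L, a) # v)" "length (b @ u @ (L, a) # v) = L"
    and "apply_transps (b @ u @ (L, a) # v) = prd (Suc L)"
    and "\<forall>t \<in> set u. fst t \<noteq> L"
  shows "\<exists>a'. a' < L \<and> bsum (u @ [(L, a)]) = bsum ((L, a') # u)
    \<and> apply_transps (u @ [(L, a)]) = apply_transps ((L, a') # u)"
  using assms(2-)
proof (induction u arbitrary: a v rule: rev_induct)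
  case Nil
  then show ?case by auto
next
  case (snoc t u)
  obtain x y where t: "t = (x, y)" by force
  have xy: "y < x" "x < L" "a < L" using snoc.prems t by auto
  have "(y < L \<and> L \<le> x) \<longleftrightarrow> (y < a \<and> a \<le> x)"
    by (rule reduced_adjacent[where u = "b @ u" and v = v and m = "Suc L"])
      (use snoc.prems t in \<open>simp_all del: comp_apply\<close>)
  then have a: "a \<le> y \<or> x < a" using xy by auto
  obtain a1 where a1: "a1 < L" "bnd x y + bnd L a = bnd L a1 + bnd x y"
    "transpose x y \<circ> transpose L a = transpose L a1 \<circ> transpose x y"
  proof (cases "a = y")
    case True
    have "bnd x y + bnd L y = bnd L x + bnd x y"
      using bnd_triangle1[of y x L] bnd_triangle2[of y x L] xy assms(1) by simp
    moreover have "transpose x y \<circ> transpose L y = transpose L x \<circ> transpose x y"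
      using xy by (auto simp: fun_eq_iff transpose_def)
    ultimately show thesis using that[of x] True xy by blast
  next
    case False
    have "bnd x y + bnd L a = bnd L a + bnd x y"
    proof (cases "x < a")
      case True
      then show ?thesis using bnd_commute_disjoint[of a L x y] xy assms(1) by simp
    next
      case False
      then show ?thesis using bnd_commute_nested[of L x y a] xy assms(1) a \<open>a \<noteq> y\<close> by simp
    qed
    moreover have "transpose x y \<circ> transpose L a = transpose L a \<circ> transpose x y"
      using xy a False by (auto simp: fun_eq_iff transpose_def)
    ultimately show thesis using that[of a] xy by blast
  qed
  have app: "apply_transps [(x, y), (L, a)] = apply_transps [(L, a1), (x, y)]"
    using a1(3) by simp
  have "apply_transps (b @ u @ (L, a1) # (x, y) # v)
      = apply_transps b \<circ> apply_transps u \<circ> apply_transps [(L, a1), (x, y)] \<circ> apply_transps v"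
    by (simp add: comp_assoc)
  also have "\<dots> = apply_transps (b @ (u @ [t]) @ (L, a) # v)"
    unfolding app[symmetric] t by (simp add: comp_assoc)
  also have "\<dots> = prd (Suc L)" by (rule snoc.prems(3))
  finally have app1: "apply_transps (b @ u @ (L, a1) # (x, y) # v) = prd (Suc L)" .
  have ord1: "ord_on (Suc L) (b @ u @ (L, a1) # (x, y) # v)"
    and len1: "length (b @ u @ (L, a1) # (x, y) # v) = L" and top1: "\<forall>t \<in> set u. fst t \<noteq> L"
    using snoc.prems(1,2,4) t xy a1(1) by auto
  from snoc.IH[OF ord1 len1 app1 top1] obtain a' where a': "a' < L" "bsum (u @ [(L, a1)]) = bsum ((L, a') # u)"
    "apply_transps (u @ [(L, a1)]) = apply_transps ((L, a') # u)"
    by blast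
  have "bsum ((u @ [t]) @ [(L, a)]) = bsum (u @ [(L, a1)]) + bs x y"
    using a1 t xy by (simp add: bs_ordered add.assoc)
  also have "\<dots> = bsum ((L, a') # u @ [t])" using a' t by (simp add: add.assoc)
  finally have 1: "bsum ((u @ [t]) @ [(L, a)]) = bsum ((L, a') # u @ [t])" .
  have "apply_transps ((u @ [t]) @ [(L, a)]) = apply_transps u \<circ> apply_transps [(x, y), (L, a)]"
    using t by simp
  also have "\<dots> = apply_transps (u @ [(L, a1)]) \<circ> transpose x y"
    unfolding app by (simp add: comp_assoc)
  also have "\<dots> = apply_transps ((L, a') # u @ [t])" using a' t by (simp add: comp_assoc)
  finally show ?case using 1 a'(1) by auto
qed

text \<open>Outer induction on the number of points, inner induction on the number of letters that
  involve the last point \<open>L\<close>. Two such letters at the front are traded for one by a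
  triangle relation; a single one must be \<open>(L, L - 1)\<close>, and the rest factorises the
  shorter cycle.\<close>

lemma bsum_reduced_prd:
  "m \<le> n \<Longrightarrow> ord_on m ps \<Longrightarrow> length ps = m - 1 \<Longrightarrow> apply_transps ps = prd m
    \<Longrightarrow> bsum ps = dlt m"
proof (induction m arbitrary: ps)
  case 0
  then show ?case by simp
next
  case (Suc L)
  note IHm = Suc.IH
  show ?case
  proof (cases "L = 0")
    case True
    then show ?thesis using Suc.prems by simp
  next
    case False
    let ?top = "\<lambda>ps. length (filter (\<lambda>t. fst t = L) ps)"
    have "ord_on (Suc L) ps \<Longrightarrow> length ps = L \<Longrightarrow> apply_transps ps = prd (Suc L)
        \<Longrightarrow> bsum ps = dlt (Suc L)" for ps
    proof (induction "?top ps" arbitrary: ps rule: less_induct)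
      case less
      have ord_less: "ord_on L w" if "ord_on (Suc L) w" "\<forall>t \<in> set w. fst t \<noteq> L" for w
        using that by (fastforce simp: ord_on_def less_Suc_eq)
      have fixL: "apply_transps w L = L" if "ord_on L w" for w
        using transps_on_permutes[OF ord_on_transps_on[OF that]] by (simp add: permutes_not_in)
      have "\<exists>t \<in> set ps. fst t = L"
      proof (rule ccontr)
        assume "\<not> (\<exists>t \<in> set ps. fst t = L)"
        then have "apply_transps ps L = L" using less.prems ord_less fixL by blast
        then show False using less.prems False by (simp add: prd_def)
      qed
      then obtain u t v where u: "ps = u @ t # v" "fst t = L" "\<forall>t \<in> set u. fst t \<noteq> L"
        by (rule split_list_first_propE)
      obtain a where t: "t = (L, a)" using u(2) by (cases t) auto
      obtain a' where a': "a' < L" "bsum (u @ [(L, a)]) = bsum ((L, a') # u)"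
        "apply_transps (u @ [(L, a)]) = apply_transps ((L, a') # u)"
        using move_top_letter_front[of L "[]" u a v] less.prems Suc.prems(1) u t by auto
      let ?w = "u @ v"
      have top: "?top ps = Suc (?top ?w)" using u t by simp
      have ps: "bsum ps = bsum ((L, a') # ?w)" "apply_transps ps = apply_transps ((L, a') # ?w)"
      proof -
        have "ps = (u @ [(L, a)]) @ v" using u t by simp
        then have "bsum ps = bsum (u @ [(L, a)]) + bsum v"
          "apply_transps ps = apply_transps (u @ [(L, a)]) \<circ> apply_transps v"
          by (simp_all only: bsum_simps apply_transps_append)
        then show "bsum ps = bsum ((L, a') # ?w)" "apply_transps ps = apply_transps ((L, a') # ?w)"
          unfolding a'(2,3) by (simp_all add: add.assoc comp_assoc)
      qed
      have w: "ord_on (Suc L) ?w" "length ?w + 1 = L" using less.prems u t by auto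
      show ?case
      proof (cases "\<exists>t \<in> set ?w. fst t = L")
        case False
        then have ordw: "ord_on L ?w" using w(1) ord_less by blast
        have eq: "transpose L a' \<circ> apply_transps ?w = prd (Suc L)" using ps(2) less.prems by simp
        \<comment> \<open>The other letters fix \<open>L\<close>, so the first letter alone decides
          where \<open>L\<close> goes.\<close>
        have "a' = prd (Suc L) L" using fun_cong[OF eq, of L] fixL[OF ordw] by simp
        then have aL: "a' = L - 1" using \<open>L \<noteq> 0\<close> by (simp add: prd_def)
        have "apply_transps ?w = transpose L a' \<circ> prd (Suc L)"
          unfolding eq[symmetric] by (simp add: comp_assoc[symmetric])
        also have "\<dots> = prd L"
          using \<open>L \<noteq> 0\<close> aL by (auto simp: fun_eq_iff prd_def transpose_def)
        finally have "bsum ?w = dlt L" using IHm[of ?w] Suc.prems(1) ordw w(2) by simp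
        moreover have "bs L a' = s (L - 1)"
          using aL \<open>L \<noteq> 0\<close> by (cases L) (simp_all add: bs_ordered)
        ultimately show ?thesis using ps(1) \<open>L \<noteq> 0\<close> by simp
      next
        case True
        then obtain w1 t2 w2 where w12: "?w = w1 @ t2 # w2" "fst t2 = L" "\<forall>t \<in> set w1. fst t \<noteq> L"
          by (rule split_list_first_propE)
        obtain e where t2: "t2 = (L, e)" using w12(2) by (cases t2) auto
        have pw: "apply_transps ([(L, a')] @ w1 @ (L, e) # w2) = prd (Suc L)"
          using ps(2) less.prems(3) w12(1) t2 by simp
        have lw: "length w1 + length w2 + 2 = L" using w(2) w12(1) by simp
        obtain e' where e': "e' < L" "bsum (w1 @ [(L, e)]) = bsum ((L, e') # w1)"
          "apply_transps (w1 @ [(L, e)]) = apply_transps ((L, e') # w1)"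
          using move_top_letter_front[of L "[(L, a')]" w1 e w2] Suc.prems(1) w w12 t2 a'(1) pw lw
          by auto
        have ww: "bsum ?w = bsum ((L, e') # w1 @ w2)"
          "apply_transps ?w = apply_transps ((L, e') # w1 @ w2)"
        proof -
          have "?w = (w1 @ [(L, e)]) @ w2" using w12 t2 by simp
          then have "bsum ?w = bsum (w1 @ [(L, e)]) + bsum w2"
            "apply_transps ?w = apply_transps (w1 @ [(L, e)]) \<circ> apply_transps w2"
            by (simp_all only: bsum_simps apply_transps_append)
          then show "bsum ?w = bsum ((L, e') # w1 @ w2)"
            "apply_transps ?w = apply_transps ((L, e') # w1 @ w2)"
            unfolding e'(2,3) by (simp_all add: add.assoc comp_assoc)
        qed
        have app: "apply_transps ((L, a') # (L, e') # w1 @ w2) = prd (Suc L)"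
          using ps(2) ww(2) less.prems(3) by simp
        have ord12: "ord_on (Suc L) (w1 @ w2)" using w(1) w12(1) t2 by simp
        \<comment> \<open>For two letters at \<open>L\<close>, being noncrossing amounts to
          \<open>a' < e'\<close>, the order in which the triangle relation applies.\<close>
        have "(a' < L \<and> L \<le> L) \<longleftrightarrow> (a' < e' \<and> e' \<le> L)"
          by (rule reduced_adjacent[where u = "[]" and v = "w1 @ w2" and m = "Suc L"])
            (use app ord12 lw a'(1) e'(1) in simp_all)
        then have ae: "a' < e'" using a'(1) by simp
        let ?ps = "(L, e') # (e', a') # w1 @ w2"
        have tt: "transpose L a' \<circ> transpose L e' = transpose L e' \<circ> transpose e' a'"
          using ae e'(1) by (auto simp: fun_eq_iff transpose_def)
        have "bnd L e' + bnd e' a' = bnd L a' + bnd L e'"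
          using bnd_triangle1[of a' e' L] ae e'(1) Suc.prems(1) by simp
        then have "bs L a' + bs L e' = bs L e' + bs e' a'"
          using ae e'(1) a'(1) by (simp add: bs_ordered)
        then have "bs L a' + bsum ((L, e') # w1 @ w2) = bsum ?ps"
          by (simp only: bsum_simps add.assoc[symmetric])
        then have "bsum ps = bsum ?ps" using ps(1) ww(1) by simp
        moreover have "apply_transps ?ps = prd (Suc L)"
          using app tt by (simp add: comp_assoc[symmetric])
        moreover have "?top ?ps < ?top ps"
          using top w12 t2 e'(1) by simp
        ultimately show ?thesis
          using less.hyps[of ?ps] ord12 lw ae e'(1) by simp
      qed
    qed
    then show ?thesis using Suc.prems by simp
  qed
qed

text \<open>Both words are completed by the same \<open>v\<close> to shortest factorisations of the
  cycle, which have equal value; then \<open>v\<close> cancels in the group.\<close>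

lemma bsum_reduced_unique:
  assumes "m \<le> n" "ord_on m us" "ord_on m us'" "length us = length us'"
    and "apply_transps us = apply_transps us'"
    and "ord_on m v" "length us + length v + 1 = m" "apply_transps (us @ v) = prd m"
  shows "bsum us = bsum us'"
proof -
  have "bsum (us @ v) = dlt m" "bsum (us' @ v) = dlt m"
    using assms by (intro bsum_reduced_prd; simp)+
  then have "bsum us + bsum v = bsum us' + bsum v" by simp
  then show ?thesis by (rule add_right_imp_eq)
qed

end

section \<open>Braid words as group elements\<close>

text \<open>Braids act faithfully on classes of words, so equality of braids becomes equality in a group
  of bijections. It is written additively because \<open>group_add\<close> is the type class of noncommutative
  groups.\<close>

typedef 'a bijn = "{f :: 'a \<Rightarrow> 'a. bij f}"
  morphisms apply_bijn Bijn
  by (rule exI[of _ id]) simp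

setup_lifting type_definition_bijn

instantiation bijn :: (type) group_add
begin

lift_definition zero_bijn :: "'a bijn" is id by simp
lift_definition plus_bijn :: "'a bijn \<Rightarrow> 'a bijn \<Rightarrow> 'a bijn" is "(\<circ>)" by (rule bij_comp)
lift_definition uminus_bijn :: "'a bijn \<Rightarrow> 'a bijn" is inv by (rule bij_imp_bij_inv)
lift_definition minus_bijn :: "'a bijn \<Rightarrow> 'a bijn \<Rightarrow> 'a bijn" is "\<lambda>f g. f \<circ> inv g"
  by (intro bij_comp bij_imp_bij_inv)

instance
  by standard (transfer; auto simp: comp_assoc bij_is_inj)+

end

lemma beq_cong: "beq n u v \<Longrightarrow> beq n (a @ u @ b) (a @ v @ b)"
proof (induction rule: beq.induct)
  case (beq_cancel i u c v)
  then show ?case using beq.beq_cancel[of i n "a @ u" c "v @ b"] by simp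
next
  case (beq_comm i j u v)
  then show ?case using beq.beq_comm[of i j n "a @ u" "v @ b"] by simp
next
  case (beq_braid i u v)
  then show ?case using beq.beq_braid[of i n "a @ u" "v @ b"] by simp
qed (auto intro: beq.intros)

definition cls :: "nat \<Rightarrow> bword \<Rightarrow> bword set" where
  "cls n w = {v. beq n w v}"

lemma cls_eq_iff: "cls n u = cls n v \<longleftrightarrow> beq n u v"
  unfolding cls_def by (auto intro: beq_refl beq_sym beq_trans)

text \<open>Left multiplication of classes by a letter. Off the classes it is the identity, because
  elements of \<open>bijn\<close> must be bijections of the whole type.\<close>

definition letter_act :: "nat \<Rightarrow> nat \<times> bool \<Rightarrow> bword set \<Rightarrow> bword set" where
  "letter_act n l X = (if X \<in> range (cls n) then cls n (l # (SOME x. x \<in> X)) else X)"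

lemma letter_act_cls: "letter_act n l (cls n w) = cls n (l # w)"
proof -
  have "w \<in> cls n w" by (simp add: cls_def beq_refl)
  then have "(SOME x. x \<in> cls n w) \<in> cls n w" by (rule someI)
  then have "beq n ([l] @ (SOME x. x \<in> cls n w) @ []) ([l] @ w @ [])"
    by (intro beq_cong) (simp add: cls_def beq_sym)
  then have "cls n (l # (SOME x. x \<in> cls n w)) = cls n (l # w)" by (simp add: cls_eq_iff)
  then show ?thesis by (simp add: letter_act_def)
qed

lemma letter_act_not_cls: "X \<notin> range (cls n) \<Longrightarrow> letter_act n l X = X"
  by (simp add: letter_act_def)

lemma letter_act_inverse:
  assumes "letter_ok n (i, b)"
  shows "letter_act n (i, b) (letter_act n (i, \<not> b) X) = X"
proof (cases "X \<in> range (cls n)")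
  case True
  then obtain w where w: "X = cls n w" by blast
  have "beq n ([] @ [(i, b), (i, \<not> b)] @ w) ([] @ w)"
    by (rule beq_cancel) (use assms in \<open>auto simp: letter_ok_def\<close>)
  then show ?thesis using w by (simp add: letter_act_cls cls_eq_iff)
qed (simp add: letter_act_not_cls)

lemma letter_act_bij:
  assumes "letter_ok n (i, b)"
  shows "bij (letter_act n (i, b))"
proof (rule o_bij)
  show "letter_act n (i, \<not> b) \<circ> letter_act n (i, b) = id"
    using letter_act_inverse[of n i "\<not> b"] assms by (auto simp: letter_ok_def)
  show "letter_act n (i, b) \<circ> letter_act n (i, \<not> b) = id"
    using letter_act_inverse[OF assms] by auto
qed

text \<open>Generators are numbered from \<open>0\<close>; numbers that are out of range give the neutral element.\<close>

definition gen :: "nat \<Rightarrow> nat \<Rightarrow> bword set bijn" where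
  "gen n k = (if k + 1 < n then Bijn (letter_act n (k + 1, True)) else 0)"

lemma apply_gen:
  "k + 1 < n \<Longrightarrow> apply_bijn (gen n k) = letter_act n (k + 1, True)"
  using letter_act_bij[of n "k + 1" True] by (simp add: gen_def Bijn_inverse letter_ok_def)

lemma apply_uminus_gen:
  assumes "k + 1 < n"
  shows "apply_bijn (- gen n k) = letter_act n (k + 1, False)"
proof -
  have "inv (letter_act n (k + 1, True)) = letter_act n (k + 1, False)"
    using letter_act_inverse[of n "k + 1" True] letter_act_inverse[of n "k + 1" False] assms
    by (intro inv_unique_comp) (auto simp: letter_ok_def)
  then show ?thesis using assms by (simp add: uminus_bijn.rep_eq apply_gen)
qed

definition lval :: "nat \<Rightarrow> nat \<times> bool \<Rightarrow> bword set bijn" where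
  "lval n l = (if snd l then gen n (fst l - 1) else - gen n (fst l - 1))"

definition val :: "nat \<Rightarrow> bword \<Rightarrow> bword set bijn" where
  "val n w = sum_list (map (lval n) w)"

lemma val_simps [simp]:
  "val n [] = 0" "val n (l # w) = lval n l + val n w" "val n (u @ v) = val n u + val n v"
  by (simp_all add: val_def)

lemma apply_val:
  "w \<in> bwords n \<Longrightarrow> apply_bijn (val n w) (cls n v) = cls n (w @ v)"
proof (induction w)
  case Nil
  then show ?case by (simp add: zero_bijn.rep_eq)
next
  case (Cons l w)
  obtain i b where l: "l = (i, b)" by force
  have ok: "1 \<le> i" "i < n" and w: "w \<in> bwords n"
    using Cons.prems l by (auto simp: bwords_def letter_ok_def)
  have "apply_bijn (lval n l) (cls n (w @ v)) = cls n (l # w @ v)"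
    using apply_gen[of "i - 1" n] apply_uminus_gen[of "i - 1" n] ok l
    by (simp add: lval_def letter_act_cls)
  then show ?case using Cons.IH[OF w] by (simp add: plus_bijn.rep_eq)
qed

lemma gen_eqI:
  assumes "\<And>w. apply_bijn x (cls n w) = apply_bijn y (cls n w)"
    and "\<And>X. X \<notin> range (cls n) \<Longrightarrow> apply_bijn x X = apply_bijn y X"
  shows "x = y"
proof -
  have "apply_bijn x X = apply_bijn y X" for X
    using assms by (cases "X \<in> range (cls n)") auto
  then show ?thesis by (simp add: apply_bijn_inject[symmetric] fun_eq_iff)
qed

lemma gen_artin_system: "artin_system n (gen n)"
proof
  fix k l assume kl: "k + 1 < l" "l + 1 < n"
  show "gen n k + gen n l = gen n l + gen n k"
  proof (rule gen_eqI[of _ n])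
    fix w
    have "beq n ([] @ [(k + 1, True), (l + 1, True)] @ w) ([] @ [(l + 1, True), (k + 1, True)] @ w)"
      by (rule beq_comm) (use kl in auto)
    then show "apply_bijn (gen n k + gen n l) (cls n w) = apply_bijn (gen n l + gen n k) (cls n w)"
      using kl by (simp add: plus_bijn.rep_eq apply_gen letter_act_cls cls_eq_iff)
  qed (use kl in \<open>simp add: plus_bijn.rep_eq apply_gen letter_act_not_cls\<close>)
next
  fix k assume k: "k + 2 < n"
  show "gen n k + gen n (k + 1) + gen n k = gen n (k + 1) + gen n k + gen n (k + 1)"
  proof (rule gen_eqI[of _ n])
    fix w
    have "beq n ([] @ [(k + 1, True), (k + 1 + 1, True), (k + 1, True)] @ w)
        ([] @ [(k + 1 + 1, True), (k + 1, True), (k + 1 + 1, True)] @ w)"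
      by (rule beq_braid) (use k in auto)
    then show "apply_bijn (gen n k + gen n (k + 1) + gen n k) (cls n w)
        = apply_bijn (gen n (k + 1) + gen n k + gen n (k + 1)) (cls n w)"
      using k apply_gen[of k n] apply_gen[of "k + 1" n]
      by (simp add: plus_bijn.rep_eq letter_act_cls cls_eq_iff)
  qed (use k apply_gen[of k n] apply_gen[of "k + 1" n] in
      \<open>simp add: plus_bijn.rep_eq letter_act_not_cls\<close>)
qed

lemma val_beq: "beq n u v \<Longrightarrow> val n u = val n v"
proof (induction rule: beq.induct)
  case (beq_cancel i u b v)
  have "lval n (i, b) + (lval n (i, \<not> b) + x) = x" for x
    by (simp add: lval_def add.assoc[symmetric])
  then show ?case by simp
next
  case (beq_comm i j u v)
  then have "gen n (i - 1) + gen n (j - 1) = gen n (j - 1) + gen n (i - 1)"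
    by (intro artin_system.far[OF gen_artin_system]) auto
  then show ?case by (simp add: lval_def add.assoc[symmetric])
next
  case (beq_braid i u v)
  then have "gen n (i - 1) + gen n (i - 1 + 1) + gen n (i - 1)
      = gen n (i - 1 + 1) + gen n (i - 1) + gen n (i - 1 + 1)"
    by (intro artin_system.braid[OF gen_artin_system]) auto
  then have "gen n (i - 1) + gen n i + gen n (i - 1) = gen n i + gen n (i - 1) + gen n i"
    using beq_braid by simp
  then show ?case by (simp add: lval_def add.assoc[symmetric])
qed auto

text \<open>Faithfulness: up to equivalence, a word can be read off from where it sends the class of
  the empty word.\<close>

lemma val_eq_iff:
  assumes "u \<in> bwords n" "v \<in> bwords n"
  shows "val n u = val n v \<longleftrightarrow> beq n u v"
proof
  assume "val n u = val n v"
  then have "cls n (u @ []) = cls n (v @ [])"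
    using apply_val[OF assms(1), of "[]"] apply_val[OF assms(2), of "[]"] by simp
  then show "beq n u v" by (simp add: cls_eq_iff)
qed (rule val_beq)

lemma belt_eq_iff:
  assumes "u \<in> bwords n" "v \<in> bwords n"
  shows "belt n u = belt n v \<longleftrightarrow> val n u = val n v"
proof -
  have "belt n u = belt n v \<longleftrightarrow> beq n u v"
  proof
    assume "belt n u = belt n v"
    moreover have "v \<in> belt n v" using assms by (simp add: belt_def beq_refl)
    ultimately show "beq n u v" by (auto simp: belt_def)
  next
    assume "beq n u v"
    then show "belt n u = belt n v"
      unfolding belt_def by (auto intro: beq_trans beq_sym)
  qed
  then show ?thesis using val_eq_iff[OF assms] by simp
qed

lemma bwords_simps [simp]:
  "[] \<in> bwords n" "(i, b) # w \<in> bwords n \<longleftrightarrow> 1 \<le> i \<and> i < n \<and> w \<in> bwords n"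
  "u @ v \<in> bwords n \<longleftrightarrow> u \<in> bwords n \<and> v \<in> bwords n"
  by (auto simp: bwords_def letter_ok_def)

lemma winv_simps [simp]:
  "winv [] = []" "winv ((i, b) # w) = winv w @ [(i, \<not> b)]" "winv (u @ v) = winv v @ winv u"
  by (simp_all add: winv_def)

lemma winv_bwords [simp]: "winv w \<in> bwords n \<longleftrightarrow> w \<in> bwords n"
  by (induction w) auto

lemma val_winv [simp]: "val n (winv w) = - val n w"
  by (induction w) (auto simp: minus_add lval_def)

lemma concat_replicate_bwords: "w \<in> bwords n \<Longrightarrow> concat (replicate k w) \<in> bwords n"
  by (induction k) auto

section \<open>Permutation and exponent sum of a braid\<close>

definition wperm :: "bword \<Rightarrow> nat \<Rightarrow> nat" where
  "wperm w = apply_transps (map (\<lambda>(i, b). (i - 1, i)) w)"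

definition wexp :: "bword \<Rightarrow> int" where
  "wexp w = sum_list (map (\<lambda>(i, b). if b then 1 else - 1) w)"

lemma wperm_simps [simp]:
  "wperm [] = id" "wperm ((i, b) # w) = transpose (i - 1) i \<circ> wperm w"
  "wperm (u @ v) = wperm u \<circ> wperm v"
  by (simp_all add: wperm_def)

lemma wexp_simps [simp]:
  "wexp [] = 0" "wexp ((i, b) # w) = (if b then 1 else - 1) + wexp w"
  "wexp (u @ v) = wexp u + wexp v"
  by (simp_all add: wexp_def)

lemma wperm_beq: "beq n u v \<Longrightarrow> wperm u = wperm v"
proof (induction rule: beq.induct)
  case (beq_cancel i u b v)
  then show ?case by (simp add: fun_eq_iff)
next
  case (beq_comm i j u v)
  then have "transpose (i - 1) i \<circ> transpose (j - 1) j = transpose (j - 1) j \<circ> transpose (i - 1) i"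
    by (auto simp: fun_eq_iff transpose_def)
  then show ?case by (simp add: comp_assoc[symmetric])
next
  case (beq_braid i u v)
  then have "transpose (i - 1) i \<circ> (transpose i (i + 1) \<circ> transpose (i - 1) i)
      = transpose i (i + 1) \<circ> (transpose (i - 1) i \<circ> transpose i (i + 1))"
    by (auto simp: fun_eq_iff transpose_def)
  then show ?case by (simp add: fun_eq_iff)
qed auto

lemma wexp_beq: "beq n u v \<Longrightarrow> wexp u = wexp v"
  by (induction rule: beq.induct) auto

lemma wperm_val: "u \<in> bwords n \<Longrightarrow> v \<in> bwords n \<Longrightarrow> val n u = val n v \<Longrightarrow> wperm u = wperm v"
  using val_eq_iff wperm_beq by blast

lemma wexp_val: "u \<in> bwords n \<Longrightarrow> v \<in> bwords n \<Longrightarrow> val n u = val n v \<Longrightarrow> wexp u = wexp v"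
  using val_eq_iff wexp_beq by blast

lemma wperm_permutes: "w \<in> bwords n \<Longrightarrow> wperm w permutes {..<n}"
proof (induction w)
  case (Cons l w)
  obtain i b where l: "l = (i, b)" by force
  then have "transpose (i - 1) i permutes {..<n}"
    using Cons.prems by (intro permutes_swap_id) auto
  then show ?case using Cons l by (auto intro: permutes_compose simp del: comp_apply)
qed (simp add: permutes_id)

lemma wperm_winv:
  assumes "w \<in> bwords n"
  shows "wperm (winv w) = inv (wperm w)"
proof -
  have "wperm (winv w) \<circ> wperm w = id" for w
  proof (induction w)
    case (Cons l w)
    obtain i b where l: "l = (i, b)" by force
    show ?case using Cons l by (simp add: fun_eq_iff)
  qed simp
  moreover have "wperm w \<circ> wperm (winv w) = id" for w
  proof (induction w)
    case (Cons l w)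
    obtain i b where l: "l = (i, b)" by force
    show ?case using Cons l by (simp add: fun_eq_iff)
  qed simp
  ultimately show ?thesis by (metis inv_unique_comp)
qed

lemma wexp_winv [simp]: "wexp (winv w) = - wexp w"
  by (induction w) auto

lemma band_Suc: "q < p \<Longrightarrow> band (Suc (Suc p)) (Suc q)
    = (Suc p, True) # band (Suc p) (Suc q) @ [(Suc p, False)]"
  by (simp add: band_def)

lemma band_base: "band (Suc (Suc q)) (Suc q) = [(Suc q, True)]"
  by (simp add: band_def)

context
  fixes n :: nat
begin

interpretation artin_system n "gen n" by (rule gen_artin_system)

lemma band_props:
  assumes "q < p" "p < n"
  shows "band (Suc p) (Suc q) \<in> bwords n" and "val n (band (Suc p) (Suc q)) = bnd p q"
    and "wperm (band (Suc p) (Suc q)) = transpose p q" and "wexp (band (Suc p) (Suc q)) = 1"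
proof -
  have "band (Suc p) (Suc q) \<in> bwords n \<and> val n (band (Suc p) (Suc q)) = bnd p q
    \<and> wperm (band (Suc p) (Suc q)) = transpose p q \<and> wexp (band (Suc p) (Suc q)) = 1"
    using assms
  proof (induction p)
    case (Suc p)
    show ?case
    proof (cases "p = q")
      case True
      then show ?thesis using Suc.prems
        by (simp add: band_base lval_def transpose_commute)
    next
      case False
      then have "transpose p (Suc p) \<circ> (transpose p q \<circ> transpose p (Suc p)) = transpose (Suc p) q"
        using Suc.prems by (auto simp: fun_eq_iff transpose_def)
      then show ?thesis using Suc False
        by (simp add: band_Suc lval_def cj_def add.assoc diff_conv_add_uminus
            del: add_uminus_conv_diff comp_apply)
    qed
  qed simp
  then show "band (Suc p) (Suc q) \<in> bwords n" "val n (band (Suc p) (Suc q)) = bnd p q"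
    "wperm (band (Suc p) (Suc q)) = transpose p q" "wexp (band (Suc p) (Suc q)) = 1" by auto
qed

lemma ddelta_Suc: "m > 0 \<Longrightarrow> ddelta (Suc m) = (m, True) # ddelta m"
  by (simp add: ddelta_def)

lemma ddelta_props:
  "m \<le> n \<Longrightarrow> ddelta m \<in> bwords n \<and> val n (ddelta m) = dlt m \<and> wperm (ddelta m) = prd m
    \<and> wexp (ddelta m) = int (m - 1)"
proof (induction m)
  case 0
  have "prd 0 = id" by (auto simp: prd_def)
  then show ?case by (simp add: ddelta_def)
next
  case (Suc m)
  show ?case
  proof (cases "m = 0")
    case True
    have "prd (Suc 0) = id" by (auto simp: prd_def)
    then show ?thesis using True by (simp add: ddelta_def)
  next
    case False
    have "transpose (m - 1) m \<circ> prd m = prd (Suc m)"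
      using False by (auto simp: fun_eq_iff prd_def transpose_def)
    then show ?thesis using Suc False by (auto simp: ddelta_Suc lval_def)
  qed
qed

definition bwd :: "(nat \<times> nat) list \<Rightarrow> bword" where
  "bwd ps = concat (map (\<lambda>(p, q). band (Suc p) (Suc q)) ps)"

lemma bwd_props:
  "ord_on n ps \<Longrightarrow> bwd ps \<in> bwords n \<and> val n (bwd ps) = bsum ps
    \<and> wperm (bwd ps) = apply_transps ps \<and> wexp (bwd ps) = int (length ps)"
proof (induction ps)
  case (Cons t ps)
  obtain p q where t: "t = (p, q)" by force
  then show ?case using Cons band_props[of q p] by (simp add: bwd_def bs_ordered)
qed (simp add: bwd_def)

definition wd :: "(nat \<times> nat) list \<Rightarrow> bword" where
  "wd ts = bwd (ordered ts)"

lemma wd_props: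
  assumes "transps_on {..<n} ts"
  shows "wd ts \<in> bwords n" "val n (wd ts) = bsum ts" "wperm (wd ts) = apply_transps ts"
    "wexp (wd ts) = int (length ts)"
  using bwd_props[OF ord_on_ordered[OF assms]] by (simp_all add: wd_def)

lemma dual_pos_iff:
  assumes "w \<in> bwords n"
  shows "dual_pos n w \<longleftrightarrow> (\<exists>ps. ord_on n ps \<and> val n w = bsum ps)"
proof
  assume "dual_pos n w"
  then obtain ps where ps: "\<forall>(i, j) \<in> set ps. 1 \<le> j \<and> j < i \<and> i \<le> n"
    "beq n w (concat (map (\<lambda>(i, j). band i j) ps))" by (auto simp: dual_pos_def)
  let ?qs = "map (\<lambda>(i, j). (i - 1, j - 1)) ps"
  have ord: "ord_on n ?qs" using ps(1) by (auto simp: ord_on_def)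
  have "bwd ?qs = concat (map (\<lambda>(i, j). band i j) ps)"
    unfolding bwd_def map_map by (rule arg_cong[of _ _ concat], rule map_cong) (use ps(1) in auto)
  then have "val n w = bsum ?qs" using val_beq[OF ps(2)] bwd_props[OF ord] by simp
  then show "\<exists>ps. ord_on n ps \<and> val n w = bsum ps" using ord by blast
next
  assume "\<exists>ps. ord_on n ps \<and> val n w = bsum ps"
  then obtain ps where ps: "ord_on n ps" "val n w = bsum ps" by blast
  let ?qs = "map (\<lambda>(p, q). (Suc p, Suc q)) ps"
  have "beq n w (bwd ps)" using bwd_props[OF ps(1)] ps(2) val_eq_iff[OF assms, of "bwd ps"] by simp
  moreover have "bwd ps = concat (map (\<lambda>(i, j). band i j) ?qs)"
    by (simp add: bwd_def comp_def case_prod_unfold)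
  moreover have "\<forall>(i, j) \<in> set ?qs. 1 \<le> j \<and> j < i \<and> i \<le> n"
    using ps(1) by (auto simp: ord_on_def)
  ultimately have "(\<forall>(i, j) \<in> set ?qs. 1 \<le> j \<and> j < i \<and> i \<le> n)
      \<and> beq n w (concat (map (\<lambda>(i, j). band i j) ?qs))" by argo
  then show "dual_pos n w" unfolding dual_pos_def by (rule exI[where x = ?qs])
qed

lemma dprec_iff:
  assumes "u \<in> bwords n" "v \<in> bwords n"
  shows "dprec n u v \<longleftrightarrow> (\<exists>ps. ord_on n ps \<and> val n v = val n u + bsum ps)"
proof -
  have "- val n u + val n v = x \<longleftrightarrow> val n v = val n u + x" for x
    by (metis add.assoc add.left_neutral left_minus right_minus)
  then show ?thesis using dual_pos_iff[of "winv u @ v"] assms by (simp add: dprec_def)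
qed

end

section \<open>Infimum and supremum\<close>

definition zmul :: "'a :: group_add \<Rightarrow> int \<Rightarrow> 'a" where
  "zmul x k = (if 0 \<le> k then sum_list (replicate (nat k) x) else sum_list (replicate (nat (- k)) (- x)))"

lemma zmul_0 [simp]: "zmul x 0 = 0"
  by (simp add: zmul_def)

lemma zmul_plus1: "zmul x (k + 1) = x + zmul x k"
proof (cases "0 \<le> k")
  case True
  then have "nat (k + 1) = Suc (nat k)" by simp
  then show ?thesis using True by (simp add: zmul_def)
next
  case False
  then have "nat (- k) = Suc (nat (- (k + 1)))" by simp
  then have "zmul x k = - x + sum_list (replicate (nat (- (k + 1))) (- x))"
    using False by (simp add: zmul_def)
  moreover have "zmul x (k + 1) = sum_list (replicate (nat (- (k + 1))) (- x))"
    using False by (simp add: zmul_def)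
  ultimately show ?thesis by (simp add: add.assoc[symmetric])
qed

lemma zmul_minus1: "zmul x (k - 1) = - x + zmul x k"
  using zmul_plus1[of x "k - 1"] by (simp add: add.assoc[symmetric])

lemma zmul_add: "zmul x (k + l) = zmul x k + zmul x l"
proof (induction k rule: int_induct[where k = 0])
  case base
  then show ?case by simp
next
  case (step1 i)
  then show ?case using zmul_plus1[of x "i + l"] zmul_plus1[of x i] by (simp add: algebra_simps add.assoc)
next
  case (step2 i)
  then show ?case using zmul_minus1[of x "i + l"] zmul_minus1[of x i] by (simp add: algebra_simps add.assoc)
qed

lemma zmul_uminus: "zmul x (- k) = - zmul x k"
  using zmul_add[of x "- k" k] by (simp add: eq_neg_iff_add_eq_0)

text \<open>The integers are not well-ordered; measuring the distance to the bound \<open>B\<close>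
  turns the greatest element into a least natural number.\<close>

lemma Greatest_int:
  fixes P :: "int \<Rightarrow> bool"
  assumes "P k0" "\<And>k. P k \<Longrightarrow> k \<le> B"
  shows "P (GREATEST k. P k)" and "\<And>k. P k \<Longrightarrow> k \<le> (GREATEST k. P k)"
proof -
  let ?Q = "\<lambda>m. P (B - int m)"
  let ?m = "LEAST m. ?Q m"
  have Q: "?Q (nat (B - k))" if "P k" for k using that assms(2)[OF that] by simp
  have 1: "?Q ?m" by (rule LeastI[of ?Q, OF Q[OF assms(1)]])
  have 2: "k \<le> B - int ?m" if "P k" for k
    using Least_le[of ?Q, OF Q[OF that]] assms(2)[OF that] by linarith
  have "(GREATEST k. P k) = B - int ?m" by (rule Greatest_equality) (use 1 2 in auto)
  then show "P (GREATEST k. P k)" "\<And>k. P k \<Longrightarrow> k \<le> (GREATEST k. P k)" using 1 2 by auto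
qed

lemma Least_int:
  fixes P :: "int \<Rightarrow> bool"
  assumes "P k0" "\<And>k. P k \<Longrightarrow> B \<le> k"
  shows "P (LEAST k. P k)" and "\<And>k. P k \<Longrightarrow> (LEAST k. P k) \<le> k"
proof -
  let ?Q = "\<lambda>m. P (B + int m)"
  let ?m = "LEAST m. ?Q m"
  have Q: "?Q (nat (k - B))" if "P k" for k using that assms(2)[OF that] by simp
  have 1: "?Q ?m" by (rule LeastI[of ?Q, OF Q[OF assms(1)]])
  have 2: "B + int ?m \<le> k" if "P k" for k
    using Least_le[of ?Q, OF Q[OF that]] assms(2)[OF that] by linarith
  have "(LEAST k. P k) = B + int ?m" by (rule Least_equality) (use 1 2 in auto)
  then show "P (LEAST k. P k)" "\<And>k. P k \<Longrightarrow> (LEAST k. P k) \<le> k" using 1 2 by auto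
qed

lemma val_concat_replicate: "val n (concat (replicate k w)) = sum_list (replicate k (val n w))"
  by (induction k) auto

lemma val_wpow: "val n (wpow w k) = zmul (val n w) k"
  by (simp add: wpow_def zmul_def val_concat_replicate)

lemma wpow_bwords: "w \<in> bwords n \<Longrightarrow> wpow w k \<in> bwords n"
  by (simp add: wpow_def concat_replicate_bwords)

lemma wexp_wpow: "wexp (wpow w k) = k * wexp w"
proof -
  have "wexp (concat (replicate m w)) = int m * wexp w" for m w
    by (induction m) (auto simp: algebra_simps)
  then show ?thesis by (simp add: wpow_def)
qed

lemma wperm_concat_replicate: "wperm (concat (replicate k w)) = wperm w ^^ k"
  by (induction k) auto

context artin_system
begin

lemma bsum_transps_unique:
  assumes "transps_on {..<n} us" "transps_on {..<n} us'" "length us = length us'"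
    and "apply_transps us = apply_transps us'"
    and "transps_on {..<n} v" "length us + length v + 1 = n" "apply_transps (us @ v) = prd n"
  shows "bsum us = bsum us'"
  using bsum_reduced_unique[of n "ordered us" "ordered us'" "ordered v"] assms
  by (simp add: ord_on_ordered)

lemma bsum_transps_prd:
  assumes "transps_on {..<n} ps" "length ps + 1 = n" "apply_transps ps = prd n"
  shows "bsum ps = dl"
  using bsum_reduced_prd[of n "ordered ps"] assms by (simp add: ord_on_ordered)

text \<open>The number of letters is recorded for comparison with exponent sums, to which every
  letter contributes one.\<close>

definition pos :: "nat \<Rightarrow> 'a \<Rightarrow> bool" where
  "pos k x \<longleftrightarrow> (\<exists>ps. transps_on {..<n} ps \<and> length ps = k \<and> x = bsum ps)"

lemma pos_ordered: "pos k x \<longleftrightarrow> (\<exists>ps. ord_on n ps \<and> length ps = k \<and> x = bsum ps)"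
  using bsum_ordered length_ordered ord_on_ordered ord_on_transps_on unfolding pos_def by metis

lemma pos_0: "pos 0 0"
  unfolding pos_def by (intro exI[of _ "[]"]) simp

lemma pos_add: "pos k x \<Longrightarrow> pos l y \<Longrightarrow> pos (k + l) (x + y)"
  unfolding pos_def by (metis bsum_simps(3) length_append transps_on_simps(3))

lemma transps_on_map:
  assumes "p permutes S" "transps_on S ts"
  shows "transps_on S (map (map_prod p p) ts)"
proof -
  have "p x \<in> S \<longleftrightarrow> x \<in> S" "p x = p y \<longleftrightarrow> x = y" for x y
    using permutes_in_image[OF assms(1)] permutes_inj[OF assms(1)] by (auto simp: inj_eq)
  then show ?thesis using assms(2) by (induction ts) auto
qed

lemma pos_dl: "pos k x \<Longrightarrow> \<exists>y. pos k y \<and> dl + x = y + dl"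
  unfolding pos_def using dl_bsum transps_on_map[OF prd_permutes] by (metis length_map)

lemma pos_dl': "pos k x \<Longrightarrow> \<exists>y. pos k y \<and> x + dl = dl + y"
proof -
  assume "pos k x"
  then obtain ps where ps: "transps_on {..<n} ps" "length ps = k" "x = bsum ps"
    by (auto simp: pos_def)
  let ?i = "inv (prd n)"
  let ?qs = "map (map_prod ?i ?i) ps"
  have qs: "transps_on {..<n} ?qs"
    by (rule transps_on_map[OF permutes_inv[OF prd_permutes] ps(1)])
  have "map (map_prod (prd n) (prd n)) ?qs = ps"
    using permutes_inverses(1)[OF prd_permutes] by (simp add: comp_def map_prod_def case_prod_unfold)
  then have "dl + bsum ?qs = x + dl" using dl_bsum[OF qs] ps(3) by simp
  moreover have "pos k (bsum ?qs)" using qs ps(2) by (auto simp: pos_def)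
  ultimately show ?thesis by metis
qed

lemma pos_zmul: "pos k x \<Longrightarrow> \<exists>y. pos k y \<and> zmul dl j + x = y + zmul dl j"
proof (induction j arbitrary: x rule: int_induct[where k = 0])
  case base
  then show ?case by auto
next
  case (step1 i)
  then obtain y where y: "pos k y" "zmul dl i + x = y + zmul dl i" by blast
  obtain z where z: "pos k z" "dl + y = z + dl" using pos_dl[OF y(1)] by blast
  have "zmul dl (i + 1) + x = (dl + y) + zmul dl i"
    by (simp add: zmul_plus1 add.assoc y(2))
  also have "\<dots> = z + zmul dl (i + 1)" by (simp add: z(2) zmul_plus1 add.assoc)
  finally show ?case using z(1) by blast
next
  case (step2 i)
  then obtain y where y: "pos k y" "zmul dl i + x = y + zmul dl i" by blast
  obtain z where z: "pos k z" "y + dl = dl + z" using pos_dl'[OF y(1)] by blast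
  have "- dl + y = - dl + (y + dl) + - dl" by (simp only: add.assoc right_minus add_0_right)
  also have "\<dots> = z + - dl" unfolding z(2) by (simp only: minus_add_cancel)
  finally have dy: "- dl + y = z + - dl" .
  have "zmul dl (i - 1) + x = (- dl + y) + zmul dl i"
    by (simp only: zmul_minus1 add.assoc y(2))
  also have "\<dots> = z + zmul dl (i - 1)" unfolding dy by (simp only: zmul_minus1 add.assoc)
  finally show ?case using z(1) by blast
qed

lemma pos_zmul': "pos k x \<Longrightarrow> \<exists>y. pos k y \<and> x + zmul dl j = zmul dl j + y"
proof -
  assume "pos k x"
  then obtain y where y: "pos k y" "zmul dl (- j) + x = y + zmul dl (- j)" using pos_zmul by blast
  then have "- zmul dl j + x = y - zmul dl j" by (simp add: zmul_uminus)
  then have "x = zmul dl j + (y - zmul dl j)" by (metis add_minus_cancel)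
  then have "x + zmul dl j = zmul dl j + y"
    by (metis add.assoc diff_add_cancel)
  then show ?thesis using y(1) by blast
qed

lemma complement_exists:
  assumes "transps_on {..<n} us" "ncyc {..<n} (inv (apply_transps us) \<circ> prd n) = length us + 1"
    "length us < n"
  shows "\<exists>v. transps_on {..<n} v \<and> length us + length v + 1 = n \<and> apply_transps (us @ v) = prd n"
proof -
  have p: "apply_transps us permutes {..<n}" by (rule transps_on_permutes[OF assms(1)])
  have "inv (apply_transps us) \<circ> prd n permutes {..<n}"
    by (intro permutes_compose permutes_inv prd_permutes p)
  then obtain v where v: "transps_on {..<n} v" "apply_transps v = inv (apply_transps us) \<circ> prd n"
    "length v + ncyc {..<n} (inv (apply_transps us) \<circ> prd n) = card {..<n}"
    using transps_exist[of "{..<n}"] by blast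
  moreover have "apply_transps us \<circ> (inv (apply_transps us) \<circ> prd n) = prd n"
    using permutes_inv_o(1)[OF p] by (simp add: comp_assoc[symmetric])
  ultimately show ?thesis using assms(2) by (intro exI[of _ v]) simp
qed

text \<open>A shortest factorisation of the cycle may start with any transposition of two of its
  points, here \<open>(k + 1, k)\<close>. So each Artin generator divides the Garside element, and
  one Garside element absorbs its inverse.\<close>

lemma pos_minus_s_dl:
  assumes "k + 1 < n"
  shows "\<exists>x. pos (n - 2) x \<and> dl = s k + x"
proof -
  let ?t = "transpose (k + 1) k"
  have "prd n (k + 1) = k" using assms by (simp add: prd_def)
  then have "k \<in> orbit (prd n) (k + 1)" using orbit.base[of "prd n" "k + 1"] by simp
  then have "ncyc {..<n} (?t \<circ> prd n) = Suc (ncyc {..<n} (prd n))"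
    using assms by (intro ncyc_split_left prd_permutes) auto
  then have "ncyc {..<n} (?t \<circ> prd n) = 2" using ncyc_prd[of n] assms by simp
  then obtain v where v: "transps_on {..<n} v" "length v + 2 = n"
    "apply_transps ((k + 1, k) # v) = prd n"
    using complement_exists[of "[(k + 1, k)]"] assms by auto
  then have "dl = bsum ((k + 1, k) # v)"
    using bsum_transps_prd[of "(k + 1, k) # v"] assms by simp
  then have "dl = s k + bsum v" by (simp add: bs_ordered)
  moreover have "pos (n - 2) (bsum v)" using v by (auto simp: pos_def)
  ultimately show ?thesis by blast
qed

end

context
  fixes n :: nat
  assumes n: "n \<ge> 2"
begin

interpretation artin_system n "gen n" by (rule gen_artin_system)

lemma val_ddelta: "val n (ddelta n) = dl"
  using ddelta_props[of n n] by simp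

lemma ddelta_bwords: "ddelta n \<in> bwords n"
  using ddelta_props[of n n] by simp

text \<open>Every negative letter is absorbed by one more factor \<open>dl\<close>. This makes the
  sets whose maximum and minimum define \<open>dinf\<close> and \<open>dsup\<close>
  nonempty.\<close>

lemma word_absorb_delta: "w \<in> bwords n \<Longrightarrow> \<exists>k l x. pos l x \<and> val n w + zmul dl k = x"
proof (induction w)
  case Nil
  then show ?case using pos_0 by (intro exI[of _ 0] exI[of _ "0 :: nat"] exI[of _ 0]) simp
next
  case (Cons lt w)
  obtain i b where l: "lt = (i, b)" by force
  have i: "1 \<le> i" "i < n" and w: "w \<in> bwords n" using Cons.prems l by auto
  obtain k m x where x: "pos m x" "val n w + zmul dl k = x" using Cons.IH[OF w] by blast
  have s: "pos 1 (gen n (i - 1))"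
    unfolding pos_def using i
    by (intro exI[of _ "[(i, i - 1)]"]) (cases i; simp add: bs_ordered)
  show ?case
  proof (cases b)
    case True
    then have "val n (lt # w) + zmul dl k = gen n (i - 1) + x"
      using x(2) l by (simp add: lval_def add.assoc)
    then show ?thesis using pos_add[OF s x(1)] by metis
  next
    case False
    obtain y where y: "pos (n - 2) y" "dl = gen n (i - 1) + y"
      using pos_minus_s_dl[of "i - 1"] i by auto
    obtain z where z: "pos m z" "x + zmul dl 1 = zmul dl 1 + z" using pos_zmul'[OF x(1)] by blast
    have one: "zmul dl 1 = dl" by (simp add: zmul_def)
    have "val n (lt # w) + zmul dl (k + 1) = - gen n (i - 1) + (x + zmul dl 1)"
      unfolding zmul_add x(2)[symmetric] using l False by (simp add: lval_def add.assoc)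
    also have "\<dots> = - gen n (i - 1) + dl + z" using z one by (simp add: add.assoc)
    also have "- gen n (i - 1) + dl = y" using y(2) by (metis minus_add_cancel)
    finally show ?thesis using pos_add[OF y(1) z(1)] by metis
  qed
qed

lemma dprec_pos:
  assumes "u \<in> bwords n" "v \<in> bwords n"
  shows "dprec n u v \<longleftrightarrow> (\<exists>k x. pos k x \<and> val n v = val n u + x)"
  unfolding dprec_iff[OF assms] pos_ordered by blast

lemma pos_word:
  assumes "pos k x"
  obtains w where "w \<in> bwords n" "val n w = x" "wexp w = int k"
  using assms bwd_props unfolding pos_ordered by metis

lemma wexp_ddelta: "wexp (ddelta n) = int n - 1"
  using ddelta_props[of n n] n by (simp add: of_nat_diff)

lemma dprec_delta_left:
  assumes "w \<in> bwords n"
  shows "dprec n (wpow (ddelta n) k) w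
    \<longleftrightarrow> (\<exists>l x. pos l x \<and> val n w = zmul dl k + x \<and> wexp w = k * (int n - 1) + int l)"
proof -
  have "wexp w = k * (int n - 1) + int l" if x: "pos l x" "val n w = zmul dl k + x" for l x
  proof -
    obtain v where v: "v \<in> bwords n" "val n v = x" "wexp v = int l" using pos_word[OF x(1)] .
    have "wexp w = wexp (wpow (ddelta n) k @ v)"
      by (rule wexp_val[OF assms])
        (use x v in \<open>simp_all add: wpow_bwords ddelta_bwords val_wpow val_ddelta\<close>)
    then show ?thesis using v by (simp add: wexp_wpow wexp_ddelta)
  qed
  then show ?thesis
    unfolding dprec_pos[OF wpow_bwords[OF ddelta_bwords] assms] val_wpow val_ddelta by blast
qed

lemma dprec_delta_right:
  assumes "w \<in> bwords n"
  shows "dprec n w (wpow (ddelta n) k)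
    \<longleftrightarrow> (\<exists>l x. pos l x \<and> zmul dl k = val n w + x \<and> wexp w + int l = k * (int n - 1))"
proof -
  have "wexp w + int l = k * (int n - 1)" if x: "pos l x" "zmul dl k = val n w + x" for l x
  proof -
    obtain v where v: "v \<in> bwords n" "val n v = x" "wexp v = int l" using pos_word[OF x(1)] .
    have "wexp (w @ v) = wexp (wpow (ddelta n) k)"
      by (rule wexp_val[where n = n])
        (use x v assms in \<open>simp_all add: wpow_bwords ddelta_bwords val_wpow val_ddelta\<close>)
    then show ?thesis using v by (simp add: wexp_wpow wexp_ddelta)
  qed
  then show ?thesis
    unfolding dprec_pos[OF assms wpow_bwords[OF ddelta_bwords]] val_wpow val_ddelta by blast
qed

lemma dinf_props:
  assumes "w \<in> bwords n"
  shows "dprec n (wpow (ddelta n) (dinf n w)) w"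
    and "\<And>k. dprec n (wpow (ddelta n) k) w \<Longrightarrow> k \<le> dinf n w"
proof -
  obtain k l x where x: "pos l x" "val n w + zmul dl k = x"
    using word_absorb_delta[OF assms] by blast
  obtain y where y: "pos l y" "x + zmul dl (- k) = zmul dl (- k) + y" using pos_zmul'[OF x(1)] by blast
  have "val n w = x + zmul dl (- k)" using x(2) by (simp add: zmul_uminus add.assoc[symmetric])
      (metis add.assoc add.right_neutral diff_conv_add_uminus right_minus)
  then have ex: "dprec n (wpow (ddelta n) (- k)) w"
    using y dprec_pos[OF wpow_bwords[OF ddelta_bwords] assms] by (auto simp: val_wpow val_ddelta)
  \<comment> \<open>Each Garside element has exponent sum \<open>n - 1\<close>, which is at least
    one, so exponent sums bound the power.\<close>
  have bound: "k \<le> \<bar>wexp w\<bar>" if k: "dprec n (wpow (ddelta n) k) w" for k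
  proof -
    obtain l where l: "wexp w = k * (int n - 1) + int l" using k unfolding dprec_delta_left[OF assms] by blast
    show ?thesis
    proof (cases "k \<le> 0")
      case False
      then have "k * 1 \<le> k * (int n - 1)" using n by (intro mult_left_mono) auto
      then show ?thesis using l by linarith
    qed simp
  qed
  show "dprec n (wpow (ddelta n) (dinf n w)) w"
    "\<And>k. dprec n (wpow (ddelta n) k) w \<Longrightarrow> k \<le> dinf n w"
    unfolding dinf_def using Greatest_int[of "\<lambda>k. dprec n (wpow (ddelta n) k) w", OF ex bound] by auto
qed

lemma dsup_props:
  assumes "w \<in> bwords n"
  shows "dprec n w (wpow (ddelta n) (dsup n w))"
    and "\<And>k. dprec n w (wpow (ddelta n) k) \<Longrightarrow> dsup n w \<le> k"
proof -
  obtain k l x where x: "pos l x" "val n (winv w) + zmul dl k = x"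
    using word_absorb_delta[of "winv w"] assms by auto
  have "zmul dl k = val n w + x" using x(2) by (simp add: add.assoc[symmetric])
      (metis add.assoc add_minus_cancel)
  then have ex: "dprec n w (wpow (ddelta n) k)"
    using x(1) dprec_pos[OF assms wpow_bwords[OF ddelta_bwords]] by (auto simp: val_wpow val_ddelta)
  have bound: "- \<bar>wexp w\<bar> \<le> k" if k: "dprec n w (wpow (ddelta n) k)" for k
  proof -
    obtain l where l: "wexp w + int l = k * (int n - 1)" using k unfolding dprec_delta_right[OF assms] by blast
    show ?thesis
    proof (cases "0 \<le> k")
      case False
      then have "k * (int n - 1) \<le> k * 1" using n by (intro mult_left_mono_neg) auto
      then show ?thesis using l by linarith
    qed simp
  qed
  show "dprec n w (wpow (ddelta n) (dsup n w))"
    "\<And>k. dprec n w (wpow (ddelta n) k) \<Longrightarrow> dsup n w \<le> k"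
    unfolding dsup_def using Least_int[of "\<lambda>k. dprec n w (wpow (ddelta n) k)", OF ex bound] by auto
qed

end

section \<open>The super summit set\<close>

lemma prd_funpow_eq: "x < N \<Longrightarrow> (prd N ^^ k) x = (x + k * (N - 1)) mod N"
proof (induction k)
  case (Suc k)
  have prd: "prd N y = (y + (N - 1)) mod N" if "y < N" for y
    using that by (auto simp: prd_def mod_if)
  have "(prd N ^^ Suc k) x = ((x + k * (N - 1)) mod N + (N - 1)) mod N"
    using Suc prd[of "(x + k * (N - 1)) mod N"] by simp
  also have "\<dots> = (x + Suc k * (N - 1)) mod N" 
    unfolding mod_add_left_eq by (simp add: add.assoc add.commute add.left_commute)
  finally show ?case .
qed simp

lemma prd_funpow_out: "\<not> x < N \<Longrightarrow> (prd N ^^ k) x = x"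
  by (induction k) (auto simp: prd_def)

lemma prd_funpow_self: "prd N ^^ N = id"
proof
  fix x
  show "(prd N ^^ N) x = id x"
  proof (cases "x < N")
    case True
    then show ?thesis using prd_funpow_eq[OF True, of N] by simp
  next
    case False
    then show ?thesis using prd_funpow_out by simp
  qed
qed

lemma comp_transpose_conj:
  assumes "inj p"
  shows "p \<circ> transpose a b = transpose (p a) (p b) \<circ> p"
  using assms by (auto simp: fun_eq_iff transpose_def inj_eq)

lemma comp_apply_transps:
  assumes "inj p"
  shows "p \<circ> apply_transps ts = apply_transps (map (map_prod p p) ts) \<circ> p"
proof (induction ts)
  case (Cons t ts)
  obtain a b where t: "t = (a, b)" by force
  have "p \<circ> apply_transps (t # ts) = (p \<circ> transpose a b) \<circ> apply_transps ts"
    by (simp add: t comp_assoc)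
  also have "\<dots> = transpose (p a) (p b) \<circ> (p \<circ> apply_transps ts)"
    unfolding comp_transpose_conj[OF assms] by (simp add: comp_assoc)
  also have "\<dots> = apply_transps (map (map_prod p p) (t # ts)) \<circ> p"
    unfolding Cons by (simp add: t comp_assoc)
  finally show ?case .
qed simp

text \<open>\<open>root_perms\<close> with the standard cycle replaced by its \<open>d\<close>-th
  power; these turn out to be exactly the permutations of the elements of
  \<open>summit\<close>.\<close>

definition rotperms :: "nat \<Rightarrow> nat \<Rightarrow> (nat \<Rightarrow> nat) set" where
  "rotperms r d = {g. g permutes {..<r * d + 1} \<and> g ^^ r = id
     \<and> ncyc {..<r * d + 1} (inv (prd (r * d + 1) ^^ d) \<circ> g) + d = r * d + 1}"

text \<open>Excess cycles of the prefix \<open>ps\<close> could not be removed by the letters of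
  \<open>v\<close>, each of which removes at most one. So a prefix of a shortest factorisation is
  shortest.\<close>

lemma ncyc_exact:
  assumes "finite S" "transps_on S ps" "transps_on S v" "ncyc S (apply_transps (ps @ v)) = 1"
    "length ps + length v + 1 = card S"
  shows "ncyc S (apply_transps ps) + length ps = card S"
proof -
  have p: "apply_transps ps permutes S" by (rule transps_on_permutes[OF assms(2)])
  have "ncyc S (apply_transps ps) \<le> ncyc S (apply_transps ps \<circ> apply_transps v) + length v"
    by (rule ncyc_transps_bounds(1)[OF assms(1) p assms(3)])
  then show ?thesis using assms card_le_ncyc_transps[OF assms(1,2)] by simp
qed

locale eps_power =
  fixes r d n :: nat
  assumes r: "r \<ge> 2" and d: "d \<ge> 1" and n: "n = r * d + 1"

sublocale eps_power \<subseteq> artin_system n "gen n"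
  by (rule gen_artin_system)

context eps_power
begin

abbreviation C :: "nat \<Rightarrow> nat" where "C \<equiv> prd n ^^ d"

lemma n2: "n \<ge> 2"
proof -
  have "2 * 1 \<le> r * d" by (rule mult_le_mono[OF r d])
  then show ?thesis unfolding n by linarith
qed

lemma d_less: "d < n - 1"
proof -
  have "2 * d \<le> r * d" using r by simp
  then show ?thesis using n d by simp
qed

lemma C_permutes: "C permutes {..<n}"
  by (rule funpow_permutes[OF prd_permutes])

text \<open>The power expands to a product of \<open>r\<close> rotated copies of \<open>ps\<close>, which therefore is the cycle.\<close>

lemma rotation_complement:
  assumes "transps_on {..<n} ps" "length ps = d" "(C \<circ> apply_transps ps) ^^ r = id"
  shows "\<exists>v. transps_on {..<n} v \<and> length ps + length v + 1 = n \<and> apply_transps (ps @ v) = prd n"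
proof -
  let ?c = "prd n" and ?g = "C \<circ> apply_transps ps"
  have injC: "inj C" using C_permutes by (rule permutes_inj)
  have Q: "\<exists>Q. transps_on {..<n} Q \<and> length Q = j * d \<and> ?g ^^ j = apply_transps Q \<circ> ?c ^^ (d * j)" for j
  proof (induction j)
    case 0
    show ?case by (intro exI[of _ "[]"]) simp
  next
    case (Suc j)
    then obtain Q where Q: "transps_on {..<n} Q" "length Q = j * d"
      "?g ^^ j = apply_transps Q \<circ> ?c ^^ (d * j)" by blast
    let ?Q = "map (map_prod C C) (ps @ Q)"
    have "?g ^^ Suc j = (C \<circ> apply_transps (ps @ Q)) \<circ> ?c ^^ (d * j)"
      using Q(3) by (simp add: comp_assoc)
    also have "\<dots> = apply_transps ?Q \<circ> (C \<circ> ?c ^^ (d * j))"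
      unfolding comp_apply_transps[OF injC] by (simp only: comp_assoc)
    also have "C \<circ> ?c ^^ (d * j) = ?c ^^ (d * Suc j)" by (simp add: funpow_add)
    finally have "?g ^^ Suc j = apply_transps ?Q \<circ> ?c ^^ (d * Suc j)" .
    moreover have "transps_on {..<n} ?Q"
      by (rule transps_on_map[OF C_permutes]) (simp add: assms(1) Q(1))
    moreover have "length ?Q = Suc j * d" using Q(2) assms(2) by simp
    ultimately show ?case by blast
  qed
  obtain Q where Q: "transps_on {..<n} Q" "length Q = (r - 1) * d"
    "?g ^^ (r - 1) = apply_transps Q \<circ> ?c ^^ (d * (r - 1))" using Q by blast
  have r1: "r = Suc (r - 1)" using r by simp
  let ?A = "apply_transps (ps @ Q)" and ?B = "?c ^^ (d * (r - 1))"
  have "?g ^^ r = ?g \<circ> ?g ^^ (r - 1)" using r1 by (metis funpow.simps(2))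
  then have "C \<circ> ?A \<circ> ?B = id" using Q(3) assms(3) by (simp add: comp_assoc)
  \<comment> \<open>Here \<open>n = d + 1 + d * (r - 1)\<close>. Since
    \<open>prd n ^^ n = id\<close>, cancelling \<open>C\<close> on the left and \<open>?B\<close> on
    the right leaves \<open>?A = ?c\<close>.\<close>
  moreover have "C \<circ> ?c \<circ> ?B = ?c ^^ n"
  proof -
    have "n = d + 1 + d * (r - 1)" using r1 n by (metis add.commute add.left_commute mult.commute mult_Suc)
    then have "?c ^^ n = ?c ^^ (d + 1 + d * (r - 1))" by simp
    also have "\<dots> = C \<circ> ?c \<circ> ?B" unfolding funpow_add by simp
    finally show ?thesis by simp
  qed
  ultimately have eq: "C (?A (?B x)) = C (?c (?B x))" for x
    using prd_funpow_self[of n] by (metis comp_apply)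
  have "?A y = ?c y" for y
  proof -
    have "surj ?B" using funpow_permutes[OF prd_permutes] by (rule permutes_surj)
    then obtain x where "y = ?B x" by blast
    then show ?thesis using eq[of x] injC by (auto dest: injD)
  qed
  then have "apply_transps (ps @ Q) = ?c" by (rule ext)
  moreover have "length ps + length Q + 1 = n"
    using assms(2) Q(2) n r1 by (metis mult_Suc)
  ultimately show ?thesis using Q(1) by blast
qed

lemma wperm_delta_bsum:
  assumes "x \<in> bwords n" "transps_on {..<n} ps" "val n x = zmul dl (int k) + bsum ps"
  shows "wperm x = prd n ^^ k \<circ> apply_transps ps" and "wexp x = int k * (int n - 1) + int (length ps)"
proof -
  let ?w = "wpow (ddelta n) (int k) @ wd ps"
  note wd = wd_props[OF assms(2)]
  have b: "?w \<in> bwords n" using wd(1) wpow_bwords[OF ddelta_bwords[OF n2]] by simp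
  have "val n x = val n ?w" using wd(2) assms(3) by (simp add: val_wpow val_ddelta[OF n2])
  then have eq: "wperm x = wperm ?w" "wexp x = wexp ?w"
    using wperm_val[OF assms(1) b] wexp_val[OF assms(1) b] by auto
  show "wperm x = prd n ^^ k \<circ> apply_transps ps"
    unfolding eq using wd(3) ddelta_props[of n n]
    by (simp add: wpow_def wperm_concat_replicate)
  show "wexp x = int k * (int n - 1) + int (length ps)"
    unfolding eq using wd(4) by (simp add: wexp_wpow wexp_ddelta[OF n2])
qed

text \<open>The condition on the permutation replaces conjugacy to the power of \<open>\<epsilon>\<close>.\<close>

definition summit :: "bword set" where
  "summit = {x \<in> bwords n. (\<exists>ps. transps_on {..<n} ps \<and> length ps = d
          \<and> val n x = zmul dl (int d) + bsum ps) \<and> wperm x ^^ r = id}"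

lemma summit_E:
  assumes "x \<in> summit"
  obtains ps v where "x \<in> bwords n" "transps_on {..<n} ps" "length ps = d"
    "val n x = zmul dl (int d) + bsum ps" "wperm x = C \<circ> apply_transps ps" "wperm x ^^ r = id"
    "transps_on {..<n} v" "length ps + length v + 1 = n" "apply_transps (ps @ v) = prd n"
proof -
  from assms obtain ps where ps: "x \<in> bwords n" "transps_on {..<n} ps" "length ps = d"
    "val n x = zmul dl (int d) + bsum ps" "wperm x ^^ r = id" by (auto simp: summit_def)
  have w: "wperm x = C \<circ> apply_transps ps" by (rule wperm_delta_bsum(1)[OF ps(1,2,4)])
  obtain v where "transps_on {..<n} v" "length ps + length v + 1 = n"
    "apply_transps (ps @ v) = prd n"
    using rotation_complement[OF ps(2,3)] ps(5) w by auto
  then show thesis using that ps w by blast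
qed

lemma summit_I:
  assumes "x \<in> bwords n" "transps_on {..<n} ps" "length ps = d"
    "val n x = zmul dl (int d) + bsum ps" "wperm x ^^ r = id"
  shows "x \<in> summit"
  using assms unfolding summit_def by blast

lemma summit_wexp:
  assumes "x \<in> summit"
  shows "wexp x = int d * int n"
proof -
  obtain ps where "x \<in> bwords n" "transps_on {..<n} ps" "length ps = d"
    "val n x = zmul dl (int d) + bsum ps" using summit_E[OF assms] by metis
  then show ?thesis using wperm_delta_bsum(2)[of x ps d] by (simp add: algebra_simps)
qed

text \<open>The exponent sum \<open>d * n\<close> of the summit elements lies strictly between
  \<open>d * (n - 1)\<close> and \<open>(d + 1) * (n - 1)\<close>, because
  \<open>0 < d < n - 1\<close>. Hence the infimum is at most \<open>d\<close> and, by the next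
  lemma, the supremum at least \<open>d + 1\<close>.\<close>

lemma delta_multiple_bounds:
  assumes "k * (int n - 1) \<le> int d * int n"
  shows "k \<le> int d"
proof (rule ccontr)
  assume "\<not> k \<le> int d"
  then have "(int d + 1) * (int n - 1) \<le> k * (int n - 1)" using n2 by (intro mult_right_mono) auto
  then have "int d * int n - int d + int n - 1 \<le> int d * int n" using assms by (simp add: algebra_simps)
  then show False using d_less by linarith
qed

lemma delta_multiple_bounds':
  assumes "int d * int n \<le> k * (int n - 1)"
  shows "int d + 1 \<le> k"
proof (rule ccontr)
  assume "\<not> int d + 1 \<le> k"
  then have "k * (int n - 1) \<le> int d * (int n - 1)" using n2 by (intro mult_right_mono) auto
  then have "int d * int n \<le> int d * int n - int d" using assms by (simp add: algebra_simps)
  then show False using d by linarith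
qed

lemma dlen_bounds:
  assumes "x \<in> bwords n" "wexp x = int d * int n"
  shows "dlen n x \<ge> 1"
    and "dlen n x = 1 \<longleftrightarrow> dprec n (wpow (ddelta n) (int d)) x \<and> dprec n x (wpow (ddelta n) (int d + 1))"
proof -
  note inf = dinf_props[OF n2 assms(1)] and sup = dsup_props[OF n2 assms(1)]
  have 1: "dinf n x \<le> int d"
    using inf(1) delta_multiple_bounds[of "dinf n x"] assms(2)
    unfolding dprec_delta_left[OF n2 assms(1)] by auto
  have 2: "int d + 1 \<le> dsup n x"
    using sup(1) delta_multiple_bounds'[of "dsup n x"] assms(2)
    unfolding dprec_delta_right[OF n2 assms(1)] by auto
  show "dlen n x \<ge> 1" using 1 2 by (simp add: dlen_def)
  show "dlen n x = 1 \<longleftrightarrow> dprec n (wpow (ddelta n) (int d)) x \<and> dprec n x (wpow (ddelta n) (int d + 1))"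
  proof
    assume "dlen n x = 1"
    then have "dinf n x = int d" "dsup n x = int d + 1" using 1 2 by (auto simp: dlen_def)
    then show "dprec n (wpow (ddelta n) (int d)) x \<and> dprec n x (wpow (ddelta n) (int d + 1))"
      using inf(1) sup(1) by simp
  next
    assume "dprec n (wpow (ddelta n) (int d)) x \<and> dprec n x (wpow (ddelta n) (int d + 1))"
    then have "int d \<le> dinf n x" "dsup n x \<le> int d + 1" using inf(2) sup(2) by auto
    then show "dlen n x = 1" using 1 2 by (simp add: dlen_def)
  qed
qed

text \<open>The complement \<open>v\<close> completes the letters to one more Garside element, so
  the value lies between the powers \<open>d\<close> and \<open>d + 1\<close>.\<close>

lemma summit_dlen:
  assumes "x \<in> summit"
  shows "dlen n x = 1"
proof -
  obtain ps v where x: "x \<in> bwords n" "transps_on {..<n} ps" "length ps = d"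
    "val n x = zmul dl (int d) + bsum ps" "transps_on {..<n} v" "length ps + length v + 1 = n"
    "apply_transps (ps @ v) = prd n"
    using summit_E[OF assms] by metis
  have "bsum ps + bsum v = dl" using bsum_transps_prd[of "ps @ v"] x by simp
  then have "zmul dl (int d + 1) = val n x + bsum v"
    unfolding zmul_add x(4) by (simp add: add.assoc) (simp add: zmul_def)
  moreover have "pos (length v) (bsum v)" "pos d (bsum ps)" using x by (auto simp: pos_def)
  moreover note wd = wpow_bwords[OF ddelta_bwords[OF n2]]
  ultimately have "dprec n (wpow (ddelta n) (int d)) x" "dprec n x (wpow (ddelta n) (int d + 1))"
    using x(4) unfolding dprec_pos[OF n2 wd x(1)] dprec_pos[OF n2 x(1) wd] val_wpow val_ddelta[OF n2]
    by blast+
  then show ?thesis using dlen_bounds(2)[OF x(1) summit_wexp[OF assms]] by simp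
qed

lemma dlen_1_summit:
  assumes "x \<in> bwords n" "wexp x = int d * int n" "wperm x ^^ r = id" "dlen n x = 1"
  shows "x \<in> summit"
proof -
  have "dprec n (wpow (ddelta n) (int d)) x" using dlen_bounds(2)[OF assms(1,2)] assms(4) by simp
  then obtain l y where y: "pos l y" "val n x = zmul dl (int d) + y" "wexp x = int d * (int n - 1) + int l"
    unfolding dprec_delta_left[OF n2 assms(1)] by blast
  have "l = d" using y(3) assms(2) by (simp add: algebra_simps)
  then obtain ps where "transps_on {..<n} ps" "length ps = d" "y = bsum ps"
    using y(1) by (auto simp: pos_def)
  then show ?thesis using y(2) assms(1,3) by (intro summit_I) simp_all
qed

text \<open>The two positive parts have the same permutation and the same length, and the complement
  obtained from \<open>rotation_complement\<close> makes \<open>bsum_transps_unique\<close>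
  applicable.\<close>

lemma summit_unique:
  assumes "x \<in> summit" "y \<in> summit" "wperm x = wperm y"
  shows "val n x = val n y"
proof -
  obtain ps v where x: "transps_on {..<n} ps" "length ps = d"
    "val n x = zmul dl (int d) + bsum ps" "wperm x = C \<circ> apply_transps ps"
    "transps_on {..<n} v" "length ps + length v + 1 = n" "apply_transps (ps @ v) = prd n"
    using summit_E[OF assms(1)] by metis
  obtain qs where y: "transps_on {..<n} qs" "length qs = d"
    "val n y = zmul dl (int d) + bsum qs" "wperm y = C \<circ> apply_transps qs"
    using summit_E[OF assms(2)] by metis
  have "apply_transps ps = apply_transps qs"
  proof
    fix z
    have "C (apply_transps ps z) = C (apply_transps qs z)"
      using assms(3) x(4) y(4) by (metis comp_apply)
    then show "apply_transps ps z = apply_transps qs z"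
      using permutes_inj[OF C_permutes] by (auto dest: injD)
  qed
  then have "bsum ps = bsum qs" using bsum_transps_unique[of ps qs v] x y by simp
  then show ?thesis using x(3) y(3) by simp
qed

lemma inv_C_comp:
  "inv C \<circ> (C \<circ> p) = p" "C \<circ> (inv C \<circ> p) = p"
  using permutes_inv_o[OF C_permutes] by (simp_all add: comp_assoc[symmetric])

lemma summit_ncyc:
  assumes "x \<in> summit"
  shows "ncyc {..<n} (inv C \<circ> wperm x) + d = n" and "wperm x permutes {..<n}"
proof -
  obtain ps v where x: "x \<in> bwords n" "transps_on {..<n} ps" "length ps = d" "wperm x = C \<circ> apply_transps ps"
    "transps_on {..<n} v" "length ps + length v + 1 = n" "apply_transps (ps @ v) = prd n"
    using summit_E[OF assms] by metis
  have "ncyc {..<n} (prd n) = 1" by (rule ncyc_prd) (use n2 in simp)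
  then have "ncyc {..<n} (apply_transps ps) + length ps = n"
    using ncyc_exact[of "{..<n}" ps v] x by simp
  then show "ncyc {..<n} (inv C \<circ> wperm x) + d = n" unfolding x(4) inv_C_comp using x(3) by simp
  show "wperm x permutes {..<n}" by (rule wperm_permutes[OF x(1)])
qed

lemma wperm_summit: "wperm ` summit = rotperms r d"
proof (intro equalityI subsetI)
  fix g assume "g \<in> wperm ` summit"
  then obtain x where x: "x \<in> summit" "g = wperm x" by blast
  moreover have "wperm x ^^ r = id" using x(1) by (simp add: summit_def)
  ultimately show "g \<in> rotperms r d" using summit_ncyc[OF x(1)] n by (simp add: rotperms_def)
next
  fix g assume "g \<in> rotperms r d"
  then have g: "g permutes {..<n}" "g ^^ r = id" "ncyc {..<n} (inv C \<circ> g) + d = n"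
    by (auto simp: rotperms_def n)
  have "inv C \<circ> g permutes {..<n}" by (intro permutes_compose permutes_inv C_permutes g)
  then obtain ps where ps: "transps_on {..<n} ps" "apply_transps ps = inv C \<circ> g"
    "length ps + ncyc {..<n} (inv C \<circ> g) = card {..<n}"
    using transps_exist[of "{..<n}"] by blast
  have len: "length ps = d" using ps(3) g(3) by simp
  let ?x = "wpow (ddelta n) (int d) @ wd ps"
  have b: "?x \<in> bwords n"
    using wd_props(1)[OF ps(1)] wpow_bwords[OF ddelta_bwords[OF n2]] by simp
  have v: "val n ?x = zmul dl (int d) + bsum ps"
    using wd_props(2)[OF ps(1)] by (simp add: val_wpow val_ddelta[OF n2])
  have w: "wperm ?x = g" using wperm_delta_bsum(1)[OF b ps(1) v] ps(2) inv_C_comp by simp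
  then have "?x \<in> summit" using b v ps(1) len g(2) by (intro summit_I) auto
  then show "g \<in> wperm ` summit" using w by blast
qed

lemma card_belt_summit: "card (belt n ` summit) = card (rotperms r d)"
proof -
  have eq: "belt n x = belt n y \<longleftrightarrow> wperm x = wperm y" if "x \<in> summit" "y \<in> summit" for x y
  proof -
    have b: "x \<in> bwords n" "y \<in> bwords n" using that by (auto simp: summit_def)
    show ?thesis
      using belt_eq_iff[OF b] summit_unique[OF that] wperm_val[OF b] by blast
  qed
  have "bij_betw (\<lambda>X. wperm (SOME x. x \<in> summit \<and> belt n x = X)) (belt n ` summit) (wperm ` summit)"
  proof -
    have some: "(SOME x. x \<in> summit \<and> belt n x = belt n y) \<in> summit
        \<and> belt n (SOME x. x \<in> summit \<and> belt n x = belt n y) = belt n y" if "y \<in> summit" for y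
      by (rule someI[of _ y]) (use that in simp)
    then have w: "wperm (SOME x. x \<in> summit \<and> belt n x = belt n y) = wperm y" if "y \<in> summit" for y
      using that eq by blast
    show ?thesis
    proof (rule bij_betw_imageI)
      show "inj_on (\<lambda>X. wperm (SOME x. x \<in> summit \<and> belt n x = X)) (belt n ` summit)"
      proof (rule inj_onI, elim imageE)
        fix X X' x x'
        assume "wperm (SOME x. x \<in> summit \<and> belt n x = X) = wperm (SOME x. x \<in> summit \<and> belt n x = X')"
          "X = belt n x" "x \<in> summit" "X' = belt n x'" "x' \<in> summit"
        then show "X = X'" using w eq by metis
      qed
      show "(\<lambda>X. wperm (SOME x. x \<in> summit \<and> belt n x = X)) ` belt n ` summit = wperm ` summit"
        unfolding image_image by (rule image_cong) (simp_all add: w)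
    qed
  qed
  from bij_betw_same_card[OF this] show ?thesis by (simp only: wperm_summit)
qed

end

section \<open>Conjugacy by partial cycling\<close>

context eps_power
begin

text \<open>Conjugacy of group elements, whereas \<open>conjugates\<close> consists of literal
  concatenations of words.\<close>

definition cnj :: "bword \<Rightarrow> bword \<Rightarrow> bool" where
  "cnj x y \<longleftrightarrow> (\<exists>c \<in> bwords n. val n y = val n c + val n x - val n c)"

lemma cnj_I: "c \<in> bwords n \<Longrightarrow> val n y = val n c + val n x - val n c \<Longrightarrow> cnj x y"
  by (auto simp: cnj_def)

lemma cnj_refl: "cnj x x"
  by (rule cnj_I[of "[]"]) simp_all

lemma cnj_sym:
  assumes "cnj x y"
  shows "cnj y x"
proof -
  obtain c where c: "c \<in> bwords n" "val n y = val n c + val n x - val n c"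
    using assms by (auto simp: cnj_def)
  have "val n x = - val n c + val n y - (- val n c)"
    unfolding c(2) diff_conv_add_uminus by (simp only: add.assoc minus_add_cancel minus_minus left_minus add_0_right)
  then show ?thesis using c(1) by (intro cnj_I[of "winv c"]) simp_all
qed

lemma cnj_trans:
  assumes "cnj x y" "cnj y z"
  shows "cnj x z"
proof -
  obtain c c' where c: "c \<in> bwords n" "val n y = val n c + val n x - val n c"
    "c' \<in> bwords n" "val n z = val n c' + val n y - val n c'"
    using assms by (auto simp: cnj_def)
  have "val n z = val n (c' @ c) + val n x - val n (c' @ c)"
    unfolding c(2,4) diff_conv_add_uminus val_simps minus_add by (simp only: add.assoc)
  then show ?thesis using c(1,3) by (intro cnj_I[of "c' @ c"]) simp_all
qed

lemma zmul_dl_bs: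
  assumes "x < n" "y < n" "x \<noteq> y"
  shows "zmul dl (int k) + bs x y = bs ((prd n ^^ k) x) ((prd n ^^ k) y) + zmul dl (int k)"
proof (induction k)
  case 0
  then show ?case by simp
next
  case (Suc k)
  have p: "prd n ^^ k permutes {..<n}" by (rule funpow_permutes[OF prd_permutes])
  have lt: "(prd n ^^ k) z < n" if "z < n" for z using permutes_in_image[OF p, of z] that by simp
  have ne: "(prd n ^^ k) x \<noteq> (prd n ^^ k) y" using permutes_inj[OF p] assms(3) by (auto dest: injD)
  have z: "zmul dl (int (Suc k)) = dl + zmul dl (int k)"
    using zmul_plus1[of dl "int k"] by (simp add: add.commute)
  have "zmul dl (int (Suc k)) + bs x y = dl + bs ((prd n ^^ k) x) ((prd n ^^ k) y) + zmul dl (int k)"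
    unfolding z add.assoc Suc ..
  also have "dl + bs ((prd n ^^ k) x) ((prd n ^^ k) y)
      = bs ((prd n ^^ Suc k) x) ((prd n ^^ Suc k) y) + dl"
    using dl_bs[OF lt[OF assms(1)] lt[OF assms(2)] ne] by simp
  finally show ?case unfolding z by (simp only: add.assoc)
qed

lemma bs_word:
  assumes "x < n" "y < n" "x \<noteq> y"
  obtains w where "w \<in> bwords n" "val n w = bs x y" "wperm w = transpose x y"
  using that[of "wd [(x, y)]"] wd_props[of n "[(x, y)]"] assms by simp

text \<open>A point \<open>p\<close> moved by the positive part gives it a shortest factorisation
  starting with \<open>(p, q)\<close>. Carried across the power of the Garside element, this letter
  becomes \<open>(C p, C q)\<close>; conjugation takes it from the front of the word to its
  end.\<close>

lemma summit_partial_cycling: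
  assumes y: "y \<in> summit" and p: "p < n" and q: "q = inv C (wperm y p)" "q \<noteq> p"
  defines "t \<equiv> transpose (C p) (C q)"
  shows "\<exists>y' \<in> summit. cnj y y' \<and> wperm y' = t \<circ> wperm y \<circ> t"
proof -
  obtain ps v where x: "y \<in> bwords n" "transps_on {..<n} ps" "length ps = d"
    "val n y = zmul dl (int d) + bsum ps" "wperm y = C \<circ> apply_transps ps" "wperm y ^^ r = id"
    "transps_on {..<n} v" "length ps + length v + 1 = n" "apply_transps (ps @ v) = prd n"
    using y by (rule summit_E)
  let ?pi = "apply_transps ps"
  have pp: "?pi permutes {..<n}" by (rule transps_on_permutes[OF x(2)])
  have Cinj: "inj C" using C_permutes by (rule permutes_inj)
  have q': "q = ?pi p" unfolding q(1) x(5) using permutes_inverses(2)[OF C_permutes] by simp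
  have qn: "q < n" using permutes_in_image[OF pp, of p] p q' by simp
  have "q \<in> orbit ?pi p" unfolding q' by (rule orbit.base)
  then have nc: "ncyc {..<n} (transpose p q \<circ> ?pi) = Suc (ncyc {..<n} ?pi)"
    using p qn q(2) by (intro ncyc_split_left pp) simp_all
  have "transpose p q \<circ> ?pi permutes {..<n}"
    using p qn by (intro permutes_compose[OF pp] permutes_swap_id) auto
  then obtain us where us: "transps_on {..<n} us" "apply_transps us = transpose p q \<circ> ?pi"
    "length us + ncyc {..<n} (transpose p q \<circ> ?pi) = card {..<n}"
    using transps_exist[of "{..<n}"] by blast
  have "ncyc {..<n} ?pi + d = n" using summit_ncyc(1)[OF y] unfolding x(5) inv_C_comp .
  then have len: "length us + 1 = d" using us(3) nc by simp
  have app: "apply_transps ((p, q) # us) = ?pi" using us(2) by (simp add: comp_assoc[symmetric])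
  have "bsum ps = bsum ((p, q) # us)"
    using bsum_transps_unique[of ps "(p, q) # us" v] x us(1) len p qn q(2) app by simp
  then have "val n y = (zmul dl (int d) + bs p q) + bsum us"
    using x(4) by (simp add: add.assoc)
  then have vy: "val n y = bs (C p) (C q) + (zmul dl (int d) + bsum us)"
    unfolding zmul_dl_bs[OF p qn q(2)[symmetric]] by (simp add: add.assoc)
  have Cpq: "C p < n" "C q < n" "C p \<noteq> C q"
    using permutes_in_image[OF C_permutes] p qn q(2) Cinj by (auto dest: injD)
  obtain w where w: "w \<in> bwords n" "val n w = bs (C p) (C q)" "wperm w = t"
    using bs_word[OF Cpq] unfolding t_def .
  let ?y = "winv w @ y @ w"
  have val: "val n ?y = zmul dl (int d) + bsum (us @ [(C p, C q)])"
    using vy w(2) by (simp add: add.assoc)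
  have "inv t = t" unfolding t_def by simp
  then have wp: "wperm ?y = inv t \<circ> wperm y \<circ> t"
    using wperm_winv[OF w(1)] w(3) by (simp add: comp_assoc)
  have bt: "bij t" unfolding t_def by simp
  have "(wperm ?y) ^^ r = inv t \<circ> id \<circ> t"
    unfolding wp inv_funpow_perm_conj[OF bt] x(6) ..
  then have "(wperm ?y) ^^ r = id" using bt by (simp add: bij_is_inj)
  then have "?y \<in> summit"
    using us(1) Cpq len w(1) x(1) by (intro summit_I[OF _ _ _ val]) simp_all
  moreover have "cnj y ?y"
    by (rule cnj_I[of "winv w"]) (use w(1) in \<open>simp_all add: diff_conv_add_uminus add.assoc del: add_uminus_conv_diff\<close>)
  ultimately show ?thesis using wp \<open>inv t = t\<close> by auto
qed

text \<open>The Garside element commutes with its powers, so conjugation by it merely rotates the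
  letters of the positive part.\<close>

lemma summit_rotate:
  assumes y: "y \<in> summit"
  shows "\<exists>y' \<in> summit. cnj y y' \<and> wperm y' = prd n \<circ> wperm y \<circ> inv (prd n)"
proof -
  obtain ps where x: "y \<in> bwords n" "transps_on {..<n} ps" "length ps = d"
    "val n y = zmul dl (int d) + bsum ps" "wperm y ^^ r = id"
    using summit_E[OF y] by metis
  let ?w = "ddelta n"
  have w: "?w \<in> bwords n" "val n ?w = dl" "wperm ?w = prd n" using ddelta_props[of n n] by auto
  let ?y = "?w @ y @ winv ?w"
  have "dl + zmul dl (int d) = zmul dl (int d) + zmul dl 1"
    using zmul_plus1[of dl "int d"] zmul_add[of dl "int d" 1] by (simp add: add.commute)
  then have dz: "dl + zmul dl (int d) = zmul dl (int d) + dl" by (simp add: zmul_def)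
  have "val n ?y = (dl + zmul dl (int d)) + bsum ps + - dl"
    using x(4) w(2) by (simp add: add.assoc diff_conv_add_uminus del: add_uminus_conv_diff)
  also have "\<dots> = zmul dl (int d) + (dl + bsum ps) + - dl" unfolding dz by (simp only: add.assoc)
  also have "\<dots> = zmul dl (int d) + bsum (map (map_prod (prd n) (prd n)) ps)"
    unfolding dl_bsum[OF x(2)] by (simp only: add.assoc right_minus add_0_right)
  finally have val: "val n ?y = zmul dl (int d) + bsum (map (map_prod (prd n) (prd n)) ps)" .
  have wp: "wperm ?y = prd n \<circ> wperm y \<circ> inv (prd n)"
    using w wperm_winv[OF w(1)] by (simp add: comp_assoc)
  have bi: "bij (inv (prd n))" and ii: "inv (inv (prd n)) = prd n"
    using permutes_bij[OF permutes_inv[OF prd_permutes]] permutes_inv_inv[OF prd_permutes] by auto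
  have "(inv (inv (prd n)) \<circ> wperm y \<circ> inv (prd n)) ^^ r
      = inv (inv (prd n)) \<circ> wperm y ^^ r \<circ> inv (prd n)"
    by (rule inv_funpow_perm_conj[OF bi])
  then have "(wperm ?y) ^^ r = id"
    unfolding wp ii x(5) using permutes_inv_o(1)[OF prd_permutes] by simp
  then have "?y \<in> summit"
    using x(1,3) w(1) transps_on_map[OF prd_permutes x(2)] by (intro summit_I[OF _ _ _ val]) simp_all
  moreover have "cnj y ?y"
    by (rule cnj_I[of ?w]) (use w(1) in \<open>simp_all add: diff_conv_add_uminus add.assoc del: add_uminus_conv_diff\<close>)
  ultimately show ?thesis using wp by blast
qed

text \<open>The renumbering that carries the standard cycle to \<open>C\<close>. Multiplication by
  \<open>d\<close> is invertible modulo \<open>n\<close> because \<open>r * d\<close> is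
  \<open>-1\<close>; hence the inverse factor \<open>n - r\<close> in
  \<open>chi_inverse\<close>.\<close>

definition chi :: "nat \<Rightarrow> nat" where
  "chi j = (if j < n then (d * j) mod n else j)"

lemma n_pos: "n > 0"
  using n2 by simp

lemma chi_inverse:
  assumes "j < n"
  shows "((n - r) * (d * j mod n)) mod n = j"
proof -
  have "r \<le> n" using n d by (cases d) auto
  then have "(n - r) * d + r * d = n * d" by (simp add: diff_mult_distrib)
  then have "(n - r) * d = n * (d - 1) + 1" using n d by (cases d) (auto simp: algebra_simps)
  then have "(n - r) * (d * j) = (n * (d - 1) + 1) * j" by (simp only: mult.assoc[symmetric])
  then have "(n - r) * (d * j) = j + n * ((d - 1) * j)" by (simp add: algebra_simps)
  then have "((n - r) * (d * j mod n)) mod n = (j + n * ((d - 1) * j)) mod n"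
    by (metis mod_mult_right_eq)
  then show ?thesis using assms by simp
qed

lemma chi_permutes: "chi permutes {..<n}"
proof (rule inj_imp_permutes)
  show "inj_on chi {..<n}"
  proof (rule inj_onI)
    fix i j assume ij: "i \<in> {..<n}" "j \<in> {..<n}" "chi i = chi j"
    then have "d * i mod n = d * j mod n" by (simp add: chi_def)
    then have "((n - r) * (d * i mod n)) mod n = ((n - r) * (d * j mod n)) mod n" by (simp only:)
    then show "i = j" using ij by (simp only: chi_inverse lessThan_iff)
  qed
qed (use n_pos in \<open>auto simp: chi_def\<close>)

lemma chi_prd: "chi \<circ> prd n = C \<circ> chi"
proof
  fix j
  show "(chi \<circ> prd n) j = (C \<circ> chi) j"
  proof (cases "j < n")
    case False
    then show ?thesis by (simp add: chi_def prd_def prd_funpow_out)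
  next
    case True
    have C: "C (chi j) = (d * j + d * (n - 1)) mod n"
      using prd_funpow_eq[of "(d * j) mod n" n d] n_pos True by (simp add: chi_def mod_add_left_eq)
    show ?thesis
    proof (cases "j = 0")
      case True
      then show ?thesis using C n_pos by (simp add: chi_def prd_def)
    next
      case False
      then have "d * j + d * (n - 1) = d * (j - 1) + n * d"
        using n_pos by (cases j; cases n) (auto simp: algebra_simps)
      then have "C (chi j) = (d * (j - 1) + n * d) mod n" using C by (simp only:)
      then show ?thesis using True False by (simp add: chi_def prd_def)
    qed
  qed
qed

lemma chi_conj_prd: "inv chi \<circ> (inv C \<circ> g) \<circ> chi = inv (prd n) \<circ> (inv chi \<circ> g \<circ> chi)"
proof -
  have "inv (chi \<circ> prd n) = inv (prd n) \<circ> inv chi"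
    by (rule o_inv_distrib[OF permutes_bij[OF chi_permutes] permutes_bij[OF prd_permutes]])
  moreover have "inv (C \<circ> chi) = inv chi \<circ> inv C"
    by (rule o_inv_distrib[OF permutes_bij[OF C_permutes] permutes_bij[OF chi_permutes]])
  ultimately have "inv chi \<circ> inv C = inv (prd n) \<circ> inv chi" using chi_prd by simp
  then show ?thesis by (metis comp_assoc)
qed

lemma rotperms_chi:
  assumes "g permutes {..<n}"
  shows "g \<in> rotperms r d \<longleftrightarrow> inv chi \<circ> g \<circ> chi \<in> root_perms r d"
proof -
  have p: "inv chi \<circ> g \<circ> chi permutes {..<n}"
    by (intro permutes_compose permutes_inv chi_permutes assms)
  have b: "bij chi" using chi_permutes by (rule permutes_bij)
  have cc: "inv chi \<circ> chi = id" "chi \<circ> inv chi = id" using permutes_inv_o[OF chi_permutes] by auto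
  have "inv C \<circ> g permutes {..<n}" by (intro permutes_compose permutes_inv C_permutes assms)
  then have "ncyc {..<n} (inv (prd n) \<circ> (inv chi \<circ> g \<circ> chi)) = ncyc {..<n} (inv C \<circ> g)"
    using ncyc_perm_conj[of "{..<n}" "inv C \<circ> g" chi] chi_permutes chi_conj_prd by simp
  moreover have "(inv chi \<circ> g \<circ> chi) ^^ r = id \<longleftrightarrow> g ^^ r = id"
  proof -
    have "inv chi \<circ> (g ^^ r) \<circ> chi = id \<longleftrightarrow> g ^^ r = id"
    proof
      assume e: "inv chi \<circ> (g ^^ r) \<circ> chi = id"
      have "g ^^ r = (chi \<circ> inv chi) \<circ> (g ^^ r) \<circ> (chi \<circ> inv chi)" using cc by simp
      also have "\<dots> = chi \<circ> (inv chi \<circ> (g ^^ r) \<circ> chi) \<circ> inv chi" by (simp only: comp_assoc)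
      also have "\<dots> = id" unfolding e using cc by simp
      finally show "g ^^ r = id" .
    qed (use cc in simp)
    then show ?thesis unfolding inv_funpow_perm_conj[OF b] .
  qed
  ultimately show ?thesis
    using assms p unfolding rotperms_def root_perms_def n[symmetric] by simp
qed

lemma card_rotperms: "card (rotperms r d) = n choose d"
proof -
  have cc: "inv chi \<circ> chi = id" "chi \<circ> inv chi = id" using permutes_inv_o[OF chi_permutes] by auto
  have cancel: "inv chi \<circ> (chi \<circ> h \<circ> inv chi) \<circ> chi = h" "chi \<circ> (inv chi \<circ> h \<circ> chi) \<circ> inv chi = h" for h
  proof -
    have "inv chi \<circ> (chi \<circ> h \<circ> inv chi) \<circ> chi = (inv chi \<circ> chi) \<circ> h \<circ> (inv chi \<circ> chi)"
      by (simp only: comp_assoc)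
    then show "inv chi \<circ> (chi \<circ> h \<circ> inv chi) \<circ> chi = h" using cc by simp
    have "chi \<circ> (inv chi \<circ> h \<circ> chi) \<circ> inv chi = (chi \<circ> inv chi) \<circ> h \<circ> (chi \<circ> inv chi)"
      by (simp only: comp_assoc)
    then show "chi \<circ> (inv chi \<circ> h \<circ> chi) \<circ> inv chi = h" using cc by simp
  qed
  have gp: "g permutes {..<n}" if "g \<in> rotperms r d" for g using that n by (simp add: rotperms_def)
  have hp: "h permutes {..<n}" if "h \<in> root_perms r d" for h using that n by (simp add: root_perms_def)
  have "bij_betw (\<lambda>g. inv chi \<circ> g \<circ> chi) (rotperms r d) (root_perms r d)"
  proof (rule bij_betw_byWitness[where f' = "\<lambda>h. chi \<circ> h \<circ> inv chi"])
    show "\<forall>g \<in> rotperms r d. chi \<circ> (inv chi \<circ> g \<circ> chi) \<circ> inv chi = g" using cancel by simp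
    show "\<forall>h \<in> root_perms r d. inv chi \<circ> (chi \<circ> h \<circ> inv chi) \<circ> chi = h" using cancel by simp
    show "(\<lambda>g. inv chi \<circ> g \<circ> chi) ` rotperms r d \<subseteq> root_perms r d"
      using rotperms_chi gp by blast
    have "chi \<circ> h \<circ> inv chi \<in> rotperms r d" if "h \<in> root_perms r d" for h
    proof -
      have "chi \<circ> h \<circ> inv chi permutes {..<n}"
        by (intro permutes_compose permutes_inv chi_permutes hp[OF that])
      then show ?thesis using rotperms_chi[of "chi \<circ> h \<circ> inv chi"] that unfolding cancel by simp
    qed
    then show "(\<lambda>h. chi \<circ> h \<circ> inv chi) ` root_perms r d \<subseteq> rotperms r d" by blast
  qed
  then have "card (rotperms r d) = card (root_perms r d)" by (rule bij_betw_same_card)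
  then show ?thesis using card_root_perms_binomial[OF r] n by simp
qed

text \<open>The points of \<open>{1..<n}\<close> form \<open>r\<close> blocks of \<open>d\<close>
  consecutive points, numbered from \<open>0\<close>. The point \<open>0\<close> is in no block; its
  value is a default of truncated subtraction.\<close>

definition lev :: "nat \<Rightarrow> nat" where
  "lev v = (v - 1) div d"

text \<open>With \<open>x - 1 = r * M + j\<close> one gets
  \<open>d * x = n * M + d * j + (d - M)\<close>, where \<open>d - M\<close> lies in
  \<open>{1..d}\<close>. So the residue \<open>j\<close> becomes the number of the block.\<close>

lemma chi_lev:
  assumes "0 < x" "x < n"
  shows "lev (chi x) = (x - 1) mod r" and "0 < chi x"
proof -
  define M where "M = (x - 1) div r"
  define j where "j = (x - 1) mod r"
  have x: "x = r * M + j + 1" using assms(1) by (simp add: M_def j_def)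
  have "x - 1 < d * r" using assms n by (simp add: mult.commute)
  then have M: "M < d" unfolding M_def by (rule less_mult_imp_div_less)
  have j: "j < r" using r by (simp add: j_def)
  obtain e where e: "d = M + e + 1" using M by (metis less_iff_Suc_add add.commute add_Suc plus_1_eq_Suc)
  have dx: "d * x = d * j + e + 1 + n * M"
    unfolding x n by (simp add: algebra_simps) (simp add: e algebra_simps)
  have lt: "d * j + e + 1 < n"
  proof -
    have "d * (j + 1) \<le> d * r" using j by (intro mult_le_mono2) simp
    then have "d * j + d \<le> d * r" by simp
    then show ?thesis using e n by (simp add: mult.commute)
  qed
  have "chi x = (d * j + e + 1 + n * M) mod n" using assms(2) dx by (simp add: chi_def)
  then have "chi x = d * j + e + 1" using lt by simp
  moreover have "e < d" using e by simp
  ultimately show "0 < chi x" "lev (chi x) = (x - 1) mod r"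
    unfolding j_def[symmetric] by (simp_all add: lev_def)
qed

lemma rotperms_fixpoint:
  assumes "g \<in> rotperms r d"
  shows "\<exists>x < n. g x = x"
proof -
  have g: "g permutes {..<n}" using assms n by (simp add: rotperms_def)
  have "inv chi \<circ> g \<circ> chi \<in> root_perms r d" using rotperms_chi[OF g] assms by simp
  then obtain x where x: "x < n" "inv chi (g (chi x)) = x"
    using root_perms_structure(2)[OF _ r, of _ d] n by fastforce
  then have "g (chi x) = chi x" using permutes_inverses(1)[OF chi_permutes] by metis
  moreover have "chi x < n" using permutes_in_image[OF chi_permutes, of x] x by simp
  ultimately show ?thesis by blast
qed

text \<open>\<open>nc_perms_levelled\<close> for \<open>k = 1\<close>, transported by
  \<open>chi\<close>: a drop of the residue by one becomes a move to the cyclically previous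
  block.\<close>

lemma rotperms_lev:
  assumes g: "g \<in> rotperms r d" "g 0 = 0" and v: "0 < v" "v < n"
  shows "0 < g v" "g v < n" "(lev (g v) + 1) mod r = lev v"
proof -
  have gp: "g permutes {..<n}" using g n by (simp add: rotperms_def)
  let ?h = "inv chi \<circ> g \<circ> chi"
  have hp: "?h permutes {..<n}" by (intro permutes_compose permutes_inv chi_permutes gp)
  have c0: "chi 0 = 0" using n_pos by (simp add: chi_def)
  then have i0: "inv chi 0 = 0" using permutes_inverses(2)[OF chi_permutes, of 0] by simp
  have h0: "?h 0 = 0" using g(2) c0 i0 by simp
  have "?h \<in> nc_perms r d 1" using rotperms_chi[OF gp] g(1) h0 nc_perms_eq_root_perms[OF r] by simp
  then have "levelled r (r * d + 1) 1 ?h" by (rule nc_perms_levelled) (use r in simp_all)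
  moreover have "orbit ?h 0 = {0}" using h0 orbit_eq_singleton_iff by metis
  ultimately have L: "(?h x + 1) mod r = x mod r" if "0 < x" "x < n" for x
    using that n by (simp add: levelled_def del: comp_apply)
  obtain x where x: "v = chi x" using permutes_surj[OF chi_permutes] by blast
  have x0: "0 < x" using x v(1) c0 by (cases "x = 0") auto
  have xn: "x < n" using x v(2) permutes_in_image[OF chi_permutes, of x] by simp
  have hx: "?h x \<noteq> 0" using h0 x0 permutes_inj[OF hp] by (metis injD less_irrefl)
  have hn: "?h x < n" using permutes_in_image[OF hp, of x] xn by simp
  have gx: "g v = chi (?h x)" using x permutes_inverses(1)[OF chi_permutes] by simp
  show "0 < g v" unfolding gx using chi_lev(2) hx hn by simp
  show "g v < n" using permutes_in_image[OF gp, of v] v(2) by simp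
  have "(lev (g v) + 1) mod r = ((?h x - 1) mod r + 1) mod r"
    unfolding gx using chi_lev(1) hx hn by simp
  also have "\<dots> = ?h x mod r" using hx by (simp add: mod_Suc_eq)
  also have "\<dots> = (x - 1) mod r"
  proof -
    have "(?h x + 1) mod r = (x - 1 + 1) mod r" using L[OF x0 xn] x0 by simp
    then show ?thesis by (simp only: nat_mod_eq_iff) auto
  qed
  also have "\<dots> = lev v" using chi_lev(1)[OF x0 xn] x by simp
  finally show "(lev (g v) + 1) mod r = lev v" .
qed


section \<open>Settling the points above the lowest block\<close>

lemma C_apply: "u < n \<Longrightarrow> C u = (if d \<le> u then u - d else u + n - d)"
proof -
  assume u: "u < n"
  have dn: "d \<le> n" "d * n = d * (n - 1) + d" using d_less by (cases n; simp)+
  have "C u = (u + d * (n - 1)) mod n" by (rule prd_funpow_eq[OF u])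
  also have "\<dots> = (if d \<le> u then u - d else u + n - d)"
  proof (cases "d \<le> u")
    case True
    then have "u + d * (n - 1) = (u - d) + n * d" using dn by (simp add: mult.commute)
    then have "(u + d * (n - 1)) mod n = (u - d) mod n" by simp
    then show ?thesis using True u by simp
  next
    case False
    have "n * d = n * (d - 1) + n" using d by (cases d) auto
    then have "u + d * (n - 1) = (u + n - d) + n * (d - 1)" using dn by (simp add: mult.commute)
    then have "(u + d * (n - 1)) mod n = (u + n - d) mod n" by simp
    then show ?thesis using False dn by simp
  qed
  finally show ?thesis .
qed

lemma lev_less: "0 < v \<Longrightarrow> v < n \<Longrightarrow> lev v < r"
  unfolding lev_def using n by (intro less_mult_imp_div_less) simp

lemma lev_diff: "d < v \<Longrightarrow> lev (v - d) + 1 = lev v"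
proof -
  assume "d < v"
  then have "v - d - 1 + d = v - 1" by linarith
  moreover have "(v - d - 1 + d) div d = (v - d - 1) div d + 1" using d by simp
  ultimately show ?thesis unfolding lev_def by simp
qed

lemma lev_pos_iff: "lev v > 0 \<longleftrightarrow> d < v"
  using d by (auto simp: lev_def div_greater_zero_iff)

text \<open>A point is settled when \<open>inv C \<circ> g\<close>, the permutation of the positive
  part, fixes it. The lowest block, \<open>v \<le> d\<close>, is exempt, since the letters are to be
  collected there.\<close>

definition unsettled :: "(nat \<Rightarrow> nat) \<Rightarrow> nat set" where
  "unsettled g = {v. d < v \<and> v < n \<and> inv C (g v) \<noteq> v}"

context
  fixes g :: "nat \<Rightarrow> nat"
  assumes g: "g \<in> rotperms r d" "g 0 = 0"
begin

text \<open>Above the lowest block the move to the previous block does not wrap around, so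
  \<open>inv C\<close> answers it by adding \<open>d\<close>, and \<open>inv C (g v)\<close> lies in
  the block of \<open>v\<close>.\<close>

lemma settled_step:
  assumes v: "d < v" "v < n"
  shows "inv C (g v) = g v + d" "d < g v + d" "g v + d < n" "lev (g v) + 1 = lev v"
proof -
  have v0: "0 < v" using v by simp
  note gl = rotperms_lev[OF g v0 v(2)]
  have "lev v < r" "lev v > 0" using lev_less[OF v0 v(2)] lev_pos_iff v(1) by auto
  moreover have "lev (g v) < r" by (rule lev_less[OF gl(1,2)])
  ultimately show l: "lev (g v) + 1 = lev v"
    using gl(3) by (cases "lev (g v) + 1 = r") auto
  then have "lev (g v) + 1 < r" using \<open>lev v < r\<close> by simp
  have "g v - 1 < d * (lev (g v) + 1)"
    using d unfolding lev_def by (metis add.commute dividend_less_times_div mult.commute mult_Suc_right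
      plus_1_eq_Suc zero_less_one less_le_trans)
  also have "\<dots> \<le> d * (r - 1)" using \<open>lev (g v) + 1 < r\<close> by (intro mult_le_mono2) simp
  finally have "g v + d \<le> d * (r - 1) + d" using gl(1) by simp
  also have "\<dots> = d * r" using r by (cases r) auto
  finally show lt: "g v + d < n" using n by (simp add: mult.commute)
  then have "C (g v + d) = g v" using C_apply[of "g v + d"] by simp
  then show "inv C (g v) = g v + d"
    using permutes_inverses(2)[OF C_permutes, of "g v + d"] by simp
  show "d < g v + d" using gl(1) by simp
qed

text \<open>Settled points move down by exactly \<open>d\<close>, and the values on the lowest block
  are then forced by \<open>g ^^ r = id\<close>.\<close>

lemma settled_determines:
  assumes "unsettled g = {}" "v < n"
  shows "g v = (if v = 0 then 0 else if d < v then v - d else v + (r - 1) * d)"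
proof -
  have up: "g u = u - d" if "d < u" "u < n" for u
  proof -
    have "inv C (g u) = u" using that assms(1) by (auto simp: unsettled_def)
    then show ?thesis using settled_step(1)[OF that] by simp
  qed
  consider "v = 0" | "d < v" | "0 < v" "v \<le> d" by linarith
  then show ?thesis
  proof cases
    case 3
    \<comment> \<open>The point of the top block that reaches \<open>v\<close> after
      \<open>r - 1\<close> steps down; the \<open>r\<close>-th step has to return to it.\<close>
    let ?t = "v + (r - 1) * d"
    have "(r - 1) * d + d = r * d" using r by (cases r) auto
    then have tn: "?t < n" using 3 n by linarith
    have it: "(g ^^ j) ?t = v + (r - 1 - j) * d" if "j \<le> r - 1" for j
      using that
    proof (induction j)
      case (Suc j)
      obtain e where e: "r - 1 - j = Suc e" "r - 1 - Suc j = e"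
        using Suc.prems by (metis Suc_diff_Suc Suc_le_lessD)
      have "Suc e * d \<le> (r - 1) * d" by (rule mult_le_mono1) (use e(1) in linarith)
      then have "g (v + Suc e * d) = v + e * d"
        using up[of "v + Suc e * d"] 3 tn by simp
      then show ?case using Suc e by simp
    qed simp
    have "(g ^^ r) ?t = g ((g ^^ (r - 1)) ?t)"
      using r by (cases r) auto
    then have "g v = (g ^^ r) ?t" using it[of "r - 1"] by simp
    also have "\<dots> = ?t" using g(1) by (simp add: rotperms_def)
    finally show ?thesis using 3 by simp
  qed (use g(2) up assms(2) in auto)
qed

text \<open>One partial cycling step pushes a transposition of \<open>inv C \<circ> g\<close> from its level to the level
  below, so the exponentially weighted number of unsettled points decreases.\<close>

lemma cycling_decreases:
  assumes v: "v \<in> unsettled g"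
  defines "q \<equiv> inv C (g v)"
  defines "t \<equiv> transpose (C v) (C q)"
  shows "(\<Sum>u\<in>unsettled (t \<circ> g \<circ> t). (3 :: nat) ^ lev u) < (\<Sum>u\<in>unsettled g. 3 ^ lev u)"
    and "(t \<circ> g \<circ> t) 0 = 0"
proof -
  have vd: "d < v" "v < n" "q \<noteq> v" using v by (auto simp: unsettled_def q_def)
  note st = settled_step[OF vd(1,2), folded q_def]
  have Cinj: "inj C" using C_permutes by (rule permutes_inj)
  have gp: "g permutes {..<n}" using g n by (simp add: rotperms_def)
  have Cv: "C v = v - d" using C_apply[OF vd(2)] vd(1) by simp
  have Cq: "C q = g v" unfolding q_def using permutes_inverses(1)[OF C_permutes] .
  have gv0: "g v > 0" using st(1,2) by simp
  have t0: "t 0 = 0" unfolding t_def Cv Cq using gv0 vd(1) by simp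
  show "(t \<circ> g \<circ> t) 0 = 0" using t0 g(2) by simp
  let ?p = "\<lambda>u. inv C (g u)"
  let ?s = "transpose v q"
  have pinj: "inj ?p"
    using permutes_inj[OF permutes_compose[OF gp permutes_inv[OF C_permutes]]] by (simp add: comp_def)
  have invC_t: "inv C (t u) = ?s (inv C u)" for u
  proof -
    have "C (?s (inv C u)) = t (C (inv C u))"
      using comp_transpose_conj[OF Cinj, of v q] unfolding t_def by (metis comp_apply)
    then have "C (?s (inv C u)) = t u" using permutes_inverses(1)[OF C_permutes] by simp
    then show ?thesis using permutes_inverses(2)[OF C_permutes] by metis
  qed
  let ?E = "{v - d, g v} \<inter> {d<..}"
  \<comment> \<open>Only the two points \<open>v - d\<close> and \<open>g v\<close> moved by
    \<open>t\<close> can become unsettled, both one level below \<open>v\<close>; the point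
    \<open>v\<close> itself becomes settled.\<close>
  have sub: "unsettled (t \<circ> g \<circ> t) \<subseteq> (unsettled g - {v}) \<union> ?E"
  proof
    fix u assume u: "u \<in> unsettled (t \<circ> g \<circ> t)"
    then have ud: "d < u" "u < n" "?s (?p (t u)) \<noteq> u" by (auto simp: unsettled_def invC_t)
    show "u \<in> (unsettled g - {v}) \<union> ?E"
    proof (cases "u = v - d \<or> u = g v")
      case True
      then show ?thesis using ud by auto
    next
      case False
      then have "t u = u" by (simp add: t_def Cv Cq)
      then have su: "?s (?p u) \<noteq> u" using ud by simp
      then have uv: "u \<noteq> v" by (auto simp: q_def)
      have "?p u \<noteq> u"
      proof
        assume pu: "?p u = u"
        then have "?s u \<noteq> u" using su by simp
        then have "u = q" using uv by (auto simp: transpose_def split: if_splits)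
        then have "?p u = ?p v" using pu by (simp add: q_def)
        then show False using uv pinj by (auto dest: injD)
      qed
      then show ?thesis using uv ud by (simp add: unsettled_def)
    qed
  qed
  have fin: "finite (unsettled g)" by (rule finite_subset[of _ "{..<n}"]) (auto simp: unsettled_def)
  let ?w = "\<lambda>u. (3 :: nat) ^ lev u"
  obtain j where j: "lev v = Suc j" using lev_pos_iff[of v] vd(1) by (cases "lev v") auto
  have wE: "?w u = 3 ^ j" if "u \<in> ?E" for u
    using that lev_diff[OF vd(1)] st(4) j by auto
  \<comment> \<open>At most two points of weight \<open>3 ^ j\<close> replace one of weight
    \<open>3 ^ (j + 1)\<close>; this is where the base \<open>3\<close> comes from.\<close>
  have "(\<Sum>u\<in>?E. ?w u) = card ?E * 3 ^ j" using wE by simp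
  also have "\<dots> \<le> 2 * 3 ^ j"
  proof (rule mult_le_mono1)
    have "card ?E \<le> card {v - d, g v}" by (rule card_mono) auto
    also have "\<dots> \<le> 2" by (simp add: card_insert_if)
    finally show "card ?E \<le> 2" .
  qed
  finally have E: "(\<Sum>u\<in>?E. ?w u) \<le> 2 * 3 ^ j" .
  have "(\<Sum>u\<in>unsettled (t \<circ> g \<circ> t). ?w u) \<le> (\<Sum>u\<in>(unsettled g - {v}) \<union> ?E. ?w u)"
    by (rule sum_mono2[OF _ sub]) (use fin in auto)
  also have "\<dots> \<le> (\<Sum>u\<in>unsettled g - {v}. ?w u) + (\<Sum>u\<in>?E. ?w u)"
    using sum.union_inter[of "unsettled g - {v}" ?E ?w] fin by simp
  also have "\<dots> < (\<Sum>u\<in>unsettled g - {v}. ?w u) + ?w v"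
    using E j by (simp add: order_le_less_trans)
  also have "\<dots> = (\<Sum>u\<in>unsettled g. ?w u)"
    using sum.remove[OF fin v, of ?w] by simp
  finally show "(\<Sum>u\<in>unsettled (t \<circ> g \<circ> t). ?w u) < (\<Sum>u\<in>unsettled g. ?w u)" .
qed

end

text \<open>Rotation by the Garside element lowers a fixed point \<open>f\<close> by one, so
  \<open>f\<close> rotations bring it to \<open>0\<close>.\<close>

lemma summit_fix_0:
  assumes "y \<in> summit"
  shows "\<exists>y' \<in> summit. cnj y y' \<and> wperm y' 0 = 0"
proof -
  have "wperm y \<in> rotperms r d" using assms wperm_summit by blast
  then obtain f where "f < n" "wperm y f = f" using rotperms_fixpoint by blast
  then show ?thesis using assms
  proof (induction f arbitrary: y)
    case 0
    then show ?case using cnj_refl by blast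
  next
    case (Suc f)
    obtain y' where y': "y' \<in> summit" "cnj y y'" "wperm y' = prd n \<circ> wperm y \<circ> inv (prd n)"
      using summit_rotate[OF Suc.prems(3)] by blast
    have p: "prd n (Suc f) = f" using Suc.prems(1) by (simp add: prd_def)
    then have "inv (prd n) f = Suc f" using permutes_inverses(2)[OF prd_permutes] by metis
    then have "wperm y' f = f" using y'(3) Suc.prems(2) p by simp
    then obtain y'' where "y'' \<in> summit" "cnj y' y''" "wperm y'' 0 = 0"
      using Suc.IH[of y'] Suc.prems(1) y'(1) by auto
    then show ?case using cnj_trans[OF y'(2)] by blast
  qed
qed

lemma summit_settle:
  assumes "y \<in> summit" "wperm y 0 = 0"
  shows "\<exists>y' \<in> summit. cnj y y' \<and> wperm y' 0 = 0 \<and> unsettled (wperm y') = {}"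
  using assms
proof (induction "\<Sum>u\<in>unsettled (wperm y). (3 :: nat) ^ lev u" arbitrary: y rule: less_induct)
  case less
  show ?case
  proof (cases "unsettled (wperm y) = {}")
    case True
    then show ?thesis using less.prems cnj_refl by blast
  next
    case False
    then obtain v where v: "v \<in> unsettled (wperm y)" by blast
    have g: "wperm y \<in> rotperms r d" using less.prems(1) wperm_summit by blast
    let ?q = "inv C (wperm y v)"
    let ?t = "transpose (C v) (C ?q)"
    have vn: "v < n" "?q \<noteq> v" using v by (auto simp: unsettled_def)
    obtain y' where y': "y' \<in> summit" "cnj y y'" "wperm y' = ?t \<circ> wperm y \<circ> ?t"
      using summit_partial_cycling[OF less.prems(1) vn(1) refl vn(2)] by blast
    note dec = cycling_decreases[OF g less.prems(2) v, folded y'(3)]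
    obtain y'' where "y'' \<in> summit" "cnj y' y''" "wperm y'' 0 = 0" "unsettled (wperm y'') = {}"
      using less.hyps[OF dec(1) y'(1) dec(2)] by blast
    then show ?thesis using cnj_trans[OF y'(2)] by blast
  qed
qed

text \<open>Both elements are brought to settled form, whose permutation is completely determined;
  \<open>summit_unique\<close> then identifies the two forms.\<close>

lemma summit_conjugate:
  assumes "x \<in> summit" "y \<in> summit"
  shows "cnj x y"
proof -
  have "\<exists>z \<in> summit. cnj x z \<and> wperm z 0 = 0 \<and> unsettled (wperm z) = {}" if "x \<in> summit" for x
    using summit_fix_0[OF that] summit_settle cnj_trans by metis
  then obtain x' y' where x': "x' \<in> summit" "cnj x x'" "wperm x' 0 = 0" "unsettled (wperm x') = {}"
    and y': "y' \<in> summit" "cnj y y'" "wperm y' 0 = 0" "unsettled (wperm y') = {}"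
    using assms by metis
  have g: "wperm x' \<in> rotperms r d" "wperm y' \<in> rotperms r d" using x'(1) y'(1) wperm_summit by blast+
  have "wperm x' v = wperm y' v" for v
  proof (cases "v < n")
    case True
    then show ?thesis
      using settled_determines[OF g(1) x'(3,4)] settled_determines[OF g(2) y'(3,4)] by simp
  next
    case False
    then show ?thesis
      using permutes_not_in[OF summit_ncyc(2)[OF x'(1)], of v] permutes_not_in[OF summit_ncyc(2)[OF y'(1)], of v]
      by simp
  qed
  then have "val n x' = val n y'" using summit_unique[OF x'(1) y'(1)] by blast
  then have "cnj x' y'" by (intro cnj_I[of "[]"]) simp_all
  then show ?thesis using x'(2) y'(2) cnj_trans cnj_sym by blast
qed

lemma eps_power_summit: "concat (replicate d (ddelta n @ band 2 1)) \<in> summit"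
proof -
  let ?e = "ddelta n @ band 2 1"
  have b: "band 2 1 = band (Suc 1) (Suc 0)" by (simp add: numeral_2_eq_2)
  note bp = band_props[of 0 1 n, folded b]
  have n1: "1 < n" using n2 by simp
  have e: "?e \<in> bwords n" "val n ?e = dl + bs 1 0" "wperm ?e = prd n \<circ> transpose 1 0"
    using bp n1 ddelta_props[of n n] by (simp_all add: bs_ordered)
  have eb: "concat (replicate k ?e) \<in> bwords n" for k by (rule concat_replicate_bwords[OF e(1)])
  have "\<exists>ps. transps_on {..<n} ps \<and> length ps = k
      \<and> val n (concat (replicate k ?e)) = zmul dl (int k) + bsum ps" for k
  proof (induction k)
    case 0
    show ?case by (intro exI[of _ "[]"]) simp
  next
    case (Suc k)
    then obtain ps where ps: "transps_on {..<n} ps" "length ps = k"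
      "val n (concat (replicate k ?e)) = zmul dl (int k) + bsum ps" by blast
    have "pos 1 (bs 1 0)" unfolding pos_def using n1 by (intro exI[of _ "[(1, 0)]"]) simp
    then obtain y where y: "pos 1 y" "bs 1 0 + zmul dl (int k) = zmul dl (int k) + y"
      using pos_zmul' by blast
    then obtain qs where qs: "transps_on {..<n} qs" "length qs = 1" "y = bsum qs"
      by (auto simp: pos_def)
    have "val n (concat (replicate (Suc k) ?e)) = val n ?e + val n (concat (replicate k ?e))"
      by (simp only: replicate_Suc concat.simps val_simps)
    also have "\<dots> = dl + (bs 1 0 + zmul dl (int k)) + bsum ps"
      unfolding e(2) ps(3) by (simp only: add.assoc)
    also have "\<dots> = (dl + zmul dl (int k)) + bsum (qs @ ps)"
      unfolding y(2) qs(3) by (simp add: add.assoc)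
    also have "dl + zmul dl (int k) = zmul dl (int (Suc k))"
      using zmul_plus1[of dl "int k"] by (simp add: add.commute)
    finally show ?case using ps qs by (intro exI[of _ "qs @ ps"]) simp
  qed
  then obtain ps where ps: "transps_on {..<n} ps" "length ps = d"
    "val n (concat (replicate d ?e)) = zmul dl (int d) + bsum ps" by blast
  let ?g = "prd n \<circ> transpose 1 0"
  \<comment> \<open>The permutation of \<open>?e\<close> fixes \<open>0\<close> and is a cycle on
    the other \<open>n - 1 = d * r\<close> points, so its power \<open>d * r\<close> is
    trivial.\<close>
  have g1: "?g (Suc x) = Suc (prd (n - 1) x)" if "x < n - 1" for x
    using that n1 by (auto simp: prd_def transpose_def)
  have it: "(?g ^^ k) (Suc x) = Suc ((prd (n - 1) ^^ k) x)" if x: "x < n - 1" for x k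
  proof (induction k)
    case (Suc k)
    have "(prd (n - 1) ^^ k) x < n - 1"
      using permutes_in_image[OF funpow_permutes[OF prd_permutes[of "n - 1"]], of k x] x by simp
    then show ?case using Suc g1 by simp
  qed simp
  have "(?g ^^ (n - 1)) x = x" for x
  proof -
    consider "x = 0" | "0 < x" "x < n" | "n \<le> x" by linarith
    then show ?thesis
    proof cases
      case 1
      have "?g 0 = 0" using n1 by (simp add: prd_def)
      then have "(?g ^^ k) 0 = 0" for k by (induction k) simp_all
      then show ?thesis using 1 by simp
    next
      case 2
      then obtain w where "x = Suc w" "w < n - 1" by (cases x) auto
      then show ?thesis using it prd_funpow_self[of "n - 1"] by simp
    next
      case 3
      then have "?g x = x" using n1 by (simp add: prd_def)
      then have "(?g ^^ k) x = x" for k by (induction k) simp_all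
      then show ?thesis .
    qed
  qed
  then have "?g ^^ (n - 1) = id" by auto
  moreover have "wperm (concat (replicate d ?e)) ^^ r = ?g ^^ (d * r)"
    unfolding wperm_concat_replicate e(3) by (simp only: funpow_mult)
  moreover have "d * r = n - 1" using n by (simp add: mult.commute)
  ultimately have "wperm (concat (replicate d ?e)) ^^ r = id" by simp
  then show ?thesis using ps eb by (intro summit_I) simp_all
qed

text \<open>Exponent sum and the order of the permutation are invariant under conjugation, so length
  one puts a conjugate into \<open>summit\<close>; the converse inclusion rests on
  \<open>summit_conjugate\<close>.\<close>

lemma super_summit_eq: "super_summit n (concat (replicate d (ddelta n @ band 2 1))) = belt n ` summit"
proof -
  let ?w = "concat (replicate d (ddelta n @ band 2 1))"
  have wY: "?w \<in> summit" by (rule eps_power_summit)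
  then have wb: "?w \<in> bwords n" and wr: "wperm ?w ^^ r = id" by (auto simp: summit_def)
  have conj: "x \<in> bwords n \<and> wexp x = int d * int n \<and> wperm x ^^ r = id" if x: "x \<in> conjugates n ?w" for x
  proof -
    obtain c where c: "c \<in> bwords n" "x = c @ ?w @ winv c" using x by (auto simp: conjugates_def)
    have i: "inv (inv (wperm c)) = wperm c" and b: "bij (inv (wperm c))"
      using wperm_permutes[OF c(1)] permutes_inv_inv permutes_inv permutes_bij by metis+
    have wx: "wperm x = inv (inv (wperm c)) \<circ> wperm ?w \<circ> inv (wperm c)"
      using c wperm_winv[OF c(1)] i by (simp add: comp_assoc)
    have "(inv (inv (wperm c)) \<circ> wperm ?w \<circ> inv (wperm c)) ^^ r
        = inv (inv (wperm c)) \<circ> wperm ?w ^^ r \<circ> inv (wperm c)"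
      by (rule inv_funpow_perm_conj[OF b])
    then have "wperm x ^^ r = id"
      unfolding wx wr i using permutes_inv_o(1)[OF wperm_permutes[OF c(1)]] by simp
    then show ?thesis using c wb summit_wexp[OF wY] by simp
  qed
  have wc: "?w \<in> conjugates n ?w"
  proof -
    have "?w = [] @ ?w @ winv []" by simp
    then show ?thesis unfolding conjugates_def using bwords_simps(1) by blast
  qed
  have least: "(LEAST m. \<exists>y \<in> conjugates n ?w. m = dlen n y) = 1"
  proof (rule Least_equality)
    show "\<exists>y \<in> conjugates n ?w. 1 = dlen n y" using wc summit_dlen[OF wY] by force
    show "1 \<le> m" if "\<exists>y \<in> conjugates n ?w. m = dlen n y" for m
      using that conj dlen_bounds(1) by blast
  qed
  show ?thesis
    unfolding super_summit_def least
  proof (intro equalityI subsetI)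
    fix X assume "X \<in> belt n ` {x \<in> conjugates n ?w. dlen n x = 1}"
    then obtain x where x: "x \<in> conjugates n ?w" "dlen n x = 1" "X = belt n x" by blast
    then show "X \<in> belt n ` summit" using conj[OF x(1)] dlen_1_summit[of x] by blast
  next
    fix X assume "X \<in> belt n ` summit"
    then obtain y where y: "y \<in> summit" "X = belt n y" by blast
    have yb: "y \<in> bwords n" using y by (simp add: summit_def)
    obtain c where c: "c \<in> bwords n" "val n y = val n c + val n ?w - val n c"
      using summit_conjugate[OF wY y(1)] by (auto simp: cnj_def)
    \<comment> \<open>The word \<open>y\<close> is conjugate only as a group element;
      \<open>?x\<close> is the literal conjugate in its class.\<close>
    let ?x = "c @ ?w @ winv c"
    have xc: "?x \<in> conjugates n ?w" using c(1) by (auto simp: conjugates_def)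
    have xb: "?x \<in> bwords n" and xe: "wexp ?x = int d * int n" using conj[OF xc] by auto
    have v: "val n ?x = val n y"
      using c(2) by (simp add: diff_conv_add_uminus add.assoc del: add_uminus_conv_diff)
    have "wexp y = int d * int n" by (rule summit_wexp[OF y(1)])
    then have "dlen n ?x = 1"
      using dlen_bounds(2)[OF xb xe] dlen_bounds(2)[OF yb] summit_dlen[OF y(1)] v
        dprec_iff[OF wpow_bwords[OF ddelta_bwords[OF n2]]] dprec_iff[OF _ wpow_bwords[OF ddelta_bwords[OF n2]]]
        xb yb by simp
    moreover have "belt n ?x = X" using belt_eq_iff[OF xb yb] v y(2) by simp
    ultimately show "X \<in> belt n ` {x \<in> conjugates n ?w. dlen n x = 1}" using xc by blast
  qed
qed

lemma card_super_summit:
  "card (super_summit n (concat (replicate d (ddelta n @ band 2 1)))) = n choose d"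
  unfolding super_summit_eq card_belt_summit card_rotperms ..

end

section \<open>Multichains\<close>

text \<open>Lists of words encode multichains as well as permutations, neither uniquely; for equal
  counts it is enough that both encodings identify the same lists.\<close>

lemma card_image_same_kernel:
  assumes "\<And>x y. x \<in> A \<Longrightarrow> y \<in> A \<Longrightarrow> f x = f y \<longleftrightarrow> h x = h y"
  shows "card (f ` A) = card (h ` A)"
proof -
  let ?k = "\<lambda>X. h (SOME x. x \<in> A \<and> f x = X)"
  have some: "(SOME z. z \<in> A \<and> f z = f x) \<in> A \<and> f (SOME z. z \<in> A \<and> f z = f x) = f x"
    if "x \<in> A" for x
    by (rule someI[of _ x]) (use that in simp)
  then have k: "?k (f x) = h x" if "x \<in> A" for x using that assms by blast
  have "bij_betw ?k (f ` A) (h ` A)"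
  proof (rule bij_betw_imageI)
    show "inj_on ?k (f ` A)"
    proof (rule inj_onI, elim imageE)
      fix X X' x x' assume "?k X = ?k X'" "X = f x" "x \<in> A" "X' = f x'" "x' \<in> A"
      then show "X = X'" using k assms by metis
    qed
    show "?k ` f ` A = h ` A" unfolding image_image by (rule image_cong) (simp_all add: k)
  qed
  then show ?thesis by (rule bij_betw_same_card)
qed

text \<open>In a shortest factorisation the first letter splits a cycle of the product, so its two
  points share a cycle and neither is fixed. This confines the letters of a multichain to the first
  \<open>d\<close> points.\<close>

lemma shortest_transps_fixed:
  assumes "finite S" "transps_on S ts" "length ts + ncyc S (apply_transps ts) = card S"
    "apply_transps ts x = x"
  shows "transps_on (S - {x}) ts"
  using assms(2-)
proof (induction ts)
  case (Cons t ts)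
  obtain a b where t: "t = (a, b)" by force
  have ab: "a \<in> S" "b \<in> S" "a \<noteq> b" and ts: "transps_on S ts" using Cons.prems(1) t by auto
  let ?p = "apply_transps (t # ts)" and ?u = "apply_transps ts"
  have p: "?p permutes S" by (rule transps_on_permutes[OF Cons.prems(1)])
  have up: "?u permutes S" by (rule transps_on_permutes[OF ts])
  have u: "transpose a b \<circ> ?p = ?u" using t by (simp add: comp_assoc[symmetric])
  have ge: "card S \<le> ncyc S ?u + length ts" by (rule card_le_ncyc_transps[OF assms(1) ts])
  have len: "length (t # ts) = Suc (length ts)" by simp
  have orb: "b \<in> orbit ?p a"
  proof (rule ccontr)
    assume "b \<notin> orbit ?p a"
    then have "ncyc S ?p = Suc (ncyc S ?u)"
      using ncyc_merge_left[OF assms(1) p ab(1,2)] unfolding u by simp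
    then show False using ge Cons.prems(2) len by linarith
  qed
  then have nc: "ncyc S ?u = Suc (ncyc S ?p)"
    using ncyc_split_left[OF assms(1) p ab] unfolding u by simp
  have ox: "orbit ?p x = {x}" using Cons.prems(3) by (simp only: orbit_eq_singleton_iff)
  have xa: "x \<noteq> a" using orb ox ab(3) by auto
  have "permutation ?p" using p assms(1) permutation_permutes by blast
  then have "a \<in> orbit ?p b" using orb orbit_swap permutation_self_in_orbit by metis
  then have xb: "x \<noteq> b" using ox ab(3) by auto
  have "?u x = x" using fun_cong[OF u, of x] Cons.prems(3) xa xb by simp
  moreover have "length ts + ncyc S ?u = card S" using nc Cons.prems(2) len by linarith
  ultimately have "transps_on (S - {x}) ts" using Cons.IH ts by blast
  then show ?case using t ab xa xb by auto
qed simp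

lemma prd_extend:
  "m \<le> N \<Longrightarrow> prd m \<circ> apply_transps (map (\<lambda>k. (0, k)) [m..<N]) = prd N"
proof (induction N)
  case (Suc N)
  show ?case
  proof (cases "m \<le> N")
    case True
    then have "prd m \<circ> apply_transps (map (\<lambda>k. (0, k)) [m..<N]) = prd N" by (rule Suc.IH)
    then have "prd m \<circ> apply_transps (map (\<lambda>k. (0, k)) [m..<N]) \<circ> transpose 0 N = prd (Suc N)"
      by (simp only: prd_Suc)
    moreover have "apply_transps (map (\<lambda>k. (0, k)) [m..<Suc N])
        = apply_transps (map (\<lambda>k. (0, k)) [m..<N]) \<circ> transpose 0 N"
      using True by (simp only: upt_Suc if_True map_append apply_transps_append list.map apply_transps_Cons apply_transps_Nil fst_conv snd_conv comp_id)
    ultimately show ?thesis by (simp only: comp_assoc)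
  next
    case False
    then have "m = Suc N" using Suc.prems by simp
    then show ?thesis by simp
  qed
qed simp

context eps_power
begin

text \<open>Each entry factorises the quotient of two neighbours in a multichain, both ends
  included: \<open>r\<close> quotients for \<open>r - 1\<close> inner elements, which are recovered
  as partial products.\<close>

definition chain_words :: "(nat \<times> nat) list list set" where
  "chain_words = {pss. length pss = r \<and> transps_on {..<d} (concat pss) \<and> length (concat pss) = d - 1
     \<and> apply_transps (concat pss) = prd d}"

definition prefix_perm :: "(nat \<times> nat) list list \<Rightarrow> nat \<Rightarrow> nat \<Rightarrow> nat" where
  "prefix_perm pss j = apply_transps (concat (take j pss))"

lemma d_le_n: "d \<le> n"
  using d_less by simp

lemma transps_on_mono: "transps_on S ts \<Longrightarrow> S \<subseteq> T \<Longrightarrow> transps_on T ts"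
  by (auto simp: transps_on_def)

lemma chain_words_split:
  assumes "pss \<in> chain_words"
  shows "transps_on {..<d} (concat (take j pss))" "transps_on {..<d} (concat (drop j pss))"
    "concat (take j pss) @ concat (drop j pss) = concat pss"
proof -
  show eq: "concat (take j pss) @ concat (drop j pss) = concat pss"
    by (simp flip: concat_append)
  have "transps_on {..<d} (concat (take j pss) @ concat (drop j pss))"
    unfolding eq using assms by (simp add: chain_words_def)
  then show "transps_on {..<d} (concat (take j pss))" "transps_on {..<d} (concat (drop j pss))"
    by simp_all
qed

lemma chain_words_prefix_n: "pss \<in> chain_words \<Longrightarrow> transps_on {..<n} (concat (take j pss))"
  using chain_words_split(1) transps_on_mono[of "{..<d}" _ "{..<n}"] d_le_n by (meson lessThan_subset_iff)

text \<open>The remaining quotients, followed by the letters \<open>(0, k)\<close> that enlarge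
  \<open>prd d\<close> to \<open>prd n\<close>, complete a partial product to the full
  cycle.\<close>

lemma chain_words_complement:
  assumes "pss \<in> chain_words"
  shows "\<exists>v. transps_on {..<n} v \<and> length (concat (take j pss)) + length v + 1 = n
    \<and> apply_transps (concat (take j pss) @ v) = prd n"
proof -
  let ?x = "map (\<lambda>k. (0, k)) [d..<n]"
  let ?v = "concat (drop j pss) @ ?x"
  have "transps_on {..<n} ?x" using d d_less by (auto simp: transps_on_def)
  then have "transps_on {..<n} ?v"
    using chain_words_split(2)[OF assms] transps_on_mono[of "{..<d}" _ "{..<n}"] d_le_n by simp
  moreover have "length (concat pss) = length (concat (take j pss)) + length (concat (drop j pss))"
    using chain_words_split(3)[OF assms, of j] by (metis length_append)
  moreover have "length (concat pss) = d - 1" "length ?v = length (concat (drop j pss)) + (n - d)"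
    using assms by (simp_all add: chain_words_def)
  ultimately have "transps_on {..<n} ?v" "length (concat (take j pss)) + length ?v + 1 = n"
    using d d_le_n by linarith+
  moreover have "apply_transps (concat (take j pss) @ ?v) = apply_transps (concat pss @ ?x)"
    using chain_words_split(3)[OF assms, of j] by (metis append_assoc)
  then have "apply_transps (concat (take j pss) @ ?v) = prd n"
    using assms prd_extend[OF d_le_n] by (simp add: chain_words_def)
  ultimately show ?thesis by blast
qed

lemma chain_words_bsum_iff:
  assumes "pss \<in> chain_words" "qss \<in> chain_words"
  shows "bsum (concat (take j pss)) = bsum (concat (take j qss))
    \<longleftrightarrow> prefix_perm pss j = prefix_perm qss j"
proof
  let ?u = "concat (take j pss)" and ?u' = "concat (take j qss)"
  note u = chain_words_prefix_n[OF assms(1), of j] and u' = chain_words_prefix_n[OF assms(2), of j]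
  assume "bsum ?u = bsum ?u'"
  then have "val n (wd ?u) = val n (wd ?u')" using wd_props(2)[OF u] wd_props(2)[OF u'] by simp
  then have "wperm (wd ?u) = wperm (wd ?u')" 
    by (rule wperm_val[OF wd_props(1)[OF u] wd_props(1)[OF u']])
  then show "prefix_perm pss j = prefix_perm qss j"
    unfolding prefix_perm_def using wd_props(3)[OF u] wd_props(3)[OF u'] by simp
next
  let ?u = "concat (take j pss)" and ?u' = "concat (take j qss)"
  note u = chain_words_prefix_n[OF assms(1), of j] and u' = chain_words_prefix_n[OF assms(2), of j]
  assume pp: "prefix_perm pss j = prefix_perm qss j"
  obtain v where v: "transps_on {..<n} v" "length ?u + length v + 1 = n" "apply_transps (?u @ v) = prd n"
    using chain_words_complement[OF assms(1)] by blast
  obtain v' where v': "transps_on {..<n} v'" "length ?u' + length v' + 1 = n"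
    "apply_transps (?u' @ v') = prd n"
    using chain_words_complement[OF assms(2)] by blast
  have n1: "ncyc {..<n} (prd n) = 1" using n2 by (intro ncyc_prd) simp
  \<comment> \<open>The length of a shortest factorisation depends only on the permutation, so the
    two prefixes have equally many letters.\<close>
  have "ncyc {..<n} (apply_transps ?u) + length ?u = n"
    using ncyc_exact[of "{..<n}" ?u v] u v n1 by simp
  moreover have "ncyc {..<n} (apply_transps ?u') + length ?u' = n"
    using ncyc_exact[of "{..<n}" ?u' v'] u' v' n1 by simp
  ultimately have "length ?u = length ?u'" using pp by (simp add: prefix_perm_def)
  then show "bsum ?u = bsum ?u'"
    using bsum_transps_unique[OF u u' _ _ v] pp by (simp add: prefix_perm_def)
qed

lemma chain_words_dlt:
  assumes "pss \<in> chain_words"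
  shows "bsum (concat pss) = dlt d"
  using bsum_reduced_prd[of d "ordered (concat pss)"] assms d_le_n by (simp add: chain_words_def ord_on_ordered)

definition chain_of :: "(nat \<times> nat) list list \<Rightarrow> bword set list" where
  "chain_of pss = map (\<lambda>j. belt n (wd (concat (take j pss)))) [1..<r]"

lemma bracket_upt: "bracket [1..<d + 1] = ddelta d"
proof -
  have b: "band (Suc (Suc k)) (Suc k) = [(Suc k, True)]" for k by (rule band_base)
  have "map (\<lambda>k. band ([1..<d + 1] ! (k + 1)) ([1..<d + 1] ! k)) [0..<length [1..<d + 1] - 1]
      = map (\<lambda>k. [(Suc k, True)]) [0..<d - 1]"
    by (rule map_cong) (auto simp: b nth_upt simp del: upt_Suc)
  then have "bracket [1..<d + 1] = concat (map (\<lambda>k. [(Suc k, True)]) (rev [0..<d - 1]))"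
    by (simp add: bracket_def rev_map)
  also have "\<dots> = map (\<lambda>k. (Suc k, True)) (rev [0..<d - 1])" by (induction d) simp_all
  also have "\<dots> = map (\<lambda>k. (k, True)) (rev (map Suc [0..<d - 1]))" by (simp add: rev_map)
  also have "map Suc [0..<d - 1] = [1..<d]" using d by (simp add: map_Suc_upt)
  finally show ?thesis by (simp add: ddelta_def)
qed

lemma eprec_belt:
  assumes "u \<in> bwords n" "v \<in> bwords n"
  shows "eprec n (belt n u) (belt n v) \<longleftrightarrow> (\<exists>k x. pos k x \<and> val n v = val n u + x)"
proof
  assume "eprec n (belt n u) (belt n v)"
  then obtain a b where ab: "a \<in> bwords n" "beq n u a" "b \<in> bwords n" "beq n v b" "dprec n a b"
    by (auto simp: eprec_def belt_def)
  then have "val n u = val n a" "val n v = val n b" by (auto dest: val_beq)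
  then show "\<exists>k x. pos k x \<and> val n v = val n u + x"
    using ab(5) dprec_pos[OF n2 ab(1,3)] by simp
next
  assume "\<exists>k x. pos k x \<and> val n v = val n u + x"
  then have "dprec n u v" using dprec_pos[OF n2 assms] by simp
  moreover have "u \<in> belt n u" "v \<in> belt n v" using assms by (auto simp: belt_def beq_refl)
  ultimately show "eprec n (belt n u) (belt n v)" by (auto simp: eprec_def)
qed

lemma multichain_nth:
  assumes "length as = r - 1"
  shows "successively R (x # as @ [y]) \<longleftrightarrow> (\<forall>j < r. R ((x # as @ [y]) ! j) ((x # as @ [y]) ! Suc j))"
proof -
  have "length (x # as @ [y]) = Suc r" using assms r by simp
  then show ?thesis by (simp add: successively_conv_nth)
qed

lemma chain_of_multichain:
  assumes "pss \<in> chain_words"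
  shows "chain_of pss \<in> multichains n r (ddelta d)"
proof -
  let ?w = "\<lambda>j. wd (concat (take j pss))"
  have len: "length pss = r" using assms by (simp add: chain_words_def)
  note w = wd_props[OF chain_words_prefix_n[OF assms]]
  have list: "belt n [] # chain_of pss @ [belt n (ddelta d)] = map (\<lambda>j. belt n (?w j)) [0..<Suc r]"
  proof -
    have "wd [] = []" by (simp add: wd_def bwd_def ordered_def)
    then have "belt n [] = belt n (?w 0)" by simp
    moreover have "belt n (ddelta d) = belt n (?w r)"
      using belt_eq_iff[OF _ w(1)[of r]] ddelta_props[of d n] d_le_n w(2)[of r] chain_words_dlt[OF assms] len
      by simp
    moreover have "[0..<Suc r] = 0 # [1..<r] @ [r]"
      using r by (simp add: upt_conv_Cons)
    ultimately show ?thesis by (simp add: chain_of_def)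
  qed
  have nth: "(map (\<lambda>j. belt n (?w j)) [0..<Suc r]) ! j = belt n (?w j)" if "j \<le> r" for j
    using that by (simp add: nth_map_upt del: upt_Suc)
  have step: "eprec n (belt n (?w j)) (belt n (?w (Suc j)))" if "j < r" for j
  proof -
    have "concat (take (Suc j) pss) = concat (take j pss) @ pss ! j"
      using that len by (simp add: take_Suc_conv_app_nth)
    then have "bsum (concat (take (Suc j) pss)) = bsum (concat (take j pss)) + bsum (pss ! j)"
      "transps_on {..<n} (pss ! j)"
      using chain_words_prefix_n[OF assms, of "Suc j"] by simp_all
    then show ?thesis unfolding eprec_belt[OF w(1) w(1)] w(2) pos_def by blast
  qed
  have simple: "simple n (?w j)" for j
  proof -
    have "dprec n [] (?w j)"
      using dprec_pos[OF n2 _ w(1)] w(2) chain_words_prefix_n[OF assms, of j] unfolding pos_def by auto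
    moreover obtain v where v: "transps_on {..<n} v" "length (concat (take j pss)) + length v + 1 = n"
      "apply_transps (concat (take j pss) @ v) = prd n" using chain_words_complement[OF assms] by blast
    have "dl = bsum (concat (take j pss)) + bsum v"
      using bsum_transps_prd[of "concat (take j pss) @ v"] v chain_words_prefix_n[OF assms, of j] by simp
    then have "dprec n (?w j) (ddelta n)"
      using dprec_pos[OF n2 w(1) ddelta_bwords[OF n2]] w(2) v(1) val_ddelta[OF n2]
      unfolding pos_def by auto
    ultimately show ?thesis by (simp add: simple_def)
  qed
  have "length (chain_of pss) = r - 1" by (simp add: chain_of_def)
  moreover have "set (chain_of pss) \<subseteq> braid_group n" using w(1) by (auto simp: chain_of_def braid_group_def)
  moreover have "\<forall>A \<in> set (chain_of pss). \<exists>a \<in> A. simple n a"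
  proof
    fix A assume "A \<in> set (chain_of pss)"
    then obtain j where "A = belt n (?w j)" by (auto simp: chain_of_def)
    then have "?w j \<in> A" using w(1)[of j] by (simp add: belt_def beq_refl)
    then show "\<exists>a \<in> A. simple n a" using simple by blast
  qed
  moreover have "successively (eprec n) (belt n [] # chain_of pss @ [belt n (ddelta d)])"
    unfolding multichain_nth[OF \<open>length (chain_of pss) = r - 1\<close>] unfolding list
    using nth step by simp
  ultimately show ?thesis by (simp add: multichains_def)
qed

text \<open>The positive quotients of neighbours multiply to \<open>dlt d\<close>; exponent sum and
  permutation show that together they form a shortest factorisation of \<open>prd d\<close>.\<close>

lemma multichain_chain_of:
  assumes "as \<in> multichains n r (ddelta d)"
  shows "\<exists>pss \<in> chain_words. as = chain_of pss"
proof -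
  let ?E = "belt n [] # as @ [belt n (ddelta d)]"
  have as: "length as = r - 1" "set as \<subseteq> braid_group n"
    "\<And>j. j < r \<Longrightarrow> eprec n (?E ! j) (?E ! Suc j)"
    using assms multichain_nth[of as "eprec n"] by (auto simp: multichains_def)
  have lenE: "length ?E = Suc r" using as(1) r by simp
  have dd: "ddelta d \<in> bwords n" "val n (ddelta d) = dlt d" "wperm (ddelta d) = prd d"
    "wexp (ddelta d) = int (d - 1)" using ddelta_props[of d n] d_le_n by auto
  have "set ?E \<subseteq> belt n ` bwords n" using as(2) dd(1) by (auto simp: braid_group_def)
  then have "\<exists>w. w \<in> bwords n \<and> ?E ! j = belt n w" if "j \<le> r" for j
  proof -
    have "?E ! j \<in> set ?E" by (rule nth_mem) (use that lenE in simp)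
    then have "?E ! j \<in> belt n ` bwords n"
      using \<open>set ?E \<subseteq> belt n ` bwords n\<close> by (rule rev_subsetD)
    then show ?thesis by blast
  qed
  then obtain w where w: "\<And>j. j \<le> r \<Longrightarrow> w j \<in> bwords n" "\<And>j. j \<le> r \<Longrightarrow> ?E ! j = belt n (w j)"
    by metis
  have "\<exists>ps. transps_on {..<n} ps \<and> val n (w (Suc j)) = val n (w j) + bsum ps" if "j < r" for j
    using as(3)[OF that] that w(2)[of j] w(2)[of "Suc j"] eprec_belt[OF w(1) w(1), of j "Suc j"]
    unfolding pos_def by fastforce
  then obtain ps where ps: "\<And>j. j < r \<Longrightarrow> transps_on {..<n} (ps j)"
    "\<And>j. j < r \<Longrightarrow> val n (w (Suc j)) = val n (w j) + bsum (ps j)" by metis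
  let ?pss = "map ps [0..<r]"
  have take: "concat (take (Suc j) ?pss) = concat (take j ?pss) @ ps j" if "j < r" for j
    using that by (simp add: take_Suc_conv_app_nth)
  have w0: "val n (w 0) = 0"
    using w(2)[of 0] belt_eq_iff[of "[]" n "w 0"] w(1)[of 0] by simp
  have vw: "val n (w j) = bsum (concat (take j ?pss)) \<and> transps_on {..<n} (concat (take j ?pss))"
    if "j \<le> r" for j
    using that
  proof (induction j)
    case 0
    then show ?case using w0 by simp
  next
    case (Suc j)
    then show ?case using take[of j] ps[of j] by simp
  qed
  have wr: "val n (w r) = dlt d"
    using w(2)[of r] as(1) r belt_eq_iff[OF dd(1) w(1)[of r]] dd(2) by (simp add: nth_append nth_Cons')
  have T: "transps_on {..<n} (concat ?pss)" "bsum (concat ?pss) = dlt d" using vw[of r] wr by simp_all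
  have "val n (wd (concat ?pss)) = val n (ddelta d)" using wd_props(2)[OF T(1)] T(2) dd(2) by simp
  then have app: "apply_transps (concat ?pss) = prd d" and len: "length (concat ?pss) = d - 1"
    using wperm_val[OF wd_props(1)[OF T(1)] dd(1)] wexp_val[OF wd_props(1)[OF T(1)] dd(1)]
      wd_props(3,4)[OF T(1)] dd(3,4) by simp_all
  \<comment> \<open>\<open>prd d\<close> fixes every point from \<open>d\<close> on, so
    \<open>shortest_transps_fixed\<close> excludes these points from all letters.\<close>
  have Td: "transps_on {..<d} (concat ?pss)"
  proof -
    let ?x = "map (\<lambda>k. (0, k)) [d..<n]"
    have x: "transps_on {..<n} ?x" using d d_less by (auto simp: transps_on_def)
    have n1: "ncyc {..<n} (prd n) = 1" using n2 by (intro ncyc_prd) simp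
    have "ncyc {..<n} (apply_transps (concat ?pss)) + length (concat ?pss) = n"
      using ncyc_exact[of "{..<n}" "concat ?pss" ?x] T(1) x n1 app len prd_extend[OF d_le_n] d d_le_n
      by simp
    then have ty: "transps_on ({..<n} - {y}) (concat ?pss)" if "d \<le> y" for y
      using shortest_transps_fixed[OF _ T(1), of y] app that by (simp add: prd_def)
    have "a < d \<and> b < d \<and> a \<noteq> b" if ab: "(a, b) \<in> set (concat ?pss)" for a b
    proof -
      have ne: "a \<noteq> y \<and> b \<noteq> y \<and> a \<noteq> b" if "d \<le> y" for y
        using ty[OF that] ab by (fastforce simp only: transps_on_def)
      show ?thesis using ne[of a] ne[of b] ne[of d] by linarith
    qed
    then show ?thesis unfolding transps_on_def by (simp only: lessThan_iff) blast
  qed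
  have chain_words: "?pss \<in> chain_words" using Td len app by (simp add: chain_words_def)
  have "as ! i = chain_of ?pss ! i" if "i < r - 1" for i
  proof -
    have j: "Suc i \<le> r" using that by simp
    have "as ! i = ?E ! Suc i" using that as(1) by (simp add: nth_append)
    also have "\<dots> = belt n (w (Suc i))" by (rule w(2)[OF j])
    also have "\<dots> = belt n (wd (concat (take (Suc i) ?pss)))"
      using belt_eq_iff[OF w(1)[OF j] wd_props(1)] vw[OF j] wd_props(2) by simp
    also have "\<dots> = chain_of ?pss ! i" using that by (simp add: chain_of_def)
    finally show ?thesis .
  qed
  then have "as = chain_of ?pss"
    using as(1) by (intro nth_equalityI) (simp_all add: chain_of_def)
  then show ?thesis using chain_words by blast
qed

lemma chain_of_eq_iff:
  assumes "pss \<in> chain_words" "qss \<in> chain_words"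
  shows "chain_of pss = chain_of qss \<longleftrightarrow> (\<forall>j \<in> {1..<r}. prefix_perm pss j = prefix_perm qss j)"
proof -
  have "belt n (wd (concat (take j pss))) = belt n (wd (concat (take j qss)))
      \<longleftrightarrow> prefix_perm pss j = prefix_perm qss j" for j
    using belt_eq_iff[OF wd_props(1) wd_props(1)] chain_words_prefix_n[OF assms(1)] chain_words_prefix_n[OF assms(2)]
      wd_props(2) chain_words_bsum_iff[OF assms] by simp
  then show ?thesis by (simp add: chain_of_def)
qed

end

section \<open>Multichains as summit permutations that fix 0\<close>

lemma transps_on_map_inj:
  assumes "inj_on f S" "transps_on S ts"
  shows "transps_on (f ` S) (map (map_prod f f) ts)"
  using assms(2)
proof (induction ts)
  case (Cons t ts)
  obtain a b where t: "t = (a, b)" by force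
  then have "a \<in> S" "b \<in> S" "f a \<noteq> f b" using Cons.prems assms(1) by (auto dest: inj_onD)
  then show ?case using Cons t by simp
qed simp

lemma apply_transps_map_inj:
  assumes "inj f"
  shows "apply_transps (map (map_prod f f) ts) (f x) = f (apply_transps ts x)"
  using fun_cong[OF comp_apply_transps[OF assms, of ts], of x] by simp

lemma apply_transps_other: "transps_on S ts \<Longrightarrow> x \<notin> S \<Longrightarrow> apply_transps ts x = x"
  using transps_on_permutes permutes_not_in by metis

context eps_power
begin

definition emb :: "nat \<Rightarrow> nat \<Rightarrow> nat" where
  "emb j i = d * j + 1 + i"

lemma emb_inj: "inj (emb j)"
  by (simp add: inj_def emb_def)

lemma emb_eq_iff:
  assumes "i < d" "i' < d"
  shows "emb j i = emb j' i' \<longleftrightarrow> j = j' \<and> i = i'"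
proof
  assume e: "emb j i = emb j' i'"
  then have "(d * j + i) div d = (d * j' + i') div d" by (simp add: emb_def)
  then have "j = j'" using assms by simp
  then show "j = j' \<and> i = i'" using e by (simp add: emb_def)
qed simp

lemma lev_emb: "i < d \<Longrightarrow> lev (emb j i) = j"
  by (simp add: lev_def emb_def)

lemma emb_cases:
  assumes "0 < v" "v < n"
  obtains j i where "j < r" "i < d" "v = emb j i"
proof
  show "lev v < r" using assms by (rule lev_less)
  show "(v - 1) mod d < d" using d by simp
  show "v = emb (lev v) ((v - 1) mod d)" using assms(1) by (simp add: emb_def lev_def)
qed

lemma emb_less:
  assumes "j < r" "i < d"
  shows "emb j i < n"
proof -
  have "d * (j + 1) \<le> d * r" using assms(1) by (intro mult_le_mono2) simp
  then show ?thesis using assms(2) n by (simp add: emb_def mult.commute)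
qed

text \<open>On disjoint blocks the quotients no longer interfere, so each of them can be read off
  from the product.\<close>

definition rho :: "(nat \<times> nat) list list \<Rightarrow> (nat \<times> nat) list" where
  "rho pss = concat (map (\<lambda>j. map (map_prod (emb j) (emb j)) (pss ! j)) [0..<length pss])"

lemma rho_emb:
  assumes "\<forall>ps \<in> set pss. transps_on {..<d} ps" "j < length pss" "i < d"
  shows "apply_transps (rho pss) (emb j i) = emb j (apply_transps (pss ! j) i)"
proof -
  let ?e = "\<lambda>k. map (map_prod (emb k) (emb k)) (pss ! k)"
  have pk: "transps_on {..<d} (pss ! k)" if "k < length pss" for k using assms(1) that by simp
  have fix_other: "apply_transps (?e k) (emb l x) = emb l x"
    if "k < length pss" "k \<noteq> l" "x < d" for k l x
  proof (rule apply_transps_other)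
    show "transps_on (emb k ` {..<d}) (?e k)"
      by (rule transps_on_map_inj[OF inj_on_subset[OF emb_inj] pk[OF that(1)]]) simp
    show "emb l x \<notin> emb k ` {..<d}"
    proof
      assume "emb l x \<in> emb k ` {..<d}"
      then obtain x' where "x' < d" "emb l x = emb k x'" by auto
      then show False using emb_eq_iff[of x x' l k] that by simp
    qed
  qed
  have pi: "apply_transps (pss ! j) i < d"
    using permutes_in_image[OF transps_on_permutes[OF pk[OF assms(2)]], of i] assms(3) by simp
  have fixs: "apply_transps (concat (map ?e ks)) (emb j x) = emb j x"
    if "set ks \<subseteq> {..<length pss} - {j}" "x < d" for ks x
    using that(1)
  proof (induction ks)
    case (Cons k ks)
    then have "apply_transps (concat (map ?e ks)) (emb j x) = emb j x" by simp
    then show ?case using fix_other[of k j x] Cons.prems that(2) by simp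
  qed simp
  have "[0..<length pss] = [0..<j] @ j # [Suc j..<length pss]"
    using assms(2) by (metis le0 less_imp_le_nat upt_add_eq_append upt_conv_Cons add_diff_inverse_nat not_less zero_le)
  then have "rho pss = concat (map ?e [0..<j]) @ ?e j @ concat (map ?e [Suc j..<length pss])"
    by (simp add: rho_def)
  then have "apply_transps (rho pss) (emb j i) = apply_transps (concat (map ?e [0..<j]))
      (apply_transps (?e j) (apply_transps (concat (map ?e [Suc j..<length pss])) (emb j i)))"
    by simp
  also have "apply_transps (concat (map ?e [Suc j..<length pss])) (emb j i) = emb j i"
    by (rule fixs) (use assms(3) in auto)
  also have "apply_transps (?e j) (emb j i) = emb j (apply_transps (pss ! j) i)"
    by (rule apply_transps_map_inj[OF emb_inj])
  also have "apply_transps (concat (map ?e [0..<j])) (emb j (apply_transps (pss ! j) i))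
      = emb j (apply_transps (pss ! j) i)"
    by (rule fixs) (use pi assms(2) in auto)
  finally show ?thesis .
qed

lemma rho_transps:
  assumes "\<forall>ps \<in> set pss. transps_on {..<d} ps" "length pss = r"
  shows "transps_on {1..<n} (rho pss)" "length (rho pss) = length (concat pss)"
proof -
  have "transps_on {1..<n} (map (map_prod (emb j) (emb j)) (pss ! j))" if "j < r" for j
  proof (rule transps_on_mono)
    have "transps_on {..<d} (pss ! j)" using assms that by simp
    then show "transps_on (emb j ` {..<d}) (map (map_prod (emb j) (emb j)) (pss ! j))"
      by (intro transps_on_map_inj inj_on_subset[OF emb_inj]) simp
    show "emb j ` {..<d} \<subseteq> {1..<n}" using emb_less[OF that] by (auto simp: emb_def)
  qed
  then show "transps_on {1..<n} (rho pss)"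
    unfolding transps_on_def rho_def assms(2) by (auto simp del: map_map)
  have "length (rho pss) = sum_list (map (\<lambda>j. length (pss ! j)) [0..<length pss])"
    by (simp add: rho_def length_concat comp_def)
  also have "map (\<lambda>j. length (pss ! j)) [0..<length pss] = map length pss"
    by (rule nth_equalityI) simp_all
  finally show "length (rho pss) = length (concat pss)" by (simp add: length_concat)
qed

text \<open>The quotients of a multichain act on consecutive blocks of \<open>d\<close> points, \<open>emb j\<close> numbering the
  \<open>j\<close>-th block; the point \<open>0\<close> is fixed in the end.\<close>

definition rot_of :: "(nat \<times> nat) list list \<Rightarrow> nat \<Rightarrow> nat" where
  "rot_of pss = C \<circ> apply_transps ((0, d) # rho pss)"

text \<open>Below \<open>d\<close>, the inverse of \<open>prd d\<close>. It arises when the lowest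
  block is carried to the top one: as \<open>n = r * d + 1\<close>, this passage shifts the block
  cyclically by one place.\<close>

definition sucd :: "nat \<Rightarrow> nat" where
  "sucd i = (if i + 1 < d then i + 1 else 0)"

lemma prd_sucd: "i < d \<Longrightarrow> prd d (sucd i) = i" "i < d \<Longrightarrow> sucd i < d"
  using d by (auto simp: prd_def sucd_def)

lemma sucd_prd: "i < d \<Longrightarrow> sucd (prd d i) = i"
  by (auto simp: prd_def sucd_def)

text \<open>\<open>C\<close> sends \<open>d\<close> to \<open>0\<close>; the letter
  \<open>(0, d)\<close> hands this role to the point \<open>0\<close>, which becomes fixed, and
  sends \<open>d\<close> to the first place of the top block instead.\<close>

lemma C_transpose_emb:
  assumes "j < r" "i < d"
  shows "C (transpose 0 d (emb j i)) = (if j = 0 then emb (r - 1) (sucd i) else emb (j - 1) i)"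
proof (cases "j = 0")
  case False
  then obtain k where k: "j = Suc k" by (cases j) auto
  have "emb j i = emb k i + d" by (simp add: emb_def k)
  moreover have "emb k i > 0" by (simp add: emb_def)
  ultimately show ?thesis using C_apply[OF emb_less[OF assms]] k by simp
next
  case True
  have nd: "n - d = d * (r - 1) + 1" using n r d by (cases r) (simp_all add: mult.commute)
  show ?thesis
  proof (cases "i + 1 < d")
    case True
    then have "transpose 0 d (emb j i) = i + 1" using \<open>j = 0\<close> by (simp add: emb_def)
    moreover have "C (i + 1) = i + 1 + (n - d)" using C_apply[of "i + 1"] True d_le_n by simp
    ultimately show ?thesis using \<open>j = 0\<close> True nd by (simp add: emb_def sucd_def)
  next
    case False
    then have "emb j i = d" using \<open>j = 0\<close> assms by (simp add: emb_def)
    moreover have "C 0 = n - d" using C_apply[of 0] d n_pos by simp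
    ultimately show ?thesis using \<open>j = 0\<close> False nd by (simp add: emb_def sucd_def)
  qed
qed

context
  fixes pss :: "(nat \<times> nat) list list"
  assumes pss: "length pss = r" "\<forall>ps \<in> set pss. transps_on {..<d} ps"
begin

lemma level_perm_less:
  "j < r \<Longrightarrow> i < d \<Longrightarrow> apply_transps (pss ! j) i < d"
  using permutes_in_image[OF transps_on_permutes, of "{..<d}" "pss ! j" i] pss by simp

lemma rot_of_emb:
  assumes "j < r" "i < d"
  shows "rot_of pss (emb j i) = (if j = 0 then emb (r - 1) (sucd (apply_transps (pss ! 0) i))
    else emb (j - 1) (apply_transps (pss ! j) i))"
  using rho_emb[OF pss(2), of j i] assms pss(1) C_transpose_emb[OF assms(1) level_perm_less[OF assms]]
  by (simp add: rot_of_def)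

lemma rot_of_0: "rot_of pss 0 = 0"
proof -
  have "apply_transps (rho pss) 0 = 0"
    by (rule apply_transps_other[OF rho_transps(1)[OF pss(2,1)]]) simp
  then show ?thesis using C_apply[of d] d_less by (simp add: rot_of_def)
qed

lemma rot_of_word: "transps_on {..<n} ((0, d) # rho pss)"
proof -
  have "transps_on {..<n} (rho pss)"
    by (rule transps_on_mono[OF rho_transps(1)[OF pss(2,1)]]) auto
  moreover have "d < n" using d_less by linarith
  ultimately show ?thesis using d by simp
qed

lemma rot_of_permutes: "rot_of pss permutes {..<n}"
  unfolding rot_of_def by (rule permutes_compose[OF transps_on_permutes[OF rot_of_word] C_permutes])

lemma drop_less: "i < d \<Longrightarrow> apply_transps (concat (drop j pss)) i < d"
proof -
  assume i: "i < d"
  have "transps_on {..<d} (concat (drop j pss))"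
    using pss(2) by (auto simp: transps_on_def dest: in_set_dropD)
  then show ?thesis using permutes_in_image[OF transps_on_permutes, of "{..<d}" _ i] i by simp
qed

lemma rot_of_funpow:
  assumes "i < d" "k < r"
  shows "(rot_of pss ^^ k) (emb (r - 1) i)
    = emb (r - 1 - k) (apply_transps (concat (drop (r - k) pss)) i)"
  using assms(2)
proof (induction k)
  case 0
  then show ?case using pss(1) by simp
next
  case (Suc k)
  let ?x = "apply_transps (concat (drop (r - k) pss)) i"
  have x: "?x < d" by (rule drop_less[OF assms(1)])
  have j: "r - 1 - k < r" "r - 1 - k \<noteq> 0" "r - 1 - k = r - Suc k" using Suc.prems by auto
  have "drop (r - Suc k) pss = pss ! (r - Suc k) # drop (r - k) pss"
    using Suc.prems pss(1) by (simp add: Cons_nth_drop_Suc[symmetric] Suc_diff_Suc)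
  then have "apply_transps (concat (drop (r - Suc k) pss)) i = apply_transps (pss ! (r - Suc k)) ?x"
    by simp
  then show ?case using Suc rot_of_emb[OF j(1) x] j by simp
qed

text \<open>The orbit passes all blocks from the top to the lowest, collecting the quotients in the
  order of their product; the return to the top block contributes \<open>sucd\<close>.\<close>

lemma rot_of_funpow_r:
  assumes "i < d"
  shows "(rot_of pss ^^ r) (emb (r - 1) i) = emb (r - 1) (sucd (apply_transps (concat pss) i))"
proof -
  have r1: "r = Suc (r - 1)" using r by simp
  let ?x = "apply_transps (concat (drop 1 pss)) i"
  have "(rot_of pss ^^ r) (emb (r - 1) i) = rot_of pss ((rot_of pss ^^ (r - 1)) (emb (r - 1) i))"
    using r1 by (metis comp_apply funpow.simps(2))
  also have "\<dots> = rot_of pss (emb 0 ?x)" using rot_of_funpow[OF assms, of "r - 1"] r by simp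
  also have "\<dots> = emb (r - 1) (sucd (apply_transps (pss ! 0) ?x))"
    using rot_of_emb[OF _ drop_less[OF assms, of 1], of 0] r by simp
  also have "apply_transps (pss ! 0) ?x = apply_transps (concat pss) i"
    using pss(1) r by (cases pss) simp_all
  finally show ?thesis .
qed

text \<open>By \<open>rot_of_funpow_r\<close>, the power is trivial on the top block exactly when
  \<open>sucd\<close> cancels the product of all quotients, that is, when this product is
  \<open>prd d\<close>.\<close>

lemma rot_of_order:
  "rot_of pss ^^ r = id \<longleftrightarrow> (\<forall>i < d. apply_transps (concat pss) i = prd d i)"
proof
  assume id: "rot_of pss ^^ r = id"
  show "\<forall>i < d. apply_transps (concat pss) i = prd d i"
  proof (intro allI impI)
    fix i assume i: "i < d"
    let ?x = "apply_transps (concat pss) i"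
    have x: "?x < d" using drop_less[OF i, of 0] by simp
    have "emb (r - 1) (sucd ?x) = emb (r - 1) i" using rot_of_funpow_r[OF i] id by simp
    then have "sucd ?x = i" using emb_eq_iff[OF prd_sucd(2)[OF x] i] by simp
    then show "?x = prd d i" using prd_sucd(1)[OF x] by simp
  qed
next
  assume prd: "\<forall>i < d. apply_transps (concat pss) i = prd d i"
  have top: "(rot_of pss ^^ r) (emb (r - 1) i) = emb (r - 1) i" if "i < d" for i
    using rot_of_funpow_r[OF that] prd that sucd_prd by simp
  have "(rot_of pss ^^ r) v = v" for v
  proof -
    consider "v = 0" | "0 < v" "v < n" | "n \<le> v" by linarith
    then show ?thesis
    proof cases
      case 1
      have "(rot_of pss ^^ k) 0 = 0" for k by (induction k) (simp_all add: rot_of_0)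
      then show ?thesis using 1 by simp
    next
      case 3
      have "rot_of pss v = v" using rot_of_permutes 3 by (simp add: permutes_not_in)
      then have "(rot_of pss ^^ k) v = v" for k by (induction k) simp_all
      then show ?thesis .
    next
      case 2
      then obtain j i where ji: "j < r" "i < d" "v = emb j i" by (rule emb_cases)
      \<comment> \<open>Every point of block \<open>j\<close> is reached from the top block after
        \<open>?k\<close> steps, and iterates commute.\<close>
      let ?k = "r - 1 - j"
      let ?D = "apply_transps (concat (drop (r - ?k) pss))"
      have "transps_on {..<d} (concat (drop (r - ?k) pss))"
        using pss(2) by (auto simp: transps_on_def dest: in_set_dropD)
      then have D: "?D permutes {..<d}" by (rule transps_on_permutes)
      then obtain i' where i': "?D i' = i" using permutes_surj by (metis surj_def)
      have "i' < d" using permutes_in_image[OF D, of i'] i' ji(2) by simp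
      then have v: "v = (rot_of pss ^^ ?k) (emb (r - 1) i')"
        using rot_of_funpow[of i' ?k] ji i' r by simp
      have "(rot_of pss ^^ r) v = (rot_of pss ^^ ?k) ((rot_of pss ^^ r) (emb (r - 1) i'))"
        unfolding v by (metis comp_apply funpow_add add.commute)
      then show ?thesis using top[OF \<open>i' < d\<close>] v by simp
    qed
  qed
  then show "rot_of pss ^^ r = id" by auto
qed

end

lemma chain_words_props:
  assumes "pss \<in> chain_words"
  shows "length pss = r" "\<forall>ps \<in> set pss. transps_on {..<d} ps"
  using assms by (auto simp: chain_words_def transps_on_def)

text \<open>The word has \<open>1 + (d - 1) = d\<close> letters, so
  \<open>rotation_complement\<close> applies and yields the number of cycles.\<close>

lemma rot_of_chain_words:
  assumes "pss \<in> chain_words"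
  shows "rot_of pss \<in> {g \<in> rotperms r d. g 0 = 0}"
proof -
  note p = chain_words_props[OF assms]
  have id: "rot_of pss ^^ r = id" using rot_of_order[OF p] assms by (simp add: chain_words_def)
  let ?ps = "(0, d) # rho pss"
  have len: "length ?ps = d" using rho_transps(2)[OF p(2,1)] assms d by (simp add: chain_words_def)
  obtain v where v: "transps_on {..<n} v" "length ?ps + length v + 1 = n"
    "apply_transps (?ps @ v) = prd n"
    using rotation_complement[OF rot_of_word[OF p] len] id unfolding rot_of_def by blast
  have "ncyc {..<n} (prd n) = 1" using n2 by (intro ncyc_prd) simp
  then have "ncyc {..<n} (apply_transps ?ps) + d = n"
    using ncyc_exact[OF _ rot_of_word[OF p] v(1)] v len by simp
  moreover have "inv C \<circ> rot_of pss = apply_transps ?ps" unfolding rot_of_def by (rule inv_C_comp)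
  ultimately show ?thesis
    using rot_of_permutes[OF p] rot_of_0[OF p] id n by (simp add: rotperms_def)
qed

text \<open>Removing the letter \<open>(0, d)\<close> from \<open>inv C \<circ> g\<close> leaves a
  permutation that fixes \<open>0\<close> and preserves every block, because \<open>g\<close> moves
  blocks to the previous one. Its restrictions to the blocks are the quotients.\<close>

lemma chain_words_rot_of:
  assumes g: "g \<in> rotperms r d" "g 0 = 0"
  shows "\<exists>pss \<in> chain_words. g = rot_of pss"
proof -
  have gp: "g permutes {..<n}" and nc: "ncyc {..<n} (inv C \<circ> g) + d = n" and gr: "g ^^ r = id"
    using g(1) n by (auto simp: rotperms_def)
  let ?pi = "inv C \<circ> g"
  let ?rho = "transpose 0 d \<circ> ?pi"
  have pp: "?pi permutes {..<n}" by (intro permutes_compose permutes_inv C_permutes gp)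
  have dn: "d < n" "0 \<noteq> d" using d_less d by auto
  have "C d = 0" using C_apply[OF dn(1)] by simp
  then have iC0: "inv C 0 = d" using permutes_inverses(2)[OF C_permutes] by metis
  have rp: "?rho permutes {..<n}"
    using dn by (intro permutes_compose[OF pp] permutes_swap_id) auto
  have r0: "?rho 0 = 0" using iC0 g(2) by simp
  have "d \<in> orbit ?pi 0" using orbit.base[of ?pi 0] iC0 g(2) by simp
  then have "ncyc {..<n} ?rho = Suc (ncyc {..<n} ?pi)"
    using dn by (intro ncyc_split_left pp) simp_all
  then have nrho: "ncyc {..<n} ?rho + d = n + 1" using nc by simp
  have lev_rho: "\<exists>i' < d. ?rho (emb j i) = emb j i'" if ji: "j < r" "i < d" for j i
  proof -
    let ?v = "emb j i"
    have v: "0 < ?v" "?v < n" using emb_less[OF ji] by (auto simp: emb_def)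
    note gl = rotperms_lev[OF g v]
    obtain k i' where ki: "k < r" "i' < d" "g ?v = emb k i'" using emb_cases[OF gl(1,2)] .
    have k: "(k + 1) mod r = j" using gl(3) ki lev_emb ji(2) by simp
    show ?thesis
    proof (cases "j = 0")
      case False
      then have kj: "j = k + 1" using k ki(1) by (cases "k + 1 = r") auto
      have "C (transpose 0 d (emb j i')) = emb k i'"
        using C_transpose_emb[OF ji(1) ki(2)] False kj by simp
      then have "inv C (g ?v) = transpose 0 d (emb j i')"
        unfolding ki(3) using permutes_inverses(2)[OF C_permutes] by metis
      then have "?rho ?v = emb j i'" by simp
      then show ?thesis using ki(2) by blast
    next
      case True
      then have kr: "k = r - 1" using k ki(1) by (cases "k + 1 = r") auto
      have "C (transpose 0 d (emb 0 (prd d i'))) = emb k i'"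
        using C_transpose_emb[of 0 "prd d i'"] r kr sucd_prd[OF ki(2)] ki(2) by (auto simp: prd_def)
      then have "inv C (g ?v) = transpose 0 d (emb 0 (prd d i'))"
        unfolding ki(3) using permutes_inverses(2)[OF C_permutes] by metis
      then have "?rho ?v = emb 0 (prd d i')" by simp
      moreover have "prd d i' < d" using ki(2) by (auto simp: prd_def)
      ultimately show ?thesis using True by blast
    qed
  qed
  define R where "R j i = (if i < d then ?rho (emb j i) - (d * j + 1) else i)" for j i
  have R: "R j i < d" "?rho (emb j i) = emb j (R j i)" if ji: "j < r" "i < d" for j i
  proof -
    obtain i' where i': "i' < d" "?rho (emb j i) = emb j i'" using lev_rho[OF ji] by blast
    then have "R j i = i'" using ji(2) by (simp add: R_def emb_def)
    then show "R j i < d" "?rho (emb j i) = emb j (R j i)" using i' by simp_all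
  qed
  have Rp: "R j permutes {..<d}" if j: "j < r" for j
  proof (rule inj_imp_permutes)
    show "inj_on (R j) {..<d}"
    proof (rule inj_onI)
      fix i i' assume i: "i \<in> {..<d}" "i' \<in> {..<d}" "R j i = R j i'"
      then have "?rho (emb j i) = ?rho (emb j i')" using R(2)[OF j] by simp
      then have "emb j i = emb j i'" using permutes_inj[OF rp] by (rule injD[rotated])
      then show "i = i'" by (simp add: emb_def)
    qed
  qed (use R(1)[OF j] in \<open>auto simp: R_def\<close>)
  have "\<exists>ps. transps_on {..<d} ps \<and> apply_transps ps = R j \<and> length ps + ncyc {..<d} (R j) = d"
    if "j < r" for j
    using transps_exist[OF finite_lessThan Rp[OF that]] by simp
  then obtain q where q: "\<And>j. j < r \<Longrightarrow> transps_on {..<d} (q j)"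
    "\<And>j. j < r \<Longrightarrow> apply_transps (q j) = R j"
    "\<And>j. j < r \<Longrightarrow> length (q j) + ncyc {..<d} (R j) = d" by metis
  let ?pss = "map q [0..<r]"
  have p: "length ?pss = r" "\<forall>ps \<in> set ?pss. transps_on {..<d} ps" using q(1) by auto
  have "apply_transps (rho ?pss) = ?rho"
  proof
    fix v
    consider "v = 0" | "0 < v" "v < n" | "n \<le> v" by linarith
    then show "apply_transps (rho ?pss) v = ?rho v"
    proof cases
      case 1
      have "apply_transps (rho ?pss) 0 = 0"
        by (rule apply_transps_other[OF rho_transps(1)[OF p(2,1)]]) simp
      then show ?thesis using r0 1 by simp
    next
      case 2
      then obtain j i where ji: "j < r" "i < d" "v = emb j i" by (rule emb_cases)
      then show ?thesis using rho_emb[OF p(2), of j i] q(2)[OF ji(1)] R(2)[OF ji(1,2)] by simp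
    next
      case 3
      have "apply_transps (rho ?pss) v = v"
        by (rule apply_transps_other[OF rho_transps(1)[OF p(2,1)]]) (use 3 in simp)
      then show ?thesis using permutes_not_in[OF rp, of v] 3 by simp
    qed
  qed
  then have "apply_transps ((0, d) # rho ?pss) = ?pi" by (simp add: comp_assoc[symmetric])
  then have g_eq: "g = rot_of ?pss" unfolding rot_of_def using inv_C_comp(2) by metis
  have "\<forall>i < d. apply_transps (concat ?pss) i = prd d i" using rot_of_order[OF p] gr g_eq by simp
  moreover have cp: "transps_on {..<d} (concat ?pss)" using p(2) by (auto simp: transps_on_def)
  ultimately have app: "apply_transps (concat ?pss) = prd d"
    using apply_transps_other[OF cp] by (fastforce simp: prd_def)
  have "length (concat ?pss) = d - 1"
  proof -
    \<comment> \<open>Counting cycles block by block gives the total length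
      \<open>r * d - (n - d) = d - 1\<close>.\<close>
    have sum: "ncyc {..<n} ?rho = 1 + (\<Sum>j<r. ncyc {..<d} (R j))"
    proof -
      let ?B = "\<lambda>j. emb j ` {..<d}"
      have U: "(\<Union>j\<in>{..<r}. ?B j) = {..<n} - {0}"
      proof (intro equalityI subsetI)
        fix v assume "v \<in> {..<n} - {0}"
        then have "0 < v" "v < n" by auto
        then show "v \<in> (\<Union>j\<in>{..<r}. ?B j)" by (rule emb_cases) auto
      qed (use emb_less in \<open>auto simp: emb_def\<close>)
      have "ncyc (\<Union>j\<in>{..<r}. ?B j) ?rho = (\<Sum>j\<in>{..<r}. ncyc (?B j) ?rho)"
      proof (rule ncyc_disjoint_UN)
        show "?rho x \<in> ?B j" if "j \<in> {..<r}" "x \<in> ?B j" for j x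
          using that R by auto
        show "?B i \<inter> ?B j = {}" if "i \<noteq> j" for i j
          using that emb_eq_iff by auto
      qed simp_all
      moreover have "ncyc (?B j) ?rho = ncyc {..<d} (R j)" if "j < r" for j
        by (rule ncyc_image[OF finite_lessThan Rp[OF that] inj_on_subset[OF emb_inj]])
          (use R(2)[OF that] in auto)
      moreover have "ncyc {..<n} ?rho = Suc (ncyc ({..<n} - {0}) ?rho)"
      proof -
        have "?rho permutes ({..<n} - {0})"
          by (rule permutes_superset[OF rp]) (use r0 in auto)
        then have "ncyc (insert 0 ({..<n} - {0})) ?rho = Suc (ncyc ({..<n} - {0}) ?rho)"
          by (intro ncyc_insert_fixpoint) simp_all
        moreover have "insert 0 ({..<n} - {0}) = {..<n}" using n_pos by auto
        ultimately show ?thesis by simp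
      qed
      ultimately show ?thesis unfolding U by simp
    qed
    have "length (concat ?pss) = (\<Sum>j<r. length (q j))"
      by (simp add: length_concat comp_def sum_list_sum_nth atLeast0LessThan)
    moreover have "(\<Sum>j<r. length (q j)) + (\<Sum>j<r. ncyc {..<d} (R j)) = r * d"
      unfolding sum.distrib[symmetric] using q(3) by simp
    ultimately show ?thesis using sum nrho n by simp
  qed
  then have "?pss \<in> chain_words" using p(1) cp app by (simp add: chain_words_def)
  then show ?thesis using g_eq by blast
qed

text \<open>Each quotient is visible on its own block, and quotients and partial products determine
  each other.\<close>

lemma rot_of_eq_iff:
  assumes "pss \<in> chain_words" "qss \<in> chain_words"
  shows "rot_of pss = rot_of qss \<longleftrightarrow> (\<forall>j \<in> {1..<r}. prefix_perm pss j = prefix_perm qss j)"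
proof -
  note p = chain_words_props[OF assms(1)] and q = chain_words_props[OF assms(2)]
  let ?P = "\<lambda>j. apply_transps (pss ! j)" and ?Q = "\<lambda>j. apply_transps (qss ! j)"
  have Pp: "?P j permutes {..<d}" if "j < r" for j using p that by (intro transps_on_permutes) simp
  have Qp: "?Q j permutes {..<d}" if "j < r" for j using q that by (intro transps_on_permutes) simp
  have pS: "prefix_perm pss (Suc j) = prefix_perm pss j \<circ> ?P j" if "j < r" for j
    using that p(1) by (simp add: prefix_perm_def take_Suc_conv_app_nth)
  have qS: "prefix_perm qss (Suc j) = prefix_perm qss j \<circ> ?Q j" if "j < r" for j
    using that q(1) by (simp add: prefix_perm_def take_Suc_conv_app_nth)
  show ?thesis
  proof
    assume eq: "rot_of pss = rot_of qss"
    have "?P j i = ?Q j i" if "j < r" for j i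
    proof (cases "i < d")
      case False
      then show ?thesis using permutes_not_in[OF Pp[OF that]] permutes_not_in[OF Qp[OF that]] by simp
    next
      case True
      note pl = level_perm_less[OF p that True] and ql = level_perm_less[OF q that True]
      have e: "rot_of pss (emb j i) = rot_of qss (emb j i)" using eq by simp
      show ?thesis
      proof (cases "j = 0")
        case False
        then have "emb (j - 1) (?P j i) = emb (j - 1) (?Q j i)"
          using e rot_of_emb[OF p that True] rot_of_emb[OF q that True] by simp
        then show ?thesis using emb_inj by (auto dest: injD)
      next
        case True
        then have "emb (r - 1) (sucd (?P j i)) = emb (r - 1) (sucd (?Q j i))"
          using e rot_of_emb[OF p that \<open>i < d\<close>] rot_of_emb[OF q that \<open>i < d\<close>] by simp
        then have "sucd (?P j i) = sucd (?Q j i)" using emb_inj by (auto dest: injD)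
        then show ?thesis using prd_sucd(1)[OF pl] prd_sucd(1)[OF ql] by metis
      qed
    qed
    then have PQ: "?P j = ?Q j" if "j < r" for j using that by (intro ext) simp
    have "prefix_perm pss j = prefix_perm qss j" if "j \<le> r" for j
      using that
    proof (induction j)
      case (Suc j)
      then show ?case using pS[of j] qS[of j] PQ[of j] by simp
    qed (simp add: prefix_perm_def)
    then show "\<forall>j \<in> {1..<r}. prefix_perm pss j = prefix_perm qss j" by simp
  next
    assume eq: "\<forall>j \<in> {1..<r}. prefix_perm pss j = prefix_perm qss j"
    have all: "prefix_perm pss j = prefix_perm qss j" if jr: "j \<le> r" for j
    proof -
      consider "j = 0" | "1 \<le> j" "j < r" | "j = r" using jr by linarith
      then show ?thesis
      proof cases
        case 3
        then show ?thesis using assms p(1) q(1) by (simp add: prefix_perm_def chain_words_def)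
      qed (use eq in \<open>auto simp: prefix_perm_def\<close>)
    qed
    have PQ: "?P j = ?Q j" if j: "j < r" for j
    proof
      fix i
      have "prefix_perm pss j (?P j i) = prefix_perm pss j (?Q j i)"
        using fun_cong[OF pS[OF j], of i] fun_cong[OF qS[OF j], of i] all[of j] all[of "Suc j"] j by simp
      moreover have "inj (prefix_perm pss j)"
        unfolding prefix_perm_def
        by (rule permutes_inj[OF transps_on_permutes[OF chain_words_split(1)[OF assms(1)]]])
      ultimately show "?P j i = ?Q j i" by (auto dest: injD)
    qed
    show "rot_of pss = rot_of qss"
    proof
      fix v
      consider "v = 0" | "0 < v" "v < n" | "n \<le> v" by linarith
      then show "rot_of pss v = rot_of qss v"
      proof cases
        case 2
        then obtain j i where ji: "j < r" "i < d" "v = emb j i" by (rule emb_cases)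
        then show ?thesis
          using rot_of_emb[OF p ji(1,2)] rot_of_emb[OF q ji(1,2)] PQ[of j] PQ[of 0] by simp
      next
        case 3
        then show ?thesis
          using permutes_not_in[OF rot_of_permutes[OF p]] permutes_not_in[OF rot_of_permutes[OF q]]
          by simp
      qed (use rot_of_0[OF p] rot_of_0[OF q] in simp)
    qed
  qed
qed

text \<open>\<open>chain_of\<close> and \<open>rot_of\<close> identify the same lists, so
  multichains are counted by the summit permutations fixing \<open>0\<close>; \<open>chi\<close>
  carries these to the case \<open>k = 1\<close> of the Fuss-Catalan count.\<close>

lemma Zd_card: "Zd n d r = card (nc_perms r d 1)"
proof -
  have "multichains n r (ddelta d) = chain_of ` chain_words"
    using chain_of_multichain multichain_chain_of by blast
  then have "Zd n d r = card (chain_of ` chain_words)" unfolding Zd_def bracket_upt by simp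
  also have "\<dots> = card (rot_of ` chain_words)"
    by (rule card_image_same_kernel) (simp add: chain_of_eq_iff rot_of_eq_iff)
  also have "rot_of ` chain_words = {g \<in> rotperms r d. g 0 = 0}"
  proof (intro equalityI subsetI)
    fix g assume "g \<in> rot_of ` chain_words"
    then show "g \<in> {g \<in> rotperms r d. g 0 = 0}" using rot_of_chain_words by (elim imageE) simp
  next
    fix g assume "g \<in> {g \<in> rotperms r d. g 0 = 0}"
    then show "g \<in> rot_of ` chain_words" using chain_words_rot_of by (simp add: image_iff)
  qed
  also have "card \<dots> = card (nc_perms r d 1)"
  proof -
    have c0: "chi 0 = 0" using n_pos by (simp add: chi_def)
    then have i0: "inv chi 0 = 0" using permutes_inverses(2)[OF chi_permutes, of 0] by simp
    have cc: "chi (inv chi x) = x" "inv chi (chi x) = x" for x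
      using permutes_inverses[OF chi_permutes] by auto
    have gp: "g permutes {..<n}" if "g \<in> rotperms r d" for g using that n by (simp add: rotperms_def)
    have hp: "h permutes {..<n}" if "h \<in> root_perms r d" for h using that n by (simp add: root_perms_def)
    have "bij_betw (\<lambda>g. inv chi \<circ> g \<circ> chi) {g \<in> rotperms r d. g 0 = 0} {h \<in> root_perms r d. h 0 = 0}"
    proof (rule bij_betw_byWitness[where f' = "\<lambda>h. chi \<circ> h \<circ> inv chi"])
      have e1: "chi \<circ> (inv chi \<circ> g \<circ> chi) \<circ> inv chi = g" for g using cc by (simp add: fun_eq_iff)
      have e2: "inv chi \<circ> (chi \<circ> h \<circ> inv chi) \<circ> chi = h" for h using cc by (simp add: fun_eq_iff)
      show "\<forall>g \<in> {g \<in> rotperms r d. g 0 = 0}. chi \<circ> (inv chi \<circ> g \<circ> chi) \<circ> inv chi = g"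
        using e1 by blast
      show "\<forall>h \<in> {h \<in> root_perms r d. h 0 = 0}. inv chi \<circ> (chi \<circ> h \<circ> inv chi) \<circ> chi = h"
        using e2 by blast
      show "(\<lambda>g. inv chi \<circ> g \<circ> chi) ` {g \<in> rotperms r d. g 0 = 0} \<subseteq> {h \<in> root_perms r d. h 0 = 0}"
        using rotperms_chi gp c0 i0 by auto
      have "chi \<circ> h \<circ> inv chi \<in> rotperms r d" if "h \<in> root_perms r d" for h
      proof -
        have "chi \<circ> h \<circ> inv chi permutes {..<n}"
          by (intro permutes_compose permutes_inv chi_permutes hp[OF that])
        then show ?thesis using rotperms_chi[of "chi \<circ> h \<circ> inv chi"] that e2[of h] by simp
      qed
      then show "(\<lambda>h. chi \<circ> h \<circ> inv chi) ` {h \<in> root_perms r d. h 0 = 0} \<subseteq> {g \<in> rotperms r d. g 0 = 0}"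
        using c0 i0 by auto
    qed
    then show ?thesis unfolding nc_perms_eq_root_perms[OF r] by (rule bij_betw_same_card)
  qed
  finally show ?thesis .
qed

lemma n_times_Zd: "n * Zd n d r = n choose d"
  unfolding Zd_card using card_root_perms[OF r, of d] card_root_perms_binomial[OF r, of d] n by simp

end

theorem theorem3p4:
  fixes n r d :: nat
  assumes "r \<ge> 2" and "d \<ge> 1" and "n = r * d + 1"
  defines "eps \<equiv> ddelta n @ band 2 1"
  shows "real (card (super_summit n (concat (replicate d eps)))) = real n * real (Zd n d r)
       \<and> real n * real (Zd n d r) = real n / real d * real ((d * r) choose (d - 1))
       \<and> real n / real d * real ((d * r) choose (d - 1)) = real n / real d * real ((n - 1) choose (d - 1))"
proof -
  interpret eps_power r d n by standard (fact assms)+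
  have nZ: "real n * real (Zd n d r) = real (n choose d)"
    using n_times_Zd by (metis of_nat_mult)
  have "card (super_summit n (concat (replicate d eps))) = n choose d"
    unfolding eps_def by (rule card_super_summit)
  moreover have dr: "d * r = n - 1" using assms(3) by (simp add: mult.commute)
  moreover have "real (n choose d) = real n / real d * real ((n - 1) choose (d - 1))"
  proof -
    have "d * (n choose d) = n * ((n - 1) choose (d - 1))"
      using times_binomial_minus1_eq[of d n] assms(2) by simp
    then have "real d * real (n choose d) = real n * real ((n - 1) choose (d - 1))"
      by (metis of_nat_mult)
    then show ?thesis using assms(2) by (simp add: field_simps)
  qed
  ultimately show ?thesis using nZ by simp
qed

end
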